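(* Let $n\geq 4$ be a positive integer and let $\mathcal{L}^i_n=\{L^i_1,L^i_2,\ldots,L^i_n\}$, $i=1,2$, be two line arrangements in the plane. Let $\theta^i_j$ be the angle made by $L^i_j$ with respect to the positive $X$-axis and suppose $0<\theta^i_1<\theta^i_2<\cdots<\theta^i_n<\pi$ for $i=1,2$. Suppose in addition that both line arrangements have global cyclicity, with anti-clockwise gonality $n$-cycles $(1=a^i_1a^i_2\ldots a^i_n)$, $i=1,2$, respectively. Then the following are equivalent. (1) The line arrangements $\mathcal{L}^1_n$ and $\mathcal{L}^2_n$ are isomorphic by an isomorphism which is trivial on subscripts (i.e. $L^1_j\mapsto L^2_j$ for $1\le j\le n$ is an isomorphism). (2) The gonality cycles $(1=a^1_1a^1_2\ldots a^1_n)$ and $(1=a^2_1a^2_2\ldots a^2_n)$ are equal. (3) For any $1\leq i<j<k\leq n$, the lines $L^1_i,L^1_j,L^1_k$ form a triangle of the arrangement $\mathcal{L}^1_n$ if and only if the lines $L^2_i,L^2_j,L^2_k$ form a triangle of the arrangement $\mathcal{L}^2_n$. There are at most two equivalence classes of triangles in each such arrangement. Moreover, for $i=1,2$, if $2\leq r\leq n-1$ is such that $1=a^i_1<a^i_2<\cdots<a^i_r$, $a^i_{r+1}<a^i_{r+2}<\cdots<a^i_n$ and $1=a^i_1<a^i_{r+1}<a^i_r$, then the triangles of $\mathcal{L}^i_n$ are given by - $\Delta L^i_{a^i_j}L^i_{a^i_{j+1}}L^i_{a^i_{j+2}}$ for $1\leq j<j+2\leq r$ or $r+1\leq j<j+2\leq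 n$; - $\Delta L^i_{a^i_1}L^i_{a^i_{n-1}}L^i_{a^i_n}$ if $n\geq r+2$; - $\Delta L^i_{a^i_1}L^i_{a^i_2}L^i_{a^i_n}$ if $a^i_2<a^i_n$; - $\Delta L^i_{a^i_{r+1}}L^i_{a^i_{r-1}}L^i_{a^i_r}$ if $a^i_{r+1}<a^i_{r-1}$; - $\Delta L^i_{a^i_{r+1}}L^i_{a^i_{r+2}}L^i_{a^i_r}$ if $a^i_{r+2}<a^i_r$ and $n\geq r+2$. There are $2^{n-1}-n$ such isomorphism classes, i.e. isomorphism classes, under isomorphisms trivial on subscripts, of $n$-line arrangements with global cyclicity whose lines are numbered by increasing angle in $(0,\pi)$.
   Context: Line arrangement: a finite set $\mathcal{L}_n=\{L_1,\ldots,L_n\}$ of lines in $\mathbb{R}^2$ such that no two are parallel and no three are concurrent. Isomorphism: a bijection $\phi:\{L^1_1,\ldots,L^1_n\}\to\{L^2_1,\ldots,L^2_n\}$ between two line arrangements, written $\phi(L^1_i)=L^2_{\phi(i)}$, such that for each $i$ the linear order of the intersection points with the other lines along $L^1_i$ agrees with that along $L^2_{\phi(i)}$, via the bijection induced by $\phi$ on subscripts, up to reversal (each line carries two mutually opposite orders). It is trivial on subscripts if $\phi(i)=i$ for all $i$. Triangle of an arrangement: $L_a,L_b,L_c$ form a triangle $\Delta L_aL_bL_c$ of the arrangement if the triangle bounded by these three lines is a (bounded) region of the arrangement, i.e. it is not subdivided by the other lines. Equivalence of triangles: two triangles $\Delta L_aL_bL_c$ and $\Delta L_dL_eL_f$ of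 the arrangement are corner adjacent if $\{a,b,c\}\cap\{d,e,f\}$ has precisely two elements. Two triangles of the arrangement are equivalent if they are the same or are joined by a finite sequence of triangles of the arrangement in which consecutive triangles are corner adjacent. Global cyclicity: an arrangement $\mathcal{L}_n=\{L_1,\ldots,L_n\}$, with angles $0<\theta_1<\cdots<\theta_n<\pi$ of the lines with respect to the positive $X$-axis, has global cyclicity if all $n$ lines form the sides of a convex $n$-gon (which is a region of the arrangement) in some cyclic order. If the sides of this $n$-gon in anti-clockwise cyclic order are $L_{a_1}\to L_{a_2}\to\cdots\to L_{a_n}\to L_{a_1}$ with $a_1=1$, then the gonality $n$-cycle is $(1=a_1a_2\ldots a_n)$. For every such cycle there exists $2\leq r\leq n-1$ with $1=a_1<a_2<\cdots<a_r$, $a_{r+1}<a_{r+2}<\cdots<a_n$ and $1<a_{r+1}<a_r$. *)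

theory Defs
  imports "HOL-Analysis.Analysis" "HOL-Combinatorics.Cycles"
begin

definition is_line :: "(real^2) set \<Rightarrow> bool" where
  "is_line l \<longleftrightarrow> affine l \<and> aff_dim l = 1"

definition line_arrangement :: "(real^2) set set \<Rightarrow> bool" where
  "line_arrangement A \<longleftrightarrow>
     finite A \<and> (\<forall>l\<in>A. is_line l) \<and>
     (\<forall>l\<in>A. \<forall>m\<in>A. l \<noteq> m \<longrightarrow> \<not> affine_parallel l m) \<and>
     (\<forall>l\<in>A. \<forall>m\<in>A. \<forall>k\<in>A. l \<noteq> m \<and> l \<noteq> k \<and> m \<noteq> k \<longrightarrow> l \<inter> m \<inter> k = {})"

text \<open>A numbered arrangement is a family of lines, of which only the values at the
  subscripts \<open>1, \<dots>, n\<close> matter.\<close>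

definition numbered_arrangement :: "nat \<Rightarrow> (nat \<Rightarrow> (real^2) set) \<Rightarrow> bool" where
  "numbered_arrangement n L \<longleftrightarrow> inj_on L {1..n} \<and> line_arrangement (L ` {1..n})"

definition has_angle :: "(real^2) set \<Rightarrow> real \<Rightarrow> bool" where
  "has_angle l \<theta> \<longleftrightarrow> (\<exists>p. l = range (\<lambda>t. p + t *\<^sub>R vector [cos \<theta>, sin \<theta>]))"

definition increasing_angles ::
    "nat \<Rightarrow> (nat \<Rightarrow> (real^2) set) \<Rightarrow> (nat \<Rightarrow> real) \<Rightarrow> bool" where
  "increasing_angles n L \<theta> \<longleftrightarrow>
     (\<forall>j\<in>{1..n}. has_angle (L j) (\<theta> j) \<and> 0 < \<theta> j \<and> \<theta> j < pi) \<and>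
     strict_mono_on {1..n} \<theta>"

definition regions :: "(real^2) set set \<Rightarrow> (real^2) set set" where
  "regions A = components (- \<Union>A)"

definition meet :: "(real^2) set \<Rightarrow> (real^2) set \<Rightarrow> real^2" where
  "meet l m = (THE p. p \<in> l \<inter> m)"

definition direction_of :: "real^2 \<Rightarrow> (real^2) set \<Rightarrow> bool" where
  "direction_of u l \<longleftrightarrow> u \<noteq> 0 \<and> (\<forall>p\<in>l. p + u \<in> l)"

text \<open>The linear order along a line determined by the direction \<open>u\<close>; the opposite
  direction gives the reversed order.\<close>

definition precedes :: "real^2 \<Rightarrow> real^2 \<Rightarrow> real^2 \<Rightarrow> bool" where
  "precedes u p q \<longleftrightarrow> u \<bullet> p < u \<bullet> q"

text \<open>``Agree up to reversal'' is the existence of directions \<open>u\<close>, \<open>w\<close> of the two lines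
  for which the orders agree.\<close>

definition arrangement_iso ::
    "((real^2) set \<Rightarrow> (real^2) set) \<Rightarrow> (real^2) set set \<Rightarrow> (real^2) set set \<Rightarrow> bool" where
  "arrangement_iso \<phi> A B \<longleftrightarrow>
     bij_betw \<phi> A B \<and>
     (\<forall>l\<in>A. \<exists>u w. direction_of u l \<and> direction_of w (\<phi> l) \<and>
        (\<forall>m\<in>A - {l}. \<forall>k\<in>A - {l}.
           precedes u (meet l m) (meet l k) \<longleftrightarrow>
           precedes w (meet (\<phi> l) (\<phi> m)) (meet (\<phi> l) (\<phi> k))))"

definition iso_trivial_on_subscripts ::
    "nat \<Rightarrow> (nat \<Rightarrow> (real^2) set) \<Rightarrow> (nat \<Rightarrow> (real^2) set) \<Rightarrow> bool" where
  "iso_trivial_on_subscripts n L M \<longleftrightarrow>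
     (\<exists>\<phi>. arrangement_iso \<phi> (L ` {1..n}) (M ` {1..n}) \<and> (\<forall>j\<in>{1..n}. \<phi> (L j) = M j))"

text \<open>For three lines of an arrangement the three pairwise intersections below are the
  vertices of the triangle that they bound.\<close>

definition forms_triangle ::
    "nat \<Rightarrow> (nat \<Rightarrow> (real^2) set) \<Rightarrow> nat \<Rightarrow> nat \<Rightarrow> nat \<Rightarrow> bool" where
  "forms_triangle n L a b c \<longleftrightarrow>
     a \<in> {1..n} \<and> b \<in> {1..n} \<and> c \<in> {1..n} \<and> a \<noteq> b \<and> a \<noteq> c \<and> b \<noteq> c \<and>
     interior (convex hull (L a \<inter> L b \<union> L b \<inter> L c \<union> L a \<inter> L c)) \<in> regions (L ` {1..n})"

text \<open>A triangle is represented by the set of its three subscripts.\<close>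

definition triangles :: "nat \<Rightarrow> (nat \<Rightarrow> (real^2) set) \<Rightarrow> nat set set" where
  "triangles n L = {{a, b, c} | a b c. forms_triangle n L a b c}"

definition corner_adjacent :: "nat set \<Rightarrow> nat set \<Rightarrow> bool" where
  "corner_adjacent S T \<longleftrightarrow> card (S \<inter> T) = 2"

definition triangle_equivalence ::
    "nat \<Rightarrow> (nat \<Rightarrow> (real^2) set) \<Rightarrow> (nat set \<times> nat set) set" where
  "triangle_equivalence n L =
     {(S, T). S \<in> triangles n L \<and> T \<in> triangles n L \<and>
        (S, T) \<in> {(S, T). S \<in> triangles n L \<and> T \<in> triangles n L \<and> corner_adjacent S T}\<^sup>*}"

text \<open>Twice the signed area of the triangle \<open>p q r\<close>; it is positive iff \<open>r\<close> lies strictly to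
  the left of the directed line from \<open>p\<close> to \<open>q\<close>.\<close>

definition signed_area2 :: "real^2 \<Rightarrow> real^2 \<Rightarrow> real^2 \<Rightarrow> real" where
  "signed_area2 p q r = (q$1 - p$1) * (r$2 - p$2) - (q$2 - p$2) * (r$1 - p$1)"

text \<open>Vertices, sides and lines are numbered \<open>1, \<dots>, n\<close>, and \<open>Suc (j mod n)\<close> is the cyclic
  successor of \<open>j\<close>. The vertices \<open>v 1, \<dots>, v n\<close> are those of a convex \<open>n\<close>-gon in
  anti-clockwise order iff every side has all the other vertices strictly on its left.\<close>

definition anticlockwise_convex_ngon :: "nat \<Rightarrow> (nat \<Rightarrow> real^2) \<Rightarrow> bool" where
  "anticlockwise_convex_ngon n v \<longleftrightarrow>
     3 \<le> n \<and>
     (\<forall>j\<in>{1..n}. \<forall>k\<in>{1..n} - {j, Suc (j mod n)}. signed_area2 (v j) (v (Suc (j mod n))) (v k) > 0)"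

text \<open>The lines \<open>L (a 1), \<dots>, L (a n)\<close> carry, in this anti-clockwise cyclic order, the sides
  of a convex \<open>n\<close>-gon that is a region of the arrangement; the side on \<open>L (a j)\<close> joins \<open>v j\<close>
  to its cyclic successor.\<close>

definition ngon_sides ::
    "nat \<Rightarrow> (nat \<Rightarrow> (real^2) set) \<Rightarrow> (nat \<Rightarrow> nat) \<Rightarrow> bool" where
  "ngon_sides n L a \<longleftrightarrow>
     bij_betw a {1..n} {1..n} \<and>
     (\<exists>v. anticlockwise_convex_ngon n v \<and>
          (\<forall>j\<in>{1..n}. v j \<in> L (a j) \<and> v (Suc (j mod n)) \<in> L (a j)) \<and>
          interior (convex hull (v ` {1..n})) \<in> regions (L ` {1..n}))"

definition global_cyclicity :: "nat \<Rightarrow> (nat \<Rightarrow> (real^2) set) \<Rightarrow> bool" where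
  "global_cyclicity n L \<longleftrightarrow> (\<exists>a. ngon_sides n L a)"

definition gonality_cycle :: "nat \<Rightarrow> (nat \<Rightarrow> nat) \<Rightarrow> nat \<Rightarrow> nat" where
  "gonality_cycle n a = cycle_of_list (map a [1..<Suc n])"

definition globally_cyclic_arrangements :: "nat \<Rightarrow> (nat \<Rightarrow> (real^2) set) set" where
  "globally_cyclic_arrangements n =
     {L. numbered_arrangement n L \<and> (\<exists>\<theta>. increasing_angles n L \<theta>) \<and> global_cyclicity n L}"

text \<open>Families that agree on \<open>1, \<dots>, n\<close> are related, so the values elsewhere do not
  affect the number of classes.\<close>

definition trivial_iso_relation ::
    "nat \<Rightarrow> ((nat \<Rightarrow> (real^2) set) \<times> (nat \<Rightarrow> (real^2) set)) set" where
  "trivial_iso_relation n =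
     {(L, M). L \<in> globally_cyclic_arrangements n \<and> M \<in> globally_cyclic_arrangements n \<and>
        iso_trivial_on_subscripts n L M}"

end

theory Submission
  imports Defs
begin

text \<open>Direct the lines so that the polygon lies on the left of each, and number them by their
  position on the polygon. Two signs then control everything: that of \<open>D i j\<close>, the turn from the
  direction of side \<open>i\<close> to that of side \<open>j\<close>, and that of \<open>Del i j k\<close>, the determinant of three
  lines. Convexity makes \<open>Del i j k\<close> positive for \<open>i < j < k\<close>, and it makes the directions run once
  around the circle, so that the gonality cycle consists of two ascending runs (the lines directed at
  their angle \<open>\<theta>\<close>, then those directed at \<open>\<theta> + \<pi>\<close>) and determines all the signs of \<open>D\<close>.

  The order of the crossings on line \<open>i\<close> is given by the signs of \<open>Del i j k * D i j * D i k\<close>, so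
  equal cycles give isomorphic arrangements. Three lines form a triangle iff no further line
  separates its vertices; by the signs this happens exactly for three cyclically consecutive sides whose
  outer two make a left turn. At most two consecutive triples fail this, and if two do then they are
  adjacent. Hence the triangles form one chain, which for \<open>n \<ge> 5\<close> recovers the cycle up to
  reversal; the reversed cycle would have too many descents. Every cycle consisting of two such runs
  is realised by tangents of the unit circle.\<close>

text \<open>The outer turn decides everything because the exterior angles of the polygon add up to a
  full turn. So of the three arcs into which three sides cut the polygon at most one turns by more
  than a half-turn, and two failing triples whose arcs were disjoint would already exceed a full
  turn. The proof never measures these angles. It knows only signs, and replaces the angle sum by
  the combinatorial facts \<open>two_turns\<close> and \<open>failing_triples_adjacent\<close>.

  Recovering the cycle from the triangles needs five sides: with four, two triples of consecutive
  sides may share a pair of opposite sides, so that neighbours can no longer be recognised as common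
  pairs. The cycles for \<open>n = 4\<close> are therefore listed and compared.

  Tangents of the unit circle suit the realisation because their \<open>Del\<close> is twice the
  signed area of the triangle inscribed in the circle with vertices at the three unit directions, so
  its sign depends on their cyclic order alone.\<close>

section \<open>Families of lines in the plane\<close>

text \<open>Otherwise \<open>{1..n}\<close> is rewritten to \<open>{Suc 0..n}\<close>.\<close>

declare One_nat_def [simp del]

definition det2 :: "real^2 \<Rightarrow> real^2 \<Rightarrow> real" where
  "det2 u w = u$1 * w$2 - u$2 * w$1"

lemma det2_simps [simp]:
  "det2 u (x + y) = det2 u x + det2 u y" "det2 (x + y) u = det2 x u + det2 y u"
  "det2 u (x - y) = det2 u x - det2 u y" "det2 (x - y) u = det2 x u - det2 y u"
  "det2 u (c *\<^sub>R x) = c * det2 u x" "det2 (c *\<^sub>R x) u = c * det2 x u"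
  "det2 u (- x) = - det2 u x" "det2 (- x) u = - det2 x u"
  "det2 u u = 0" "det2 0 u = 0" "det2 u 0 = 0"
  by (auto simp: det2_def algebra_simps)

lemma det2_swap: "det2 u w = - det2 w u"
  by (simp add: det2_def algebra_simps)

text \<open>Cramer's rule for \<open>w\<close> in terms of \<open>x\<close> and \<open>y\<close>,
  cleared of its denominator. It serves to write a vector in terms of two adjacent sides of the
  polygon.\<close>

lemma det2_expand: "det2 x y *\<^sub>R w = det2 x w *\<^sub>R y - det2 y w *\<^sub>R x"
  by (simp add: det2_def vec_eq_iff forall_2 algebra_simps)

lemma det2_eq_inner: "det2 u x = vector [- (u$2), u$1] \<bullet> x"
  by (simp add: det2_def inner_vec_def sum_2)

lemma det2_eqI:
  assumes "det2 u w \<noteq> 0" "det2 u x = det2 u y" "det2 w x = det2 w y"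
  shows "x = y"
proof -
  have "det2 u w *\<^sub>R (x - y) = 0"
    using assms by (simp add: det2_expand)
  then show ?thesis using assms by simp
qed

lemma det2_zero_imp_scaleR:
  assumes "e \<noteq> 0" "det2 e u = 0" obtains c where "u = c *\<^sub>R e"
proof (cases "e$1 = 0")
  case True
  then have "e$2 \<noteq> 0" using assms by (auto simp: vec_eq_iff forall_2)
  then have "u = (u$2 / e$2) *\<^sub>R e" using True assms by (auto simp: det2_def vec_eq_iff forall_2)
  then show ?thesis by (rule that)
next
  case False
  then have "u = (u$1 / e$1) *\<^sub>R e"
    using assms by (auto simp: det2_def vec_eq_iff forall_2 field_simps)
  then show ?thesis by (rule that)
qed

lemma signed_area2_eq: "signed_area2 p q r = det2 (q - p) (r - p)"
  by (simp add: signed_area2_def det2_def)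

lemma zero_less_mult_pos_iff: "0 < b \<Longrightarrow> 0 < a * b \<longleftrightarrow> 0 < a" for a b :: real
  by (simp add: zero_less_mult_iff)

lemma square_pos_iff: "0 < a * a \<longleftrightarrow> a \<noteq> 0" for a :: real
  by (auto simp: zero_less_mult_iff)

lemma zero_less_divide_iff_mult: "0 < a / b \<longleftrightarrow> 0 < a * b" for a b :: real
  by (simp add: zero_less_mult_iff zero_less_divide_iff)

lemma same_sign_trans: "0 < x * a \<Longrightarrow> 0 < x * b \<Longrightarrow> 0 < a * b" for a b x :: real
  by (auto simp: zero_less_mult_iff)

text \<open>A direction vector \<open>e k\<close> of any length and orientation replaces the angle,
  so that the locale covers both the lines directed at their angles and the same lines directed as
  sides of the polygon.\<close>

locale line_family =
  fixes n :: nat and l :: "nat \<Rightarrow> (real^2) set" and e :: "nat \<Rightarrow> real^2" and h :: "nat \<Rightarrow> real"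
  assumes line: "k \<in> {1..n} \<Longrightarrow> l k = {x. det2 (e k) x = h k}"
    and cross: "i \<in> {1..n} \<Longrightarrow> j \<in> {1..n} \<Longrightarrow> i \<noteq> j \<Longrightarrow> det2 (e i) (e j) \<noteq> 0"
    and no_concurrence: "i \<in> {1..n} \<Longrightarrow> j \<in> {1..n} \<Longrightarrow> k \<in> {1..n} \<Longrightarrow> i \<noteq> j \<Longrightarrow> i \<noteq> k \<Longrightarrow> j \<noteq> k \<Longrightarrow>
      h i * det2 (e j) (e k) + h j * det2 (e k) (e i) + h k * det2 (e i) (e j) \<noteq> 0"
begin

definition D :: "nat \<Rightarrow> nat \<Rightarrow> real" where "D i j = det2 (e i) (e j)"

definition F :: "nat \<Rightarrow> real^2 \<Rightarrow> real" where "F k x = det2 (e k) x - h k"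

text \<open>Minus the 3 by 3 determinant of the coefficients \<open>(e, h)\<close> of three lines,
  expanded along the \<open>h\<close> column; the sign is the one that makes \<open>Del_eq\<close>
  free of minus signs.\<close>

definition Del :: "nat \<Rightarrow> nat \<Rightarrow> nat \<Rightarrow> real" where
  "Del i j k = - (h i * D j k + h j * D k i + h k * D i j)"

definition P :: "nat \<Rightarrow> nat \<Rightarrow> real^2" where
  "P i j = (1 / D i j) *\<^sub>R (h i *\<^sub>R e j - h j *\<^sub>R e i)"

lemma D_swap: "D i j = - D j i"
  unfolding D_def by (rule det2_swap)

lemma D_nz: "i \<in> {1..n} \<Longrightarrow> j \<in> {1..n} \<Longrightarrow> i \<noteq> j \<Longrightarrow> D i j \<noteq> 0"
  unfolding D_def by (rule cross)

lemma P_swap: "P i j = P j i"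
  by (simp add: P_def D_swap[of i j] algebra_simps)

text \<open>The terms in \<open>x\<close> cancel by the linear relation of three vectors in the
  plane (\<open>det2_expand\<close>). Since \<open>x\<close> is arbitrary, it can be chosen on one
  of the lines, which removes a summand and shows the sign of \<open>Del\<close>.\<close>

lemma Del_eq: "Del i j k = F i x * D j k + F j x * D k i + F k x * D i j"
  by (simp add: Del_def F_def D_def det2_def algebra_simps)

lemma Del_rot: "Del i j k = Del j k i" and Del_swap: "Del i j k = - Del j i k"
  by (simp_all add: Del_def D_swap[of j i] D_swap[of k j] D_swap[of i k] algebra_simps)

lemma Del_nz:
  "i \<in> {1..n} \<Longrightarrow> j \<in> {1..n} \<Longrightarrow> k \<in> {1..n} \<Longrightarrow> i \<noteq> j \<Longrightarrow> i \<noteq> k \<Longrightarrow> j \<noteq> k \<Longrightarrow> Del i j k \<noteq> 0"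
  using no_concurrence[of i j k] by (simp add: Del_def D_def)

text \<open>This is \<open>Del_eq\<close> at the crossing of lines \<open>i\<close> and
  \<open>j\<close>, where \<open>F i\<close> and \<open>F j\<close> vanish. The side of line
  \<open>m\<close> on which a crossing lies thus depends on two signs only.\<close>

lemma F_P: assumes "D i j \<noteq> 0" shows "F m (P i j) = Del i j m / D i j"
proof -
  have "F m (P i j) * D i j = Del i j m"
    using assms by (simp add: F_def P_def Del_def field_simps) (simp add: D_def det2_def algebra_simps)
  then show ?thesis using assms by (simp add: field_simps)
qed

lemma F_P_self: assumes "D i j \<noteq> 0" shows "F i (P i j) = 0" "F j (P i j) = 0"
  using assms by (auto simp: F_P Del_def D_def D_swap[of j i]) (auto simp: det2_swap[of "e j" "e i"])

lemma on_line: "k \<in> {1..n} \<Longrightarrow> x \<in> l k \<longleftrightarrow> F k x = 0"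
  by (auto simp: line F_def)

lemma F_affine: "u + v + w = 1 \<Longrightarrow> F m (u *\<^sub>R x + v *\<^sub>R y + w *\<^sub>R z) = u * F m x + v * F m y + w * F m z"
proof -
  assume "u + v + w = 1"
  then have "w = 1 - u - v" by simp
  then show ?thesis by (simp only: F_def det2_simps) (simp add: algebra_simps)
qed

lemma inter_lines:
  assumes "i \<in> {1..n}" "j \<in> {1..n}" "i \<noteq> j" shows "l i \<inter> l j = {P i j}"
proof -
  note D = D_nz[OF assms]
  have "F i x = 0 \<and> F j x = 0 \<longleftrightarrow> x = P i j" for x
    using F_P_self[OF D] D det2_eqI[of "e i" "e j" x "P i j"] by (auto simp: F_def D_def)
  then show ?thesis by (simp add: set_eq_iff on_line[OF assms(1)] on_line[OF assms(2)])
qed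

lemma meet_eq: assumes "i \<in> {1..n}" "j \<in> {1..n}" "i \<noteq> j" shows "meet (l i) (l j) = P i j"
  unfolding meet_def inter_lines[OF assms] by simp

text \<open>Both crossings lie on line \<open>i\<close>, so the difference is a multiple of
  \<open>e i\<close>; the factor is found from the values of \<open>F k\<close> at the two
  points.\<close>

lemma P_diff:
  assumes "i \<in> {1..n}" "j \<in> {1..n}" "k \<in> {1..n}" "i \<noteq> j" "i \<noteq> k"
  shows "P i k - P i j = (Del i j k / (D i j * D i k)) *\<^sub>R e i"
proof (rule det2_eqI[of "e i" "e k"])
  note D = D_nz[OF assms(1,2,4)] D_nz[OF assms(1,3,5)]
  note z = F_P_self[OF D(1)] F_P_self[OF D(2)]
  show "det2 (e i) (e k) \<noteq> 0" using D(2) unfolding D_def .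
  show "det2 (e i) (P i k - P i j) = det2 (e i) ((Del i j k / (D i j * D i k)) *\<^sub>R e i)"
    using z by (simp add: F_def)
  have "det2 (e k) (P i k - P i j) = F k (P i k) - F k (P i j)" by (simp add: F_def)
  also have "\<dots> = - Del i j k / D i j"
    by (simp add: z F_P[OF D(1)])
  also have "\<dots> = (Del i j k / (D i j * D i k)) * D k i"
    using D by (simp add: D_swap[of k i])
  finally show "det2 (e k) (P i k - P i j) = det2 (e k) ((Del i j k / (D i j * D i k)) *\<^sub>R e i)"
    by (simp add: D_def)
qed

lemma direction_of_iff:
  assumes "i \<in> {1..n}" "e i \<noteq> 0"
  shows "direction_of u (l i) \<longleftrightarrow> (\<exists>c. c \<noteq> 0 \<and> u = c *\<^sub>R e i)"
proof
  assume u: "direction_of u (l i)"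
  have ne: "(e i)$1 \<noteq> 0 \<or> (e i)$2 \<noteq> 0"
    using assms by (simp add: vec_eq_iff forall_2)
  have "\<exists>p. det2 (e i) p = h i"
  proof (cases "(e i)$1 = 0")
    case True
    then show ?thesis using ne
      by (intro exI[of _ "vector [- h i / (e i)$2, 0]"]) (simp add: det2_def)
  next
    case False
    then show ?thesis by (intro exI[of _ "vector [0, h i / (e i)$1]"]) (simp add: det2_def)
  qed
  then obtain p where "p \<in> l i" using assms by (auto simp: line)
  then have z: "det2 (e i) u = 0" "u \<noteq> 0"
    using u assms by (auto simp: direction_of_def line)
  obtain c where "u = c *\<^sub>R e i" using det2_zero_imp_scaleR[OF assms(2) z(1)] .
  then show "\<exists>c. c \<noteq> 0 \<and> u = c *\<^sub>R e i" using z by auto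
next
  assume "\<exists>c. c \<noteq> 0 \<and> u = c *\<^sub>R e i"
  then show "direction_of u (l i)" using assms by (auto simp: direction_of_def line)
qed

text \<open>The sign of the factor in \<open>P_diff\<close>, with the quotient replaced by a product
  of the same sign. The scalar \<open>c\<close> accounts for both directions of the line.\<close>

lemma precedes_iff:
  assumes "i \<in> {1..n}" "j \<in> {1..n}" "k \<in> {1..n}" "i \<noteq> j" "i \<noteq> k"
  shows "precedes (c *\<^sub>R e i) (P i j) (P i k) \<longleftrightarrow> c * (Del i j k * D i j * D i k) > 0"
proof -
  have D: "D i j \<noteq> 0" "D i k \<noteq> 0" using D_nz assms by auto
  then have "e i \<noteq> 0" by (auto simp: D_def)
  then have ee: "e i \<bullet> e i > 0" by simp
  have "precedes (c *\<^sub>R e i) (P i j) (P i k) \<longleftrightarrow> c * (e i \<bullet> (P i k - P i j)) > 0"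
    by (simp add: precedes_def inner_diff_right algebra_simps)
  also have "\<dots> \<longleftrightarrow> (c * (Del i j k / (D i j * D i k))) * (e i \<bullet> e i) > 0"
    unfolding P_diff[OF assms] by (simp add: mult.assoc)
  also have "\<dots> \<longleftrightarrow> c * (Del i j k / (D i j * D i k)) > 0"
    by (rule zero_less_mult_pos_iff[OF ee])
  also have "\<dots> \<longleftrightarrow> c * (Del i j k / (D i j * D i k)) * ((D i j * D i k) * (D i j * D i k)) > 0"
    using D by (intro zero_less_mult_pos_iff[symmetric]) (simp add: square_pos_iff)
  also have "c * (Del i j k / (D i j * D i k)) * ((D i j * D i k) * (D i j * D i k)) = c * (Del i j k * D i j * D i k)"
    using D by (simp add: field_simps)
  finally show ?thesis .
qed

lemma convex_cell: "convex {y. \<forall>m\<in>I. c m * F m y > 0}"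
proof -
  have "{y. \<forall>m\<in>I. c m * F m y > 0} =
     (\<Inter>m\<in>I. {y. (c m *\<^sub>R vector [- (e m$2), e m$1]) \<bullet> y > c m * h m})"
    by (auto simp: F_def det2_eq_inner algebra_simps)
  moreover have "convex \<dots>" by (intro convex_INT ballI convex_halfspace_gt)
  ultimately show ?thesis by simp
qed

text \<open>The cell is convex and avoids all lines, hence lies in the component. Conversely, a
  connected set with points on both sides of line \<open>m\<close> meets that line by the
  intermediate value property.\<close>

lemma connected_component_cell:
  assumes x: "\<forall>m\<in>{1..n}. F m x \<noteq> 0"
  shows "connected_component_set (- \<Union> (l ` {1..n})) x = {y. \<forall>m\<in>{1..n}. F m x * F m y > 0}"
    (is "?C = ?R")
proof
  have x': "x \<in> - \<Union> (l ` {1..n})" using x by (auto simp: on_line)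
  show "?R \<subseteq> ?C"
  proof (rule connected_component_maximal)
    show "x \<in> ?R" using x by (simp add: square_pos_iff)
    show "connected ?R" by (intro convex_connected convex_cell)
    show "?R \<subseteq> - \<Union> (l ` {1..n})" by (fastforce simp: on_line)
  qed
  show "?C \<subseteq> ?R"
  proof safe
    fix y m assume y: "connected_component (- \<Union> (l ` {1..n})) x y" and m: "m \<in> {1..n}"
    show "0 < F m x * F m y"
    proof (rule ccontr)
      let ?a = "vector [- (e m$2), e m$1] :: real^2"
      assume "\<not> 0 < F m x * F m y"
      then have *: "?a \<bullet> x \<le> h m \<and> h m \<le> ?a \<bullet> y \<or> ?a \<bullet> y \<le> h m \<and> h m \<le> ?a \<bullet> x"
        by (auto simp: F_def det2_eq_inner zero_less_mult_iff)
      have c: "connected ?C" "x \<in> ?C" "y \<in> ?C"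
        using y x' by auto
      have "\<exists>z\<in>?C. ?a \<bullet> z = h m"
        using * connected_ivt_hyperplane[OF c(1,2,3)] connected_ivt_hyperplane[OF c(1,3,2)] by blast
      then obtain z where "z \<in> ?C" "z \<in> l m" using m by (auto simp: line det2_eq_inner)
      then show False using connected_component_subset m by blast
    qed
  qed
qed

lemma regions_iff:
  "C \<in> regions (l ` {1..n}) \<longleftrightarrow>
     (\<exists>x. (\<forall>m\<in>{1..n}. F m x \<noteq> 0) \<and> C = {y. \<forall>m\<in>{1..n}. F m x * F m y > 0})"
proof -
  have "C \<in> regions (l ` {1..n}) \<longleftrightarrow>
     (\<exists>x. (\<forall>m\<in>{1..n}. F m x \<noteq> 0) \<and> C = connected_component_set (- \<Union> (l ` {1..n})) x)"
    unfolding regions_def components_def by (fastforce simp: on_line)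
  then show ?thesis using connected_component_cell by (metis (no_types, lifting))
qed

lemma F_P_nz: 
  assumes "i \<in> {1..n}" "j \<in> {1..n}" "m \<in> {1..n}" "i \<noteq> j" "m \<noteq> i" "m \<noteq> j"
  shows "F m (P i j) \<noteq> 0"
  by (simp add: F_P D_nz[OF assms(1,2,4)] Del_nz[OF assms(1-4) assms(5,6)[symmetric]])

text \<open>The quotients such as \<open>F i x / F i (P j k)\<close> are the barycentric coordinates
  of \<open>x\<close>: each is 1 at its own vertex and 0 at the other two, and their sum is 1 by
  \<open>Del_eq\<close>.\<close>

lemma triangle_interior:
  assumes "i \<in> {1..n}" "j \<in> {1..n}" "k \<in> {1..n}" "i \<noteq> j" "i \<noteq> k" "j \<noteq> k"
  shows "x \<in> interior (convex hull {P j k, P k i, P i j}) \<longleftrightarrow>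
     F i x * F i (P j k) > 0 \<and> F j x * F j (P k i) > 0 \<and> F k x * F k (P i j) > 0"
proof -
  let ?A = "P j k" and ?B = "P k i" and ?C = "P i j"
  have D: "D i j \<noteq> 0" "D j k \<noteq> 0" "D k i \<noteq> 0" "Del i j k \<noteq> 0"
    by (rule D_nz[OF assms(1,2,4)] D_nz[OF assms(2,3,6)] D_nz[OF assms(3,1) assms(5)[symmetric]]
          Del_nz[OF assms])+
  have rot: "Del j k i = Del i j k" "Del k i j = Del i j k" by (simp_all only: Del_rot[of i j k] Del_rot[of k i j])
  have z: "F i ?B = 0" "F i ?C = 0" "F j ?A = 0" "F j ?C = 0" "F k ?A = 0" "F k ?B = 0"
    using F_P_self[OF D(1)] F_P_self[OF D(2)] F_P_self[OF D(3)] by simp_all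
  have FA: "F i ?A = Del i j k / D j k" and FB: "F j ?B = Del i j k / D k i" and FC: "F k ?C = Del i j k / D i j"
    by (simp_all only: F_P[OF D(1)] F_P[OF D(2)] F_P[OF D(3)] rot)
  have nc: "\<not> collinear {?A, ?B, ?C}"
  proof
    assume "collinear {?A, ?B, ?C}"
    then consider "?A = ?C" | u where "?B = u *\<^sub>R ?A + (1 - u) *\<^sub>R ?C"
      by (auto simp: collinear_3_expand)
    then show False
    proof cases
      case 1
      then show ?thesis using z FA D by auto
    next
      case 2
      then have "F j ?B = F j (u *\<^sub>R ?A + (1 - u) *\<^sub>R ?C + 0 *\<^sub>R ?C)" by simp
      also have "\<dots> = 0" by (subst F_affine) (auto simp: z)
      finally show ?thesis using FB D by simp
    qed
  qed
  have bary: "x = (F i x / F i ?A) *\<^sub>R ?A + (F j x / F j ?B) *\<^sub>R ?B + (F k x / F k ?C) *\<^sub>R ?C"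
    "F i x / F i ?A + F j x / F j ?B + F k x / F k ?C = 1"
  proof -
    show s: "F i x / F i ?A + F j x / F j ?B + F k x / F k ?C = 1"
      using D by (simp add: FA FB FC Del_eq[of i j k x, symmetric] flip: add_divide_distrib)
    let ?y = "(F i x / F i ?A) *\<^sub>R ?A + (F j x / F j ?B) *\<^sub>R ?B + (F k x / F k ?C) *\<^sub>R ?C"
    have "F i ?y = F i x" "F j ?y = F j x"
      unfolding F_affine[OF s] using D by (simp_all add: z FA FB)
    then show "x = ?y" using D by (intro det2_eqI[of "e i" "e j"]) (auto simp: F_def D_def)
  qed
  have hull: "interior (convex hull {?A, ?B, ?C}) = {v. \<exists>x y z. 0 < x \<and> 0 < y \<and> 0 < z \<and> x + y + z = 1 \<and> x *\<^sub>R ?A + y *\<^sub>R ?B + z *\<^sub>R ?C = v}"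
    by (rule interior_convex_hull_3_minimal[OF nc]) simp
  have sq: "F i ?A * F i ?A > 0" "F j ?B * F j ?B > 0" "F k ?C * F k ?C > 0"
      using FA FB FC D by (simp_all add: square_pos_iff)
    show ?thesis unfolding hull
    proof
      assume "x \<in> {v. \<exists>x y z. 0 < x \<and> 0 < y \<and> 0 < z \<and> x + y + z = 1 \<and> x *\<^sub>R ?A + y *\<^sub>R ?B + z *\<^sub>R ?C = v}"
      then obtain u v w where u: "0 < u" "0 < v" "0 < w" and s: "u + v + w = 1"
        and x: "x = u *\<^sub>R ?A + v *\<^sub>R ?B + w *\<^sub>R ?C" by blast
      show "F i x * F i ?A > 0 \<and> F j x * F j ?B > 0 \<and> F k x * F k ?C > 0"
        unfolding x F_affine[OF s] z using u sq by (simp add: mult.assoc)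
    next
      assume "F i x * F i ?A > 0 \<and> F j x * F j ?B > 0 \<and> F k x * F k ?C > 0"
      then have "F i x / F i ?A > 0" "F j x / F j ?B > 0" "F k x / F k ?C > 0"
        by (simp_all add: zero_less_divide_iff_mult)
      then show "x \<in> {v. \<exists>x y z. 0 < x \<and> 0 < y \<and> 0 < z \<and> x + y + z = 1 \<and> x *\<^sub>R ?A + y *\<^sub>R ?B + z *\<^sub>R ?C = v}"
        using bary(2) bary(1)[symmetric] by blast
    qed
qed

text \<open>Regions are the cells of constant sign, so the open triangle is one iff no further line
  separates its vertices. The vertices are only limits of interior points, which yields weak
  inequalities; they are strict because no three lines are concurrent
  (\<open>F_P_nz\<close>).\<close>

lemma forms_triangle_iff:
  assumes ijk: "i \<in> {1..n}" "j \<in> {1..n}" "k \<in> {1..n}" "i \<noteq> j" "i \<noteq> k" "j \<noteq> k"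
  shows "forms_triangle n l i j k \<longleftrightarrow>
     (\<forall>m\<in>{1..n}-{i,j,k}. F m (P j k) * F m (P k i) > 0 \<and> F m (P j k) * F m (P i j) > 0)"
proof -
  let ?A = "P j k" and ?B = "P k i" and ?C = "P i j"
  let ?H = "interior (convex hull {?A, ?B, ?C})"
  note tri = triangle_interior[OF ijk]
  have nzA: "F i ?A \<noteq> 0" "F j ?B \<noteq> 0" "F k ?C \<noteq> 0"
    using F_P_nz[of j k i] F_P_nz[of k i j] F_P_nz[of i j k] ijk by metis+
  have "l i \<inter> l j \<union> l j \<inter> l k \<union> l i \<inter> l k = {?A, ?B, ?C}"
    unfolding inter_lines[OF ijk(1,2,4)] inter_lines[OF ijk(2,3,6)] inter_lines[OF ijk(1,3,5)] P_swap[of i k]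
    by auto
  then have "forms_triangle n l i j k \<longleftrightarrow> ?H \<in> regions (l ` {1..n})"
    using ijk by (simp add: forms_triangle_def)
  also have "\<dots> \<longleftrightarrow> (\<forall>m\<in>{1..n}-{i,j,k}. F m ?A * F m ?B > 0 \<and> F m ?A * F m ?C > 0)"
  proof
    assume "?H \<in> regions (l ` {1..n})"
    then obtain x where x: "\<forall>m\<in>{1..n}. F m x \<noteq> 0" and H: "?H = {y. \<forall>m\<in>{1..n}. F m x * F m y > 0}"
      using regions_iff by blast
    have xH: "x \<in> ?H" unfolding H using x by (simp add: square_pos_iff)
    show "\<forall>m\<in>{1..n}-{i,j,k}. F m ?A * F m ?B > 0 \<and> F m ?A * F m ?C > 0"
    proof
      fix m assume m: "m \<in> {1..n} - {i,j,k}"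
      then have m': "m \<in> {1..n}" "m \<noteq> i" "m \<noteq> j" "m \<noteq> k" by auto
      have nz: "F m ?A \<noteq> 0" "F m ?B \<noteq> 0" "F m ?C \<noteq> 0"
        by (rule F_P_nz; use m' ijk in metis)+
      have pos: "F m x * F m y \<ge> 0" if "y \<in> {?A, ?B, ?C}" for y
      proof -
        have "y \<in> convex hull {?A, ?B, ?C}" using that by (rule hull_inc)
        also have "\<dots> \<subseteq> closure (convex hull {?A, ?B, ?C})" by (rule closure_subset)
        also have "\<dots> = closure ?H"
          using xH by (intro convex_closure_interior[symmetric]) auto
        also have "\<dots> \<subseteq> {y. F m x * F m y \<ge> 0}"
        proof (rule closure_minimal)
          show "?H \<subseteq> {y. F m x * F m y \<ge> 0}" unfolding H using m'(1) by (auto intro: less_imp_le)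
          show "closed {y. F m x * F m y \<ge> 0}"
            unfolding F_def det2_eq_inner by (intro closed_Collect_le continuous_intros)
        qed
        finally show ?thesis by simp
      qed
      show "F m ?A * F m ?B > 0 \<and> F m ?A * F m ?C > 0"
        using pos[of ?A] pos[of ?B] pos[of ?C] nz x m'(1) same_sign_trans[of "F m x"]
        by (simp add: order.order_iff_strict)
    qed
  next
    assume R: "\<forall>m\<in>{1..n}-{i,j,k}. F m ?A * F m ?B > 0 \<and> F m ?A * F m ?C > 0"
    have same: "F m x * F m ?A > 0" if x: "x \<in> ?H" and m: "m \<in> {1..n}-{i,j,k}" for m x
    proof -
      have "x \<in> convex hull {?A, ?B, ?C}" using x interior_subset by blast
      then obtain u v w where u: "0 \<le> u" "0 \<le> v" "0 \<le> w" "u + v + w = 1" and x: "x = u *\<^sub>R ?A + v *\<^sub>R ?B + w *\<^sub>R ?C"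
        unfolding convex_hull_3 by blast
      have p: "F m ?A * F m ?A > 0" "F m ?A * F m ?B > 0" "F m ?A * F m ?C > 0"
        using R m by (auto simp: zero_less_mult_iff)
      have "F m x * F m ?A = u * (F m ?A * F m ?A) + v * (F m ?A * F m ?B) + w * (F m ?A * F m ?C)"
        unfolding x F_affine[OF u(4)] by (simp add: algebra_simps)
      moreover have "u > 0 \<or> v > 0 \<or> w > 0" using u by linarith
      ultimately show ?thesis
        using u p by (smt (verit) mult_nonneg_nonneg mult_pos_pos)
    qed
    \<comment> \<open>The centroid is the sample point whose cell is shown to be the open
      triangle.\<close>
    define x where "x = (1/3) *\<^sub>R ?A + (1/3) *\<^sub>R ?B + (1/3) *\<^sub>R ?C"
    have z: "F i ?B = 0" "F i ?C = 0" "F j ?A = 0" "F j ?C = 0" "F k ?A = 0" "F k ?B = 0"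
      by (rule F_P_self[OF D_nz[OF ijk(1,2,4)]] F_P_self[OF D_nz[OF ijk(2,3,6)]]
            F_P_self[OF D_nz[OF ijk(3,1) ijk(5)[symmetric]]])+
    have FX: "F m x = (1/3) * F m ?A + (1/3) * F m ?B + (1/3) * F m ?C" for m
      unfolding x_def by (rule F_affine) simp
    have xH: "x \<in> ?H"
      unfolding tri FX using nzA by (simp add: z square_pos_iff)
    have x: "\<forall>m\<in>{1..n}. F m x \<noteq> 0"
    proof
      fix m assume "m \<in> {1..n}"
      then show "F m x \<noteq> 0" using same[OF xH, of m] xH[unfolded tri] by (cases "m \<in> {i,j,k}") auto
    qed
    moreover have "?H = {y. \<forall>m\<in>{1..n}. F m x * F m y > 0}"
    proof safe
      fix y m assume y: "y \<in> ?H" and m: "m \<in> {1..n}"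
      show "F m x * F m y > 0"
      proof (cases "m \<in> {i,j,k}")
        case True
        then show ?thesis
          using same_sign_trans[of "F i ?A" "F i x" "F i y"] same_sign_trans[of "F j ?B" "F j x" "F j y"]
            same_sign_trans[of "F k ?C" "F k x" "F k y"] y xH unfolding tri mult.commute[of "F _ ?A"]
            mult.commute[of "F _ ?B"] mult.commute[of "F _ ?C"] by blast
      next
        case False
        then have "F m ?A * F m x > 0" "F m ?A * F m y > 0"
          using same[OF xH, of m] same[OF y, of m] m by (auto simp: mult.commute)
        then show ?thesis by (rule same_sign_trans)
      qed
    next
      fix y assume "\<forall>m\<in>{1..n}. F m x * F m y > 0"
      then show "y \<in> ?H" using xH ijk unfolding tri
        using same_sign_trans[of "F i x" "F i y" "F i ?A"] same_sign_trans[of "F j x" "F j y" "F j ?B"]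
          same_sign_trans[of "F k x" "F k y" "F k ?C"] by blast
    qed
    ultimately show "?H \<in> regions (l ` {1..n})" unfolding regions_iff by blast
  qed
  finally show ?thesis .
qed

end

lemma line_eq_level_set:
  assumes "u \<noteq> 0" shows "range (\<lambda>t. p + t *\<^sub>R u) = {x. det2 u x = det2 u p}"
proof safe
  fix x assume "det2 u x = det2 u p"
  then have "det2 u (x - p) = 0" by simp
  then obtain c where "x - p = c *\<^sub>R u" by (rule det2_zero_imp_scaleR[OF assms])
  then have "x = p + c *\<^sub>R u" by (simp add: algebra_simps)
  then show "x \<in> range (\<lambda>t. p + t *\<^sub>R u)" by blast
qed simp

text \<open>Turns empty triple intersections into \<open>no_concurrence\<close>: Cramer's rule
  solves the first two equations, and the vanishing determinant says that the solution satisfies the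
  third.\<close>

lemma concurrent_lines:
  assumes "det2 u v \<noteq> 0" "a * det2 v w + b * det2 w u + c * det2 u v = 0"
  shows "\<exists>x. det2 u x = a \<and> det2 v x = b \<and> det2 w x = c"
proof -
  define x where "x = (1 / det2 u v) *\<^sub>R (a *\<^sub>R v - b *\<^sub>R u)"
  have "det2 u x = a" using assms(1) by (simp add: x_def)
  moreover have "det2 v x = b" using assms(1) by (simp add: x_def det2_swap[of v u])
  moreover have "det2 w x * det2 u v = c * det2 u v"
  proof -
    have "det2 w x * det2 u v = a * det2 w v - b * det2 w u" using assms(1) by (simp add: x_def)
    also have "\<dots> = c * det2 u v" using assms(2) by (simp add: det2_swap[of w v])
    finally show ?thesis .
  qed
  then have "det2 w x = c" using assms(1) by simp
  ultimately show ?thesis by blast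
qed

lemma zero_less_mult_iff_eq: "x * y \<noteq> 0 \<Longrightarrow> 0 < x * y \<longleftrightarrow> (0 < x) = (0 < y)" for x y :: real
  by (auto simp: zero_less_mult_iff)

lemma bij_betw_neq: "bij_betw f A B \<Longrightarrow> i \<in> A \<Longrightarrow> j \<in> A \<Longrightarrow> i \<noteq> j \<Longrightarrow> f i \<noteq> f j"
  by (metis bij_betw_imp_inj_on inj_onD)

text \<open>Rescaling the equations multiplies the determinant of three lines by
  \<open>c i * c j * c k\<close>, so it stays nonzero. A negative \<open>c k\<close> reverses the
  direction of a line, as is needed to direct the lines along the polygon.\<close>

lemma line_family_reindex:
  assumes "line_family n l e h" and a: "bij_betw a {1..n} {1..n}"
    and c: "\<And>k. k \<in> {1..n} \<Longrightarrow> c k \<noteq> (0::real)"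
    and e': "\<And>k. k \<in> {1..n} \<Longrightarrow> e' k = c k *\<^sub>R e (a k)"
    and h': "\<And>k. k \<in> {1..n} \<Longrightarrow> h' k = c k * h (a k)"
  shows "line_family n (l \<circ> a) e' h'"
proof -
  interpret line_family n l e h by fact
  have aI: "a k \<in> {1..n}" if "k \<in> {1..n}" for k using bij_betwE[OF a] that by blast
  have ne: "a i \<noteq> a j" if "i \<in> {1..n}" "j \<in> {1..n}" "i \<noteq> j" for i j
    using bij_betw_neq[OF a that] .
  show ?thesis
  proof
    fix k assume k: "k \<in> {1..n}"
    show "(l \<circ> a) k = {x. det2 (e' k) x = h' k}"
      using line[OF aI[OF k]] c[OF k] by (simp add: e'[OF k] h'[OF k])
  next
    fix i j assume ij: "i \<in> {1..n}" "j \<in> {1..n}" "i \<noteq> j"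
    then show "det2 (e' i) (e' j) \<noteq> 0"
      using cross[OF aI aI ne, of i j] c by (simp add: e')
  next
    fix i j k assume ijk: "i \<in> {1..n}" "j \<in> {1..n}" "k \<in> {1..n}" "i \<noteq> j" "i \<noteq> k" "j \<noteq> k"
    note nc = no_concurrence[OF aI[OF ijk(1)] aI[OF ijk(2)] aI[OF ijk(3)]
        ne[OF ijk(1,2,4)] ne[OF ijk(1,3,5)] ne[OF ijk(2,3,6)]]
    have "h' i * det2 (e' j) (e' k) + h' j * det2 (e' k) (e' i) + h' k * det2 (e' i) (e' j) =
      (c i * c j * c k) * (h (a i) * det2 (e (a j)) (e (a k)) + h (a j) * det2 (e (a k)) (e (a i))
        + h (a k) * det2 (e (a i)) (e (a j)))"
      by (simp add: e'[OF ijk(1)] e'[OF ijk(2)] e'[OF ijk(3)] h'[OF ijk(1)] h'[OF ijk(2)] h'[OF ijk(3)] algebra_simps)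
    then show "h' i * det2 (e' j) (e' k) + h' j * det2 (e' k) (e' i) + h' k * det2 (e' i) (e' j) \<noteq> 0"
      using nc c[OF ijk(1)] c[OF ijk(2)] c[OF ijk(3)] by simp
  qed
qed

section \<open>The directions of the sides of a convex polygon\<close>

definition dir :: "real \<Rightarrow> real^2" where "dir t = vector [cos t, sin t]"

lemma dir_nz: "dir t \<noteq> 0"
proof
  assume "dir t = 0"
  then have "cos t = 0" "sin t = 0" by (auto simp: dir_def vec_eq_iff forall_2)
  then show False using sin_cos_squared_add[of t] by simp
qed

lemma det2_dir: "det2 (dir s) (dir t) = sin (t - s)"
  by (simp add: det2_def dir_def sin_diff algebra_simps)

lemma sin_diff_pos_iff:
  assumes "0 < s" "s < pi" "0 < t" "t < pi" shows "0 < sin (t - s) \<longleftrightarrow> s < t"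
proof (cases "s < t")
  case True
  then show ?thesis using assms by (simp add: sin_gt_zero)
next
  case False
  then have "sin (s - t) \<ge> 0" using assms by (intro sin_ge_zero) auto
  then show ?thesis using False sin_minus[of "s - t"] by simp
qed

lemma arrangement_line_family:
  assumes "numbered_arrangement n L" and ang: "increasing_angles n L \<theta>"
  shows "\<exists>h. line_family n L (\<lambda>j. dir (\<theta> j)) h"
proof -
  have "\<exists>h. \<forall>j\<in>{1..n}. L j = {x. det2 (dir (\<theta> j)) x = h j}"
  proof -
    have "\<exists>h. L j = {x. det2 (dir (\<theta> j)) x = h}" if j: "j \<in> {1..n}" for j
      using ang j unfolding increasing_angles_def has_angle_def
      by (metis line_eq_level_set[OF dir_nz] dir_def)
    then show ?thesis by metis
  qed
  then obtain h where h: "\<And>j. j \<in> {1..n} \<Longrightarrow> L j = {x. det2 (dir (\<theta> j)) x = h j}" by metis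
  have inj: "inj_on L {1..n}" and arr: "line_arrangement (L ` {1..n})"
    using assms by (auto simp: numbered_arrangement_def)
  have cr: "det2 (dir (\<theta> i)) (dir (\<theta> j)) \<noteq> 0" if "i \<in> {1..n}" "j \<in> {1..n}" "i \<noteq> j" for i j
  proof -
    have b: "0 < \<theta> i" "\<theta> i < pi" "0 < \<theta> j" "\<theta> j < pi" using ang that by (auto simp: increasing_angles_def)
    have "inj_on \<theta> {1..n}" using ang unfolding increasing_angles_def by (blast intro: strict_mono_on_imp_inj_on)
    then have "\<theta> i \<noteq> \<theta> j" using that by (meson inj_onD)
    then have "sin (\<theta> j - \<theta> i) > 0 \<or> sin (\<theta> i - \<theta> j) > 0"
      using b sin_diff_pos_iff by (metis linorder_neqE)
    then show ?thesis using sin_minus[of "\<theta> j - \<theta> i"] by (auto simp: det2_dir)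
  qed
  have "line_family n L (\<lambda>j. dir (\<theta> j)) h"
  proof
    fix i j k assume ijk: "i \<in> {1..n}" "j \<in> {1..n}" "k \<in> {1..n}" "i \<noteq> j" "i \<noteq> k" "j \<noteq> k"
    then have ne: "L i \<noteq> L j" "L i \<noteq> L k" "L j \<noteq> L k" using inj_on_contraD[OF inj] by blast+
    have e: "L i \<inter> L j \<inter> L k = {}"
    proof -
      have "\<And>l m k. l \<in> L ` {1..n} \<Longrightarrow> m \<in> L ` {1..n} \<Longrightarrow> k \<in> L ` {1..n} \<Longrightarrow> l \<noteq> m \<Longrightarrow> l \<noteq> k \<Longrightarrow> m \<noteq> k \<Longrightarrow>
          l \<inter> m \<inter> k = {}"
        using arr unfolding line_arrangement_def by blast
      then show ?thesis using ijk ne by (meson imageI)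
    qed
    show "h i * det2 (dir (\<theta> j)) (dir (\<theta> k)) + h j * det2 (dir (\<theta> k)) (dir (\<theta> i)) +
        h k * det2 (dir (\<theta> i)) (dir (\<theta> j)) \<noteq> 0"
    proof
      assume "h i * det2 (dir (\<theta> j)) (dir (\<theta> k)) + h j * det2 (dir (\<theta> k)) (dir (\<theta> i)) +
        h k * det2 (dir (\<theta> i)) (dir (\<theta> j)) = 0"
      then obtain x where "det2 (dir (\<theta> i)) x = h i" "det2 (dir (\<theta> j)) x = h j" "det2 (dir (\<theta> k)) x = h k"
        using concurrent_lines[OF cr[OF ijk(1,2,4)]] by blast
      then have "x \<in> L i \<inter> L j \<inter> L k" by (simp add: h[OF ijk(1)] h[OF ijk(2)] h[OF ijk(3)])
      then show False using e by simp
    qed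
  qed (use h cr in auto)
  then show ?thesis by blast
qed

text \<open>Whether the direction of side \<open>j\<close> lies less than a half-turn anticlockwise of that of side \<open>i\<close>,
  when line \<open>a i\<close> is directed at its angle for \<open>i \<le> r\<close> and oppositely for \<open>i > r\<close>.\<close>

definition turn :: "nat \<Rightarrow> (nat \<Rightarrow> nat) \<Rightarrow> nat \<Rightarrow> nat \<Rightarrow> bool" where
  "turn r a i j \<longleftrightarrow> ((i \<le> r) = (j \<le> r)) = (a i < a j)"

definition cyc_shape :: "nat \<Rightarrow> nat \<Rightarrow> (nat \<Rightarrow> nat) \<Rightarrow> bool" where
  "cyc_shape n r a \<longleftrightarrow> bij_betw a {1..n} {1..n} \<and> a 1 = 1 \<and> 2 \<le> r \<and> r + 1 \<le> n \<and>
     strict_mono_on {1..r} a \<and> strict_mono_on {r+1..n} a \<and> 1 < a (r+1) \<and> a (r+1) < a r"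

lemma turn_swap:
  assumes "cyc_shape n r a" "i \<in> {1..n}" "j \<in> {1..n}" "i \<noteq> j"
  shows "turn r a i j \<longleftrightarrow> \<not> turn r a j i"
proof -
  have "a i \<noteq> a j" using assms bij_betw_neq by (metis cyc_shape_def)
  then show ?thesis by (auto simp: turn_def)
qed

lemma cyc_shape_mono:
  assumes "cyc_shape n r a" "i < j" "1 \<le> i" "j \<le> n" "j \<le> r \<or> r < i"
  shows "a i < a j"
  using assms unfolding cyc_shape_def strict_mono_on_def by auto

text \<open>The directions run once around the circle, so the turns from \<open>i\<close> to
  \<open>j\<close>, from \<open>j\<close> to \<open>k\<close> and from \<open>k\<close> back to
  \<open>i\<close> add up to a full turn, and at most one of them can exceed a half-turn.\<close>

lemma two_turns:
  assumes "cyc_shape n r a" "1 \<le> i" "i < j" "j < k" "k \<le> n"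
  shows "turn r a i j \<and> turn r a j k \<or> turn r a j k \<and> turn r a k i \<or> turn r a k i \<and> turn r a i j"
proof -
  have inj: "a x \<noteq> a y" if "x \<in> {1..n}" "y \<in> {1..n}" "x \<noteq> y" for x y
    using assms(1) that bij_betw_neq by (metis cyc_shape_def)
  have ne: "a i \<noteq> a j" "a j \<noteq> a k" "a i \<noteq> a k" using inj assms by auto
  have m: "j \<le> r \<or> r < i \<Longrightarrow> a i < a j" "k \<le> r \<or> r < j \<Longrightarrow> a j < a k"
    using cyc_shape_mono[OF assms(1), of i j] cyc_shape_mono[OF assms(1), of j k] assms by auto
  consider "k \<le> r" | "j \<le> r" "r < k" | "i \<le> r" "r < j" | "r < i" using assms by linarith
  then show ?thesis
    using m ne assms(3,4) by cases (auto simp: turn_def)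
qed

locale ngon =
  fixes n :: nat and L \<theta> a v
  assumes arr: "numbered_arrangement n L" and ang: "increasing_angles n L \<theta>"
    and bij: "bij_betw a {1..n} {1..n}" and a1: "a 1 = (1::nat)"
    and conv: "anticlockwise_convex_ngon n v"
    and sides: "\<And>j. j \<in> {1..n} \<Longrightarrow> v j \<in> L (a j) \<and> v (Suc (j mod n)) \<in> L (a j)"
begin

definition S :: "nat \<Rightarrow> nat" where "S j = Suc (j mod n)"

definition E :: "nat \<Rightarrow> real^2" where "E k = v (S k) - v k"

definition H :: "nat \<Rightarrow> real" where "H k = det2 (E k) (v k)"

lemma n3: "3 \<le> n" using conv by (simp add: anticlockwise_convex_ngon_def)

lemma S_less: "1 \<le> k \<Longrightarrow> k < n \<Longrightarrow> S k = k + 1" and S_n: "S n = 1"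
  by (simp_all add: S_def)

lemma S_in: "S k \<in> {1..n}" using n3 by (simp add: S_def Suc_le_eq)

lemma S_neq: assumes "k \<in> {1..n}" shows "S k \<noteq> k" "S (S k) \<noteq> k"
proof -
  consider "k + 1 < n" | "k + 1 = n" | "k = n" using assms by force
  then show "S k \<noteq> k" "S (S k) \<noteq> k"
    using assms n3 by (cases; auto simp: S_less S_n)+
qed

lemma left: "j \<in> {1..n} \<Longrightarrow> k \<in> {1..n} \<Longrightarrow> k \<noteq> j \<Longrightarrow> k \<noteq> S j \<Longrightarrow> det2 (E j) (v k - v j) > 0"
  using conv by (auto simp: anticlockwise_convex_ngon_def signed_area2_eq E_def S_def)

lemma E_nz: assumes "j \<in> {1..n}" shows "E j \<noteq> 0"
  using left[OF assms S_in, of "S j"] S_neq[OF assms] S_neq[OF S_in, of j] by auto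

text \<open>The sign of \<open>c k\<close> says whether side \<open>k\<close> runs at the angle of
  its line or against it; \<open>turns\<close> determines these signs.\<close>

lemma exists_family:
  "\<exists>c. (\<forall>k\<in>{1..n}. c k \<noteq> 0 \<and> E k = c k *\<^sub>R dir (\<theta> (a k))) \<and> line_family n (L \<circ> a) E H"
proof -
  obtain h where lf: "line_family n L (\<lambda>j. dir (\<theta> j)) h"
    using arrangement_line_family[OF arr ang] by blast
  interpret line_family n L "\<lambda>j. dir (\<theta> j)" h by fact
  have aI: "a k \<in> {1..n}" if "k \<in> {1..n}" for k using bij_betwE[OF bij] that by blast
  have "\<exists>c. c \<noteq> 0 \<and> E k = c *\<^sub>R dir (\<theta> (a k)) \<and> H k = c * h (a k)" if k: "k \<in> {1..n}" for k
  proof -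
    have *: "det2 (dir (\<theta> (a k))) (v k) = h (a k)" "det2 (dir (\<theta> (a k))) (v (S k)) = h (a k)"
      using sides[OF k] line[OF aI[OF k]] by (auto simp: S_def)
    then have "det2 (dir (\<theta> (a k))) (E k) = 0" by (simp add: E_def)
    then obtain c where "E k = c *\<^sub>R dir (\<theta> (a k))" by (rule det2_zero_imp_scaleR[OF dir_nz])
    then show ?thesis using E_nz[OF k] * by (intro exI[of _ c]) (auto simp: H_def)
  qed
  then obtain c where c: "\<And>k. k \<in> {1..n} \<Longrightarrow> c k \<noteq> 0 \<and> E k = c k *\<^sub>R dir (\<theta> (a k)) \<and> H k = c k * h (a k)"
    by metis
  have "line_family n (L \<circ> a) E H"
    by (rule line_family_reindex[OF lf bij, of c]) (use c in auto)
  then show ?thesis using c by blast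
qed

lemma line_family_sides: "line_family n (L \<circ> a) E H"
proof -
  from exists_family obtain c where "line_family n (L \<circ> a) E H" by meson
  then show ?thesis .
qed

sublocale line_family n "L \<circ> a" E H
  by (rule line_family_sides)

lemma F_eq: "F j x = det2 (E j) (x - v j)"
  by (simp add: F_def H_def)

lemma F_zero: "F j (v j) = 0" "F j (v (S j)) = 0"
  by (simp_all add: F_eq flip: E_def)

lemma F_pos: "j \<in> {1..n} \<Longrightarrow> k \<in> {1..n} \<Longrightarrow> k \<noteq> j \<Longrightarrow> k \<noteq> S j \<Longrightarrow> F j (v k) > 0"
  using left by (simp add: F_eq)

lemma F_nonneg: "j \<in> {1..n} \<Longrightarrow> k \<in> {1..n} \<Longrightarrow> F j (v k) \<ge> 0"
  using F_pos[of j k] F_zero[of j] by (cases "k = j \<or> k = S j") auto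

text \<open>The determinant of two successive edges is the value of \<open>F k\<close> at the far
  end of the second, a vertex off side \<open>k\<close>.\<close>

lemma D_S: assumes "k \<in> {1..n}" shows "D k (S k) > 0"
proof -
  have "D k (S k) = F k (v (S (S k))) - F k (v (S k))" by (simp add: D_def F_def E_def)
  then show ?thesis using F_zero[of k] F_pos[OF assms S_in, of "S k"] S_neq[OF assms] S_neq[OF S_in, of k] by auto
qed

text \<open>Heights above the first side increase and then decrease: at a local minimum the other
  vertices would lie in the cone spanned by the two adjacent sides, hence above it.\<close>

lemma no_second_rise:
  assumes "2 \<le> k" "k < n" shows "\<not> (D 1 k \<le> 0 \<and> D 1 (k+1) \<ge> 0)"
proof
  assume *: "D 1 k \<le> 0 \<and> D 1 (k+1) \<ge> 0"
  have k: "1 \<in> {1..n}" "k \<in> {1..n}" "k+1 \<in> {1..n}" "S k = k+1" "S 1 = 2" using assms by (auto simp: S_less)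
  define w where "w = v 1 - v (k+1)"
  have "D k (k+1) * det2 (E 1) w = det2 (E 1) (D k (k+1) *\<^sub>R w)" by simp
  also have "\<dots> = det2 (E k) w * D 1 (k+1) - det2 (E (k+1)) w * D 1 k"
    unfolding D_def by (subst det2_expand) simp
  also have "det2 (E k) w = F k (v 1) - F k (v (S k))" by (simp add: w_def F_def k)
  also have "det2 (E (k+1)) w = F (k+1) (v 1) - F (k+1) (v (k+1))" by (simp add: w_def F_def)
  also have "det2 (E 1) w = F 1 (v 1) - F 1 (v (k+1))" by (simp add: w_def F_def)
  finally have "- (D k (k+1) * F 1 (v (k+1))) = F k (v 1) * D 1 (k+1) - F (k+1) (v 1) * D 1 k"
    by (simp add: F_zero)
  moreover have "F k (v 1) * D 1 (k+1) \<ge> 0" "F (k+1) (v 1) * D 1 k \<le> 0"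
    using * F_nonneg k by (simp_all add: mult_nonneg_nonpos)
  moreover have "D k (k+1) * F 1 (v (k+1)) > 0"
    using D_S[OF k(2)] F_pos[OF k(1,3)] k assms by simp
  ultimately show False by linarith
qed

lemma turns:
  "\<exists>r. cyc_shape n r a \<and> (\<forall>i\<in>{1..n}. \<forall>j\<in>{1..n}. i \<noteq> j \<longrightarrow> (D i j > 0 \<longleftrightarrow> turn r a i j))"
proof -
  from exists_family obtain c where "\<forall>k\<in>{1..n}. c k \<noteq> 0 \<and> E k = c k *\<^sub>R dir (\<theta> (a k))" by meson
  then have c: "\<And>k. k \<in> {1..n} \<Longrightarrow> c k \<noteq> 0 \<and> E k = c k *\<^sub>R dir (\<theta> (a k))" by (rule bspec)
  have I: "1 \<in> {1..n}" "2 \<in> {1..n}" "n \<in> {1..n}" using n3 by auto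
  have aI: "a k \<in> {1..n}" if "k \<in> {1..n}" for k using bij_betwE[OF bij] that by blast
  have ainj: "a i \<noteq> a j" if "i \<in> {1..n}" "j \<in> {1..n}" "i \<noteq> j" for i j
    using bij_betw_neq[OF bij that] .
  have th: "0 < \<theta> j" "\<theta> j < pi" if "j \<in> {1..n}" for j using ang that by (auto simp: increasing_angles_def)
  have th_less: "\<theta> i < \<theta> j \<longleftrightarrow> i < j" if "i \<in> {1..n}" "j \<in> {1..n}" for i j
    using ang strict_mono_on_less[of "{1..n}" \<theta>, OF _ that] unfolding increasing_angles_def by blast
  have Dc: "D i j > 0 \<longleftrightarrow> (c i * c j > 0) = (a i < a j)"
    if ij: "i \<in> {1..n}" "j \<in> {1..n}" "i \<noteq> j" for i j
  proof -
    let ?s = "sin (\<theta> (a j) - \<theta> (a i))"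
    have "D i j = (c i * c j) * ?s"
      using c ij by (simp add: D_def det2_dir)
    moreover have "?s > 0 \<longleftrightarrow> a i < a j"
      using sin_diff_pos_iff th[OF aI] th_less[OF aI aI] ij by simp
    moreover have "D i j \<noteq> 0" using D_nz ij by blast
    ultimately show ?thesis using zero_less_mult_iff_eq[of "c i * c j" ?s] by simp
  qed
  define r where "r = Max {k \<in> {2..n}. D 1 k > 0}"
  have "D 1 2 > 0" using D_S[OF I(1)] n3 S_less[of 1] by simp
  then have 2: "2 \<in> {k \<in> {2..n}. D 1 k > 0}" using n3 by auto
  have rmem: "r \<in> {k \<in> {2..n}. D 1 k > 0}" unfolding r_def by (rule Max_in) (use 2 in auto)
  have "D 1 n < 0" using D_S[OF I(3)] D_swap[of 1 n] by (simp add: S_n)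
  then have rn: "2 \<le> r" "r + 1 \<le> n" using rmem by (auto simp: le_less Suc_le_eq)
  have above: "D 1 k < 0" if "r < k" "k \<le> n" for k
  proof -
    have "\<not> D 1 k > 0"
    proof
      assume "D 1 k > 0"
      then have "k \<le> r" unfolding r_def using that rn by (intro Max_ge) auto
      then show False using that by simp
    qed
    moreover have "D 1 k \<noteq> 0" using D_nz[OF I(1), of k] that rn by simp
    ultimately show ?thesis by simp
  qed
  have below: "D 1 k > 0" if "2 \<le> k" "k \<le> r" for k
    using that(2,1)
  proof (induction k rule: inc_induct)
    case base
    then show ?case using rmem by simp
  next
    case (step k)
    then have "D 1 (k+1) > 0" by (simp add: Suc_eq_plus1)
    then have "\<not> D 1 k \<le> 0" using no_second_rise[of k] step rn by auto
    then show ?case by simp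
  qed
  have csign: "c 1 * c k > 0 \<longleftrightarrow> k \<le> r" if k: "k \<in> {1..n}" for k
  proof (cases "k = 1")
    case True
    then show ?thesis using c[OF I(1)] rn by (simp add: square_pos_iff)
  next
    case False
    have "a k > 1" using ainj[OF I(1) k] aI[OF k] False a1 by auto
    then have "D 1 k > 0 \<longleftrightarrow> c 1 * c k > 0" using Dc[OF I(1) k] False a1 by simp
    then show ?thesis using above[of k] below[of k] False k by force
  qed
  have cc: "c i * c j > 0 \<longleftrightarrow> (i \<le> r) = (j \<le> r)" if "i \<in> {1..n}" "j \<in> {1..n}" for i j
    using csign[OF that(1)] csign[OF that(2)] c[OF I(1)] c[OF that(1)] c[OF that(2)]
    by (auto simp: zero_less_mult_iff)
  have T: "D i j > 0 \<longleftrightarrow> turn r a i j" if "i \<in> {1..n}" "j \<in> {1..n}" "i \<noteq> j" for i j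
    using Dc[OF that] cc[OF that(1,2)] by (simp add: turn_def)
  have up: "a k < a (k+1)" if "1 \<le> k" "k < n" "k \<noteq> r" for k
    using T[of k "k+1"] D_S[of k] that S_less[of k] by (auto simp: turn_def split: if_splits)
  have up': "a i < a j" if "i < j" "1 \<le> i" "j \<le> n" "j \<le> r \<or> r < i" for i j
    using that
  proof (induction j rule: less_Suc_induct)
    case (1 i)
    then have "i \<noteq> r" by linarith
    then show ?case using 1 up[of i] by (simp add: Suc_eq_plus1)
  next
    case (2 i j k)
    then show ?case by force
  qed
  have "turn r a r (r+1)" using T[of r "r+1"] D_S[of r] rn S_less[of r] by auto
  then have d: "a (r+1) < a r" using ainj[of r "r+1"] rn by (auto simp: turn_def)
  have "a (r+1) > 1" using ainj[OF I(1), of "r+1"] aI[of "r+1"] rn a1 by auto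
  then have "cyc_shape n r a"
    unfolding cyc_shape_def using bij a1 rn d up' by (auto intro!: strict_mono_onI)
  then show ?thesis using T by blast
qed

text \<open>Two cyclically successive turns are left turns by \<open>two_turns\<close>. Evaluating
  \<open>Del_eq\<close> at the starting vertex of the side common to both kills the term with the
  unknown sign; the other two terms are nonnegative, and one is positive.\<close>

lemma Del_pos:
  assumes "1 \<le> i" "i < j" "j < k" "k \<le> n" shows "Del i j k > 0"
proof -
  obtain r where r: "cyc_shape n r a"
    "\<And>i j. i \<in> {1..n} \<Longrightarrow> j \<in> {1..n} \<Longrightarrow> i \<noteq> j \<Longrightarrow> D i j > 0 \<longleftrightarrow> turn r a i j"
    using turns by blast
  have I: "i \<in> {1..n}" "j \<in> {1..n}" "k \<in> {1..n}" "S i = i+1" "S j = j+1" using assms by (auto simp: S_less)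
  have "D i j > 0 \<and> D j k > 0 \<or> D j k > 0 \<and> D k i > 0 \<or> D k i > 0 \<and> D i j > 0"
    using two_turns[OF r(1) assms] r(2) I assms by simp
  then show ?thesis
  proof (elim disjE conjE)
    assume D: "D i j > 0" "D j k > 0"
    have "F k (v j) > 0" using assms n3 I S_less[of k] S_n by (intro F_pos) (auto simp: S_def mod_if)
    then show ?thesis using D F_nonneg[OF I(1,2)] F_zero[of j] Del_eq[of i j k "v j"]
      by (simp add: add_nonneg_pos)
  next
    assume D: "D j k > 0" "D k i > 0"
    have "F i (v k) > 0" using assms I by (intro F_pos) auto
    then show ?thesis using D F_nonneg[OF I(2,3)] F_zero[of k] Del_eq[of i j k "v k"]
      by (simp add: add_pos_nonneg)
  next
    assume D: "D k i > 0" "D i j > 0"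
    have "F j (v i) > 0" using assms I by (intro F_pos) auto
    then show ?thesis using D F_nonneg[OF I(3,1)] F_zero[of i] Del_eq[of i j k "v i"]
      by (simp add: add_pos_nonneg)
  qed
qed

end

section \<open>Triangles read off the orders along the lines\<close>

context line_family
begin

text \<open>Line \<open>m\<close> meets line \<open>i\<close> in the single point
  \<open>P i m\<close>, so two points of line \<open>i\<close> are on the same side of
  \<open>m\<close> iff they are on the same side of that point in the order along
  \<open>i\<close>.\<close>

lemma same_side_iff:
  assumes u: "direction_of u (l i)"
    and I: "i \<in> {1..n}" "j \<in> {1..n}" "k \<in> {1..n}" "m \<in> {1..n}"
    and ne: "i \<noteq> j" "i \<noteq> k" "i \<noteq> m" "j \<noteq> m" "k \<noteq> m"
  shows "0 < F m (P i j) * F m (P i k) \<longleftrightarrow>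
    precedes u (P i j) (P i m) = precedes u (P i k) (P i m)"
proof -
  note D = D_nz[OF I(1,2) ne(1)] D_nz[OF I(1,3) ne(2)] D_nz[OF I(1,4) ne(3)]
  note Del = Del_nz[OF I(1,2,4) ne(1,3,4)] Del_nz[OF I(1,3,4) ne(2,3,5)]
  have "e i \<noteq> 0" using D(1) by (auto simp: D_def)
  then obtain c where c: "c \<noteq> 0" "u = c *\<^sub>R e i" using u direction_of_iff[OF I(1)] by blast
  let ?A = "c * (Del i j m * D i j * D i m)" and ?B = "c * (Del i k m * D i k * D i m)"
  have AB: "?A * ?B \<noteq> 0" using c D Del by simp
  have "precedes u (P i j) (P i m) = precedes u (P i k) (P i m) \<longleftrightarrow> 0 < ?A * ?B"
    unfolding c(2) precedes_iff[OF I(1,2,4) ne(1,3)] precedes_iff[OF I(1,3,4) ne(2,3)]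
    by (rule zero_less_mult_iff_eq[OF AB, symmetric])
  also have "?A * ?B = F m (P i j) * F m (P i k) * ((c * D i j * D i k * D i m) * (c * D i j * D i k * D i m))"
    using D by (simp add: F_P[OF D(1)] F_P[OF D(2)])
  also have "0 < \<dots> \<longleftrightarrow> 0 < F m (P i j) * F m (P i k)"
    using c D by (intro zero_less_mult_pos_iff) (simp add: square_pos_iff)
  finally show ?thesis by simp
qed

end

lemma arrangement_isoD:
  assumes "arrangement_iso \<phi> A B" "l \<in> A"
  shows "\<exists>u w. direction_of u l \<and> direction_of w (\<phi> l) \<and>
        (\<forall>m\<in>A - {l}. \<forall>k\<in>A - {l}.
           precedes u (meet l m) (meet l k) \<longleftrightarrow> precedes w (meet (\<phi> l) (\<phi> m)) (meet (\<phi> l) (\<phi> k)))"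
  using assms unfolding arrangement_iso_def by (elim conjE) (rule bspec)

text \<open>In \<open>forms_triangle_iff\<close> the two vertices being compared always lie on a
  common side line, so by \<open>same_side_iff\<close> the criterion involves only the orders along
  lines, which the isomorphism preserves up to reversal.\<close>

lemma iso_trivial_same_triangles:
  assumes "line_family n L e h" "line_family n M e' h'" and iso: "iso_trivial_on_subscripts n L M"
    and inj: "inj_on L {1..n}"
    and fL: "forms_triangle n L i j k"
  shows "forms_triangle n M i j k"
proof -
  interpret L: line_family n L e h by fact
  interpret M: line_family n M e' h' by fact
  obtain \<phi> where \<phi>1: "arrangement_iso \<phi> (L ` {1..n}) (M ` {1..n})" and "\<forall>j\<in>{1..n}. \<phi> (L j) = M j"
    using iso unfolding iso_trivial_on_subscripts_def by meson
  then have \<phi>2: "\<phi> (L j) = M j" if "j \<in> {1..n}" for j using that by blast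
  have same: "0 < M.F m (M.P i j) * M.F m (M.P i k)"
    if I: "i \<in> {1..n}" "j \<in> {1..n}" "k \<in> {1..n}" "m \<in> {1..n}"
    and ne: "i \<noteq> j" "i \<noteq> k" "i \<noteq> m" "j \<noteq> m" "k \<noteq> m"
    and pos: "0 < L.F m (L.P i j) * L.F m (L.P i k)" for i j k m
  proof -
    obtain u w where uw: "direction_of u (L i)" "direction_of w (\<phi> (L i))"
      and p: "\<And>m k. m \<in> L ` {1..n} - {L i} \<Longrightarrow> k \<in> L ` {1..n} - {L i} \<Longrightarrow>
        precedes u (meet (L i) m) (meet (L i) k) \<longleftrightarrow>
           precedes w (meet (\<phi> (L i)) (\<phi> m)) (meet (\<phi> (L i)) (\<phi> k))"
      using arrangement_isoD[OF \<phi>1 imageI[OF I(1)]] by metis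
    have p': "precedes u (L.P i j) (L.P i k) \<longleftrightarrow> precedes w (M.P i j) (M.P i k)"
      if "j \<in> {1..n}" "k \<in> {1..n}" "i \<noteq> j" "i \<noteq> k" for j k
    proof -
      have "L j \<in> L ` {1..n} - {L i}" "L k \<in> L ` {1..n} - {L i}"
        using inj_on_contraD[OF inj that(3)[symmetric] that(1) I(1)]
          inj_on_contraD[OF inj that(4)[symmetric] that(2) I(1)] that by blast+
      from p[OF this] show ?thesis
        by (simp only: L.meet_eq[OF I(1) that(1,3)] L.meet_eq[OF I(1) that(2,4)] \<phi>2[OF I(1)] \<phi>2[OF that(1)]
            \<phi>2[OF that(2)] M.meet_eq[OF I(1) that(1,3)] M.meet_eq[OF I(1) that(2,4)])
    qed
    have w: "direction_of w (M i)" using uw(2) \<phi>2[OF I(1)] by simp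
    show ?thesis
      using pos unfolding M.same_side_iff[OF w I ne] L.same_side_iff[OF uw(1) I ne]
        p'[OF I(2,4) ne(1,3)] p'[OF I(3,4) ne(2,3)] .
  qed
  have I: "i \<in> {1..n}" "j \<in> {1..n}" "k \<in> {1..n}" "i \<noteq> j" "i \<noteq> k" "j \<noteq> k"
    using fL unfolding forms_triangle_def by blast+
  show ?thesis unfolding M.forms_triangle_iff[OF I]
  proof (intro ballI conjI)
    fix m assume m: "m \<in> {1..n} - {i,j,k}"
    then have mI: "m \<in> {1..n}" "m \<noteq> i" "m \<noteq> j" "m \<noteq> k" by auto
    have pos: "0 < L.F m (L.P j k) * L.F m (L.P k i)" "0 < L.F m (L.P j k) * L.F m (L.P i j)"
      using fL m unfolding L.forms_triangle_iff[OF I] by blast+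
    show "0 < M.F m (M.P j k) * M.F m (M.P k i)"
      using same[OF I(3,2,1) mI(1) I(6)[symmetric] I(5)[symmetric] mI(4,3,2)[symmetric]] pos(1)
      by (simp add: L.P_swap[of k j] M.P_swap[of k j])
    show "0 < M.F m (M.P j k) * M.F m (M.P i j)"
      using same[OF I(2,3,1) mI(1) I(6) I(4)[symmetric] mI(3,4,2)[symmetric]] pos(2)
      by (simp add: L.P_swap[of j i] M.P_swap[of j i])
  qed
qed

lemma iso_trivial_sym:
  assumes "iso_trivial_on_subscripts n L M" "inj_on L {1..n}"
  shows "iso_trivial_on_subscripts n M L"
proof -
  obtain \<phi> where \<phi>1: "arrangement_iso \<phi> (L ` {1..n}) (M ` {1..n})" and "\<forall>j\<in>{1..n}. \<phi> (L j) = M j"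
    using assms unfolding iso_trivial_on_subscripts_def by meson
  then have \<phi>2: "\<phi> (L j) = M j" if "j \<in> {1..n}" for j using that by blast
  define \<psi> where "\<psi> = inv_into (L ` {1..n}) \<phi>"
  have b: "bij_betw \<phi> (L ` {1..n}) (M ` {1..n})" using \<phi>1 by (simp add: arrangement_iso_def)
  then have inj: "inj_on \<phi> (L ` {1..n})" by (rule bij_betw_imp_inj_on)
  have \<psi>: "\<psi> (M j) = L j" if "j \<in> {1..n}" for j
    using inv_into_f_f[OF inj, of "L j"] that \<phi>2[OF that] by (simp add: \<psi>_def)
  have Mne: "L j \<noteq> L i" if "M j \<noteq> M i" "i \<in> {1..n}" "j \<in> {1..n}" for i j
    using that \<phi>2 by metis
  have "arrangement_iso \<psi> (M ` {1..n}) (L ` {1..n})"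
    unfolding arrangement_iso_def
  proof (intro conjI ballI)
    show "bij_betw \<psi> (M ` {1..n}) (L ` {1..n})" unfolding \<psi>_def by (rule bij_betw_inv_into[OF b])
    fix l assume "l \<in> M ` {1..n}"
    then obtain i where i: "i \<in> {1..n}" "l = M i" by blast
    obtain u w where uw: "direction_of u (L i)" "direction_of w (\<phi> (L i))"
      and p: "\<And>m k. m \<in> L ` {1..n} - {L i} \<Longrightarrow> k \<in> L ` {1..n} - {L i} \<Longrightarrow>
        precedes u (meet (L i) m) (meet (L i) k) \<longleftrightarrow>
           precedes w (meet (\<phi> (L i)) (\<phi> m)) (meet (\<phi> (L i)) (\<phi> k))"
      using arrangement_isoD[OF \<phi>1 imageI[OF i(1)]] by metis
    have "precedes w (meet l m) (meet l k) \<longleftrightarrow> precedes u (meet (\<psi> l) (\<psi> m)) (meet (\<psi> l) (\<psi> k))"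
      if mk: "m \<in> M ` {1..n} - {l}" "k \<in> M ` {1..n} - {l}" for m k
    proof -
      obtain j j' where j: "j \<in> {1..n}" "m = M j" "j' \<in> {1..n}" "k = M j'" using mk by blast
      then have "L j \<in> L ` {1..n} - {L i}" "L j' \<in> L ` {1..n} - {L i}"
        using Mne mk i by blast+
      from p[OF this] show ?thesis
        by (simp only: i(2) j(2,4) \<psi>[OF i(1)] \<psi>[OF j(1)] \<psi>[OF j(3)] \<phi>2[OF i(1)] \<phi>2[OF j(1)] \<phi>2[OF j(3)])
    qed
    then show "\<exists>u w. direction_of u l \<and> direction_of w (\<psi> l) \<and>
        (\<forall>m\<in>M ` {1..n} - {l}. \<forall>k\<in>M ` {1..n} - {l}.
           precedes u (meet l m) (meet l k) \<longleftrightarrow> precedes w (meet (\<psi> l) (\<psi> m)) (meet (\<psi> l) (\<psi> k)))"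
      using uw i \<psi>[OF i(1)] \<phi>2[OF i(1)] by (intro exI[of _ w] exI[of _ u]) simp
  qed
  then show ?thesis unfolding iso_trivial_on_subscripts_def using \<psi> by blast
qed

text \<open>The right-hand side depends only on the set \<open>{i,j,k}\<close>. This makes the
  representation of triangles by sets of subscripts faithful.\<close>

lemma forms_triangle_set:
  "forms_triangle n L i j k \<longleftrightarrow> card {i,j,k} = 3 \<and> {i,j,k} \<subseteq> {1..n} \<and>
    interior (convex hull (\<Union>x\<in>{i,j,k}. \<Union>y\<in>{i,j,k}-{x}. L x \<inter> L y)) \<in> regions (L ` {1..n})"
proof (cases "i \<noteq> j \<and> i \<noteq> k \<and> j \<noteq> k")
  case True
  have "{i,j,k} - {i} = {j,k}" "{i,j,k} - {j} = {i,k}" "{i,j,k} - {k} = {i,j}" using True by auto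
  then have "(\<Union>x\<in>{i,j,k}. \<Union>y\<in>{i,j,k}-{x}. L x \<inter> L y) = L i \<inter> L j \<union> L j \<inter> L k \<union> L i \<inter> L k"
    by auto
  then show ?thesis using True by (simp add: forms_triangle_def)
next
  case False
  then have "card {i,j,k} \<le> 2" by (auto simp: card_insert_if)
  then show ?thesis using False by (auto simp: forms_triangle_def)
qed

lemma forms_triangle_iff_triangles: "forms_triangle n L i j k \<longleftrightarrow> {i,j,k} \<in> triangles n L"
proof
  assume "{i,j,k} \<in> triangles n L"
  then obtain a b c where "{i,j,k} = {a,b,c}" "forms_triangle n L a b c" unfolding triangles_def by blast
  then show "forms_triangle n L i j k" by (simp only: forms_triangle_set)
qed (auto simp: triangles_def)

lemma triangles_sorted:
  assumes SL: "S \<in> triangles n L"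
  shows "\<exists>i j k. S = {i,j,k} \<and> 1 \<le> i \<and> i < j \<and> j < k \<and> k \<le> n"
proof -
  obtain a b c where S: "S = {a,b,c}" and "forms_triangle n L a b c"
    using SL unfolding triangles_def by blast
  then have I: "a \<in> {1..n}" "b \<in> {1..n}" "c \<in> {1..n}" "a \<noteq> b" "a \<noteq> c" "b \<noteq> c"
    unfolding forms_triangle_def by simp_all
  consider "a < b" "b < c" | "a < c" "c < b" | "b < a" "a < c" | "b < c" "c < a" | "c < a" "a < b" | "c < b" "b < a"
    using I(4-6) by linarith
  then show ?thesis
  proof cases
    case 1 then show ?thesis using S I by (intro exI[of _ a] exI[of _ b] exI[of _ c]) auto
  next
    case 2 then show ?thesis using S I by (intro exI[of _ a] exI[of _ c] exI[of _ b]) auto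
  next
    case 3 then show ?thesis using S I by (intro exI[of _ b] exI[of _ a] exI[of _ c]) auto
  next
    case 4 then show ?thesis using S I by (intro exI[of _ b] exI[of _ c] exI[of _ a]) auto
  next
    case 5 then show ?thesis using S I by (intro exI[of _ c] exI[of _ a] exI[of _ b]) auto
  next
    case 6 then show ?thesis using S I by (intro exI[of _ c] exI[of _ b] exI[of _ a]) auto
  qed
qed

lemma triangles_eq_iff:
  "triangles n L = triangles n M \<longleftrightarrow>
    (\<forall>i j k. 1 \<le> i \<and> i < j \<and> j < k \<and> k \<le> n \<longrightarrow> (forms_triangle n L i j k \<longleftrightarrow> forms_triangle n M i j k))"
    (is "_ \<longleftrightarrow> ?R")
proof
  assume R: ?R
  have "S \<in> triangles n L \<longleftrightarrow> S \<in> triangles n M" for S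
    using triangles_sorted[of S n L] triangles_sorted[of S n M] R unfolding forms_triangle_iff_triangles by blast
  then show "triangles n L = triangles n M" by blast
qed (simp add: forms_triangle_iff_triangles)

section \<open>Lines numbered by their position on the polygon\<close>

definition cyc :: "nat \<Rightarrow> nat \<Rightarrow> nat \<Rightarrow> bool" where
  "cyc i j k \<longleftrightarrow> i < j \<and> j < k \<or> j < k \<and> k < i \<or> k < i \<and> i < j"

text \<open>Records all that is used of the polygon from here on: the signs of \<open>D\<close> and
  of \<open>Del\<close>, for lines indexed by position. Subscripts of lines enter only through
  \<open>a\<close>.\<close>

locale cyclic_family = line_family n "L \<circ> a" e h for n L a e h +
  fixes r
  assumes n4: "4 \<le> n"
    and shape: "cyc_shape n r a"
    and turn_iff: "\<And>i j. i \<in> {1..n} \<Longrightarrow> j \<in> {1..n} \<Longrightarrow> i \<noteq> j \<Longrightarrow> D i j > 0 \<longleftrightarrow> turn r a i j"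
    and Del_pos: "\<And>i j k. 1 \<le> i \<Longrightarrow> i < j \<Longrightarrow> j < k \<Longrightarrow> k \<le> n \<Longrightarrow> Del i j k > 0"
begin

lemma bij: "bij_betw a {1..n} {1..n}" using shape by (simp add: cyc_shape_def)

lemma Del_pos_iff:
  assumes "i \<in> {1..n}" "j \<in> {1..n}" "k \<in> {1..n}" "i \<noteq> j" "i \<noteq> k" "j \<noteq> k"
  shows "Del i j k > 0 \<longleftrightarrow> cyc i j k"
proof -
  have b: "1 \<le> i" "i \<le> n" "1 \<le> j" "j \<le> n" "1 \<le> k" "k \<le> n" using assms by auto
  have r: "Del j k i = Del i j k" "Del k i j = Del i j k" by (simp_all only: Del_rot[of i j k] Del_rot[of k i j])
  have s: "Del j i k = - Del i j k" "Del i k j = - Del i j k" "Del k j i = - Del i j k"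
    using Del_swap[of j i k] Del_swap[of i k j] Del_swap[of k j i] r by auto
  consider "i < j" "j < k" | "i < k" "k < j" | "j < i" "i < k" | "j < k" "k < i" | "k < i" "i < j" | "k < j" "j < i"
    using assms(4-6) by linarith
  then show ?thesis
  proof cases
    case 1 then show ?thesis using Del_pos[of i j k] b by (simp add: cyc_def)
  next
    case 2 then show ?thesis using Del_pos[of i k j] b s by (simp add: cyc_def)
  next
    case 3 then show ?thesis using Del_pos[of j i k] b s by (simp add: cyc_def)
  next
    case 4 then show ?thesis using Del_pos[of j k i] b r by (simp add: cyc_def)
  next
    case 5 then show ?thesis using Del_pos[of k i j] b r by (simp add: cyc_def)
  next
    case 6 then show ?thesis using Del_pos[of k j i] b s by (simp add: cyc_def)
  qed
qed

lemma F_P_pos_iff: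
  assumes "i \<in> {1..n}" "j \<in> {1..n}" "m \<in> {1..n}" "i \<noteq> j" "i \<noteq> m" "j \<noteq> m"
  shows "F m (P i j) > 0 \<longleftrightarrow> cyc i j m = turn r a i j"
proof -
  note D = D_nz[OF assms(1,2,4)]
  have "F m (P i j) > 0 \<longleftrightarrow> Del i j m * D i j > 0"
    by (simp add: F_P[OF D] zero_less_divide_iff_mult)
  also have "\<dots> \<longleftrightarrow> cyc i j m = turn r a i j"
    using zero_less_mult_iff_eq[of "Del i j m" "D i j"] Del_nz[OF assms] D
      Del_pos_iff[OF assms] turn_iff[OF assms(1,2,4)] by simp
  finally show ?thesis .
qed

text \<open>For a side \<open>m\<close> in the arc between two of the three sides,
  \<open>cyc\<close> is false for that pair and true for the other two pairs. So the three vertices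
  are on one side of \<open>m\<close> iff the turn over that arc fails and the other two hold; the
  opposite combination contradicts \<open>two_turns\<close>.\<close>

lemma forms_triangle_positions:
  assumes "1 \<le> i" "i < j" "j < k" "k \<le> n"
  shows "forms_triangle n (L \<circ> a) i j k \<longleftrightarrow>
    (\<forall>m\<in>{1..n}-{i,j,k}. (m < i \<or> k < m \<longrightarrow> \<not> turn r a k i) \<and> (i < m \<and> m < j \<longrightarrow> \<not> turn r a i j) \<and>
      (j < m \<and> m < k \<longrightarrow> \<not> turn r a j k))"
proof -
  have I: "i \<in> {1..n}" "j \<in> {1..n}" "k \<in> {1..n}" "i \<noteq> j" "i \<noteq> k" "j \<noteq> k" using assms by auto
  note two = two_turns[OF shape assms]
  show ?thesis unfolding forms_triangle_iff[OF I]
  proof (rule ball_cong[OF refl])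
    fix m assume "m \<in> {1..n} - {i,j,k}"
    then have m: "m \<in> {1..n}" "i \<noteq> m" "j \<noteq> m" "k \<noteq> m" by auto
    have nz: "F m (P j k) \<noteq> 0" "F m (P k i) \<noteq> 0" "F m (P i j) \<noteq> 0"
      using F_P_nz[OF I(2,3) m(1) I(6) m(3,4)[symmetric]] F_P_nz[OF I(3,1) m(1) I(5)[symmetric] m(4,2)[symmetric]]
        F_P_nz[OF I(1,2) m(1) I(4) m(2,3)[symmetric]] by blast+
    have c: "cyc j k m \<longleftrightarrow> k < m \<or> m < j" "cyc k i m \<longleftrightarrow> i < m \<and> m < k" "cyc i j m \<longleftrightarrow> j < m \<or> m < i"
      using assms m by (auto simp: cyc_def)
    have "m < i \<or> i < m \<and> m < j \<or> j < m \<and> m < k \<or> k < m" using m by linarith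
    then show "(0 < F m (P j k) * F m (P k i) \<and> 0 < F m (P j k) * F m (P i j)) \<longleftrightarrow>
      (m < i \<or> k < m \<longrightarrow> \<not> turn r a k i) \<and> (i < m \<and> m < j \<longrightarrow> \<not> turn r a i j) \<and>
      (j < m \<and> m < k \<longrightarrow> \<not> turn r a j k)"
      unfolding zero_less_mult_iff_eq[OF no_zero_divisors[OF nz(1,2)]]
        zero_less_mult_iff_eq[OF no_zero_divisors[OF nz(1,3)]]
        F_P_pos_iff[OF I(2,3) m(1) I(6) m(3,4)] F_P_pos_iff[OF I(3,1) m(1) I(5)[symmetric] m(4,2)]
        F_P_pos_iff[OF I(1,2) m(1) I(4) m(2,3)] c
      using two assms by (elim disjE[of "m < i"] disjE[of "i < m \<and> m < j"] disjE[of "j < m \<and> m < k"]) auto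
  qed
qed

text \<open>At least two of the three turns hold, and an arc whose turn holds may contain no further
  side. So the sides are consecutive, and since \<open>n \<ge> 4\<close> the third arc does contain
  a side, which forces its turn to fail.\<close>

lemma forms_triangle_consecutive:
  assumes "1 \<le> i" "i < j" "j < k" "k \<le> n"
  shows "forms_triangle n (L \<circ> a) i j k \<longleftrightarrow>
    j = i + 1 \<and> k = i + 2 \<and> turn r a i k \<or> i = 1 \<and> j = n - 1 \<and> k = n \<and> turn r a j i \<or>
    i = 1 \<and> j = 2 \<and> k = n \<and> turn r a k j"
proof -
  note two = two_turns[OF shape assms]
  have sw: "turn r a k i \<longleftrightarrow> \<not> turn r a i k" "turn r a j i \<longleftrightarrow> \<not> turn r a i j" "turn r a k j \<longleftrightarrow> \<not> turn r a j k"
    by (rule turn_swap[OF shape]; use assms in auto)+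
  have "forms_triangle n (L \<circ> a) i j k \<longleftrightarrow> (turn r a k i \<longrightarrow> i = 1 \<and> k = n) \<and> (turn r a i j \<longrightarrow> j = i + 1) \<and>
     (turn r a j k \<longrightarrow> k = j + 1)" (is "_ \<longleftrightarrow> ?R")
    unfolding forms_triangle_positions[OF assms]
  proof
    assume *: "\<forall>m\<in>{1..n}-{i,j,k}. (m < i \<or> k < m \<longrightarrow> \<not> turn r a k i) \<and> (i < m \<and> m < j \<longrightarrow> \<not> turn r a i j) \<and>
      (j < m \<and> m < k \<longrightarrow> \<not> turn r a j k)"
    have "i = 1" if "turn r a k i" using bspec[OF *, of 1] that assms by force
    moreover have "k = n" if "turn r a k i" using bspec[OF *, of n] that assms by force
    moreover have "j = i + 1" if "turn r a i j" using bspec[OF *, of "i+1"] that assms by force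
    moreover have "k = j + 1" if "turn r a j k" using bspec[OF *, of "j+1"] that assms by force
    ultimately show ?R by blast
  qed auto
  then show ?thesis using two assms n4 by (auto simp: sw)
qed

end

section \<open>The triangles\<close>

text \<open>The last two sets are the triples that run across the end of the numbering, starting at
  positions \<open>n-1\<close> and \<open>n\<close>.\<close>

definition position_triangles :: "nat \<Rightarrow> nat \<Rightarrow> (nat \<Rightarrow> nat) \<Rightarrow> nat set set" where
  "position_triangles n r a = {{i, i+1, i+2} | i. 1 \<le> i \<and> i + 2 \<le> n \<and> turn r a i (i+2)} \<union>
     (if turn r a (n-1) 1 then {{1, n-1, n}} else {}) \<union> (if turn r a n 2 then {{1, 2, n}} else {})"

context cyclic_family
begin

lemma triangles_comp: "triangles n (L \<circ> a) = position_triangles n r a"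
proof (intro set_eqI iffI)
  fix S assume S: "S \<in> triangles n (L \<circ> a)"
  then obtain i j k where ijk: "S = {i,j,k}" "1 \<le> i" "i < j" "j < k" "k \<le> n"
    using triangles_sorted by meson
  then have "forms_triangle n (L \<circ> a) i j k" using S by (simp add: forms_triangle_iff_triangles)
  then have "j = i + 1 \<and> k = i + 2 \<and> turn r a i k \<or> i = 1 \<and> j = n - 1 \<and> k = n \<and> turn r a j i \<or>
    i = 1 \<and> j = 2 \<and> k = n \<and> turn r a k j" using forms_triangle_consecutive[OF ijk(2-5)] by blast
  then show "S \<in> position_triangles n r a"
    using ijk unfolding position_triangles_def by (elim disjE conjE) auto
next
  fix S assume "S \<in> position_triangles n r a"
  then consider i where "S = {i,i+1,i+2}" "1 \<le> i" "i + 2 \<le> n" "turn r a i (i+2)"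
    | "S = {1,n-1,n}" "turn r a (n-1) 1" | "S = {1,2,n}" "turn r a n 2"
    unfolding position_triangles_def by (auto split: if_splits)
  then show "S \<in> triangles n (L \<circ> a)"
  proof cases
    case 1
    then show ?thesis using forms_triangle_consecutive[of i "i+1" "i+2"]
      by (simp flip: forms_triangle_iff_triangles)
  next
    case 2
    then show ?thesis using forms_triangle_consecutive[of 1 "n-1" n] n4
      by (simp flip: forms_triangle_iff_triangles)
  next
    case 3
    then show ?thesis using forms_triangle_consecutive[of 1 2 n] n4
      by (simp flip: forms_triangle_iff_triangles)
  qed
qed

lemma triangles_eq: "triangles n L = (`) a ` position_triangles n r a"
proof -
  have img: "(L \<circ> a) ` {1..n} = L ` {1..n}"
    using bij_betw_imp_surj_on[OF bij] by (metis image_comp)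
  have *: "forms_triangle n L (a i) (a j) (a k) \<longleftrightarrow> forms_triangle n (L \<circ> a) i j k"
    if "i \<in> {1..n}" "j \<in> {1..n}" "k \<in> {1..n}" for i j k
    using that bij_betwE[OF bij] inj_on_eq_iff[OF bij_betw_imp_inj_on[OF bij]]
    unfolding forms_triangle_def img by simp
  have "triangles n L = (`) a ` triangles n (L \<circ> a)"
  proof (intro set_eqI iffI)
    fix S assume S: "S \<in> triangles n L"
    then obtain x y z where xyz: "S = {x,y,z}" "forms_triangle n L x y z" unfolding triangles_def by blast
    then have "x \<in> a ` {1..n}" "y \<in> a ` {1..n}" "z \<in> a ` {1..n}"
      using bij by (auto simp: forms_triangle_def bij_betw_def)
    then obtain i j k where "i \<in> {1..n}" "j \<in> {1..n}" "k \<in> {1..n}" "x = a i" "y = a j" "z = a k" by blast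
    then have "forms_triangle n (L \<circ> a) i j k" "S = a ` {i,j,k}" using xyz * by auto
    then show "S \<in> (`) a ` triangles n (L \<circ> a)" unfolding triangles_def by blast
  next
    fix S assume "S \<in> (`) a ` triangles n (L \<circ> a)"
    then obtain i j k where ijk: "S = a ` {i,j,k}" "forms_triangle n (L \<circ> a) i j k"
      unfolding triangles_def by blast
    then have "forms_triangle n L (a i) (a j) (a k)" using * by (auto simp: forms_triangle_def)
    then show "S \<in> triangles n L" using ijk(1) by (auto simp: forms_triangle_iff_triangles)
  qed
  then show ?thesis by (simp only: triangles_comp)
qed

end

text \<open>Inside one ascending run the outer sides always make a left turn. Only the triples
  across the breaks between \<open>r\<close> and \<open>r+1\<close> and between \<open>n\<close> and
  \<open>1\<close> impose a condition; the one starting at \<open>n-1\<close> is compared with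
  \<open>a 1 = 1\<close>, which just says that \<open>n-1\<close> lies in the second run.\<close>

lemma image_position_triangles:
  assumes "cyc_shape n r a" "4 \<le> n"
  shows "(`) a ` position_triangles n r a =
             {{a j, a (j+1), a (j+2)} | j. 1 \<le> j \<and> j + 2 \<le> r \<or> r + 1 \<le> j \<and> j + 2 \<le> n} \<union>
             (if n \<ge> r + 2 then {{a 1, a (n-1), a n}} else {}) \<union>
             (if a 2 < a n then {{a 1, a 2, a n}} else {}) \<union>
             (if a (r+1) < a (r-1) then {{a (r+1), a (r-1), a r}} else {}) \<union>
             (if a (r+2) < a r \<and> n \<ge> r + 2 then {{a (r+1), a (r+2), a r}} else {})"
    (is "?l = ?r")
proof -
  have r: "2 \<le> r" "r + 1 \<le> n" and a1: "a 1 = 1" and bij: "bij_betw a {1..n} {1..n}"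
    using assms by (auto simp: cyc_shape_def)
  have ai: "a i > 1" if "2 \<le> i" "i \<le> n" for i
    using bij_betw_neq[OF bij, of i 1] bspec[OF bij_betwE[OF bij], of i] that a1 by auto
  have ne: "a i \<noteq> a j" if "1 \<le> i" "i \<le> n" "1 \<le> j" "j \<le> n" "i \<noteq> j" for i j
    using bij_betw_neq[OF bij, of i j] that by auto
  have t1: "turn r a (n-1) 1 \<longleftrightarrow> n \<ge> r + 2"
  proof -
    have "a (n-1) > 1" using assms(2) by (intro ai) auto
    then show ?thesis using a1 r assms(2) by (auto simp: turn_def)
  qed
  have t2: "turn r a n 2 \<longleftrightarrow> a 2 < a n"
    using ne[of 2 n] r assms(2) by (auto simp: turn_def)
  have mono: "a i < a (i+2)" if "1 \<le> i" "i + 2 \<le> r \<or> r < i" "i + 2 \<le> n" for i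
    using cyc_shape_mono[OF assms(1), of i "i+2"] that by auto
  have t3: "turn r a i (i+2) \<longleftrightarrow> i + 2 \<le> r \<or> r + 1 \<le> i \<or> i = r - 1 \<and> a (r+1) < a (r-1) \<or> i = r \<and> a (r+2) < a r"
    if "1 \<le> i" "i + 2 \<le> n" for i
  proof -
    consider "i + 2 \<le> r" | "r + 1 \<le> i" | "i = r - 1" | "i = r" by linarith
    then show ?thesis
    proof cases
      case 3
      then have "i + 2 = r + 1" using r by simp
      then have "turn r a i (i+2) \<longleftrightarrow> turn r a (r-1) (r+1)" using 3 by (simp only:)
      also have "\<dots> \<longleftrightarrow> a (r+1) < a (r-1)"
      proof -
        have "a (r-1) \<noteq> a (r+1)" by (rule ne) (use 3 r that in auto)
        then show ?thesis using 3 r by (auto simp: turn_def)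
      qed
      finally show ?thesis using 3 r by auto
    next
      case 4
      then show ?thesis using r ne[of r "r+2"] that by (auto simp: turn_def)
    qed (use mono[of i] that in \<open>auto simp: turn_def\<close>)
  qed
  have "{{i, i+1, i+2} | i. 1 \<le> i \<and> i + 2 \<le> n \<and> turn r a i (i+2)} =
    {{j, j+1, j+2} | j. 1 \<le> j \<and> j + 2 \<le> r \<or> r + 1 \<le> j \<and> j + 2 \<le> n} \<union>
     (if a (r+1) < a (r-1) then {{r+1, r-1, r}} else {}) \<union>
     (if a (r+2) < a r \<and> n \<ge> r + 2 then {{r+1, r+2, r}} else {})" (is "?A = ?B \<union> ?C \<union> ?D")
  proof (intro set_eqI iffI)
    fix S assume "S \<in> ?A"
    then obtain i where i: "S = {i,i+1,i+2}" "1 \<le> i" "i + 2 \<le> n" "turn r a i (i+2)" by blast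
    then have "i + 2 \<le> r \<or> r + 1 \<le> i \<or> i = r - 1 \<and> a (r+1) < a (r-1) \<or> i = r \<and> a (r+2) < a r"
      using t3 by blast
    then show "S \<in> ?B \<union> ?C \<union> ?D"
    proof (elim disjE conjE)
      assume "i = r - 1" "a (r+1) < a (r-1)"
      moreover from this have "S = {r+1, r-1, r}" using i r by auto
      ultimately show ?thesis by simp
    next
      assume "i = r" "a (r+2) < a r"
      moreover from this have "S = {r+1, r+2, r}" using i by auto
      ultimately show ?thesis using i by simp
    qed (use i in blast)+
  next
    fix S assume "S \<in> ?B \<union> ?C \<union> ?D"
    then have "S \<in> ?B \<or> a (r+1) < a (r-1) \<and> S = {r+1,r-1,r} \<or> a (r+2) < a r \<and> n \<ge> r + 2 \<and> S = {r+1,r+2,r}"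
      by (auto simp del: mem_Collect_eq split: if_splits)
    then have "\<exists>i. S = {i,i+1,i+2} \<and> 1 \<le> i \<and> i + 2 \<le> n \<and>
       (i + 2 \<le> r \<or> r + 1 \<le> i \<or> i = r - 1 \<and> a (r+1) < a (r-1) \<or> i = r \<and> a (r+2) < a r)"
    proof (elim disjE conjE)
      assume "S \<in> ?B"
      then obtain j where "S = {j, j+1, j+2}" "1 \<le> j \<and> j + 2 \<le> r \<or> r + 1 \<le> j \<and> j + 2 \<le> n" by blast
      then show ?thesis using r by (intro exI[of _ j]) auto
    next
      assume *: "a (r+1) < a (r-1)" "S = {r+1,r-1,r}"
      then have "S = {r-1, r-1+1, r-1+2}" using r by auto
      then show ?thesis using * r by (intro exI[of _ "r-1"]) auto
    next
      assume "a (r+2) < a r" "n \<ge> r + 2" "S = {r+1,r+2,r}"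
      then show ?thesis using r by (intro exI[of _ r]) auto
    qed
    then show "S \<in> ?A" using t3 by blast
  qed
  then have P: "position_triangles n r a = ?B \<union> ?C \<union> ?D \<union> (if n \<ge> r + 2 then {{1, n-1, n}} else {}) \<union>
     (if a 2 < a n then {{1, 2, n}} else {})"
    unfolding position_triangles_def t1 t2 by simp
  have "(`) a ` ?B = {{a j, a (j+1), a (j+2)} | j. 1 \<le> j \<and> j + 2 \<le> r \<or> r + 1 \<le> j \<and> j + 2 \<le> n}"
    by (auto simp: image_iff) (metis image_empty image_insert)+
  then show ?thesis
    unfolding P by (simp add: image_Un if_distrib[of "(`) ((`) a)"] ac_simps cong: if_cong)
qed

text \<open>The position in \<open>{1..n}\<close> congruent to \<open>p + 1\<close>; position \<open>1\<close> is \<open>p = 0\<close>.\<close>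

definition cidx :: "nat \<Rightarrow> int \<Rightarrow> nat" where "cidx n p = nat (p mod int n) + 1"

lemma cidx_in: "0 < n \<Longrightarrow> cidx n p \<in> {1..n}"
proof -
  assume "0 < n"
  then have "nat (p mod int n) < n" by (simp add: nat_less_iff)
  then show ?thesis by (simp add: cidx_def)
qed

lemma cidx_eq_iff: "0 < n \<Longrightarrow> cidx n p = cidx n q \<longleftrightarrow> int n dvd p - q"
  by (simp add: cidx_def eq_nat_nat_iff mod_eq_dvd_iff)

lemma cidx_int: "i < n \<Longrightarrow> cidx n (int i) = i + 1"
  by (simp add: cidx_def)

text \<open>With positions taken modulo \<open>n\<close> the triples across the end of the numbering
  are no longer special.\<close>

lemma position_triangles_cidx:
  assumes "4 \<le> n"
  shows "position_triangles n r a =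
    {{cidx n p, cidx n (p+1), cidx n (p+2)} | p. turn r a (cidx n p) (cidx n (p+2))}" (is "_ = ?R")
proof (intro set_eqI iffI)
  have c: "cidx n (int n + p) = cidx n p" for p using assms by (simp add: cidx_def)
  have ends: "cidx n (int n - 2) = n - 1" "cidx n (int n - 1) = n" "cidx n (int n) = 1" "cidx n (int n + 1) = 2" "cidx n (1 + int n) = 2"
    using assms cidx_int[of "n-2" n] cidx_int[of "n-1" n] c[of 0] c[of 1] cidx_int[of 0 n] cidx_int[of 1 n]
    by (simp_all add: of_nat_diff add.commute)
  {
    fix S assume "S \<in> position_triangles n r a"
    then consider i where "S = {i,i+1,i+2}" "1 \<le> i" "i + 2 \<le> n" "turn r a i (i+2)"
      | "S = {1,n-1,n}" "turn r a (n-1) 1" | "S = {1,2,n}" "turn r a n 2"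
      unfolding position_triangles_def by (auto split: if_splits)
    then show "S \<in> ?R"
    proof cases
      case 1
      then have "cidx n (int i - 1) = i" "cidx n (int i - 1 + 1) = i + 1" "cidx n (int i - 1 + 2) = i + 2"
        using cidx_int[of "i-1" n] cidx_int[of i n] cidx_int[of "i+1" n] by (simp_all add: of_nat_diff add_ac)
      then show ?thesis using 1 by (intro CollectI exI[of _ "int i - 1"]) simp
    next
      case 2
      then show ?thesis using ends by (intro CollectI exI[of _ "int n - 2"]) auto
    next
      case 3
      then show ?thesis using ends by (intro CollectI exI[of _ "int n - 1"]) auto
    qed
  }
  fix S assume "S \<in> ?R"
  then obtain p' where p': "S = {cidx n p', cidx n (p'+1), cidx n (p'+2)}" "turn r a (cidx n p') (cidx n (p'+2))" by blast
  define q where "q = nat (p' mod int n)"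
  have q: "q < n" "int q = p' mod int n" using assms by (auto simp: q_def nat_less_iff)
  have e: "cidx n p' = cidx n (int q)" "cidx n (p'+1) = cidx n (int q + 1)" "cidx n (p'+2) = cidx n (int q + 2)"
    unfolding q(2) by (simp_all add: cidx_def mod_add_left_eq)
  consider "q + 3 \<le> n" | "q = n - 2" | "q = n - 1" using q by linarith
  then show "S \<in> position_triangles n r a"
  proof cases
    case 1
    then have "cidx n (int q) = q + 1" "cidx n (int q + 1) = q + 1 + 1" "cidx n (int q + 2) = q + 1 + 2"
      using cidx_int[of q n] cidx_int[of "q+1" n] cidx_int[of "q+2" n] by (simp_all add: add_ac)
    then show ?thesis using p' 1 unfolding e position_triangles_def by (intro UnI1 CollectI exI[of _ "q+1"]) simp
  next
    case 2
    then have "int q = int n - 2" using assms by simp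
    then have "cidx n (int q) = n - 1" "cidx n (int q + 1) = n" "cidx n (int q + 2) = 1" using ends by simp_all
    then show ?thesis using p' unfolding e position_triangles_def by (simp add: insert_commute)
  next
    case 3
    then have "int q = int n - 1" using assms by simp
    then have "cidx n (int q) = n" "cidx n (int q + 1) = 1" "cidx n (int q + 2) = 2" using ends by simp_all
    then show ?thesis using p' unfolding e position_triangles_def by (simp add: insert_commute)
  qed
qed

text \<open>The turn over a triple consists of two exterior angles, and it fails when they exceed a
  half-turn. Two failing triples must share an exterior angle, so their starts are cyclically
  adjacent, and \<open>n \<ge> 4\<close> excludes three pairwise adjacent starts. The proof renders
  this as comparisons: a failure across the end means \<open>a n < a 2\<close>, which the ascending
  runs make incompatible with a failure at the other break unless the two are neighbours.\<close>

lemma failing_triples_adjacent: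
  assumes "cyc_shape n r a" "4 \<le> n"
  shows "\<exists>x. \<forall>p. turn r a (cidx n p) (cidx n (p+2)) \<or> int n dvd p - x \<or> int n dvd p - (x+1)"
proof -
  have r: "2 \<le> r" "r + 1 \<le> n" and a1: "a 1 = 1" and bij: "bij_betw a {1..n} {1..n}"
    using assms by (auto simp: cyc_shape_def)
  note mono = cyc_shape_mono[OF assms(1)]
  have ne: "a i \<noteq> a j" if "1 \<le> i" "i \<le> n" "1 \<le> j" "j \<le> n" "i \<noteq> j" for i j
    using bij_betw_neq[OF bij, of i j] that by auto
  have mono_le: "a i \<le> a j" if "i \<le> j" "1 \<le> i" "j \<le> n" "j \<le> r \<or> r < i" for i j
    using mono[of i j] that by (cases "i = j") auto
  define ok where "ok q \<longleftrightarrow> turn r a (cidx n (int q)) (cidx n (int q + 2))" for q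
  have lin: "ok q \<longleftrightarrow> turn r a (q+1) (q+3)" if "q + 3 \<le> n" for q
    using that cidx_int[of q n] cidx_int[of "q+2" n] by (simp add: ok_def add.commute[of 2 "int q"] numeral_eq_Suc One_nat_def)
  have okn: "ok (n-1) \<longleftrightarrow> a 2 < a n"
  proof -
    have "cidx n (int (n-1) + 2) = 2" using assms by (simp add: cidx_def of_nat_diff)
    then show ?thesis using r cidx_int[of "n-1" n] assms(2) ne[of 2 n] by (auto simp: ok_def turn_def)
  qed
  have okn2: "ok (n-2)" if "r + 2 \<le> n"
  proof -
    have "cidx n (int (n-2) + 2) = 1" using assms by (simp add: cidx_def of_nat_diff)
    moreover have "a (n-1) > 1"
    proof -
      have "n - 1 \<in> {1..n}" "n - 1 \<noteq> 1" using assms(2) by auto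
      then show ?thesis using ne[of "n-1" 1] bspec[OF bij_betwE[OF bij], of "n-1"] a1 assms(2) by auto
    qed
    moreover have "cidx n (int (n-2)) = n - 1"
      using cidx_int[of "n-2" n] assms(2) by linarith
    ultimately show ?thesis using r a1 that
      by (auto simp: ok_def turn_def)
  qed
  \<comment> \<open>Here \<open>q\<close> counts from 0, so its triple occupies the positions
    \<open>q+1\<close> to \<open>q+3\<close>. The triple at \<open>n-2\<close> holds if
    \<open>r + 2 \<le> n\<close>; otherwise \<open>n-2\<close> is \<open>r-1\<close>, which is
    excluded.\<close>
  have other: "ok q" if "q < n" "q \<noteq> r - 2" "q \<noteq> r - 1" "q \<noteq> n - 1" for q
  proof (cases "q = n - 2")
    case True
    then show ?thesis using okn2 that r by (cases "r + 2 \<le> n") auto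
  next
    case False
    then have "q + 3 \<le> n" using that by linarith
    moreover have "q + 3 \<le> r \<or> r \<le> q" using that by linarith
    ultimately show ?thesis using lin[of q] mono[of "q+1" "q+3"] by (auto simp: turn_def)
  qed
  have r2: "\<not> ok (r-2) \<Longrightarrow> a (r-1) < a (r+1)"
  proof -
    have e: "r - 2 + 1 = r - 1" "r - 2 + 3 = r + 1" "r - 2 + 3 \<le> n" using r by auto
    have "a (r-1) \<noteq> a (r+1)" by (rule ne) (use r in auto)
    then show "\<not> ok (r-2) \<Longrightarrow> a (r-1) < a (r+1)"
      using lin[OF e(3), unfolded e(1,2)] r by (auto simp: turn_def)
  qed
  have r1: "\<not> ok (r-1) \<Longrightarrow> r + 2 \<le> n \<Longrightarrow> a r < a (r+2)"
    using lin[of "r-1"] r ne[of r "r+2"] by (auto simp: turn_def)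
  have m: "(r - 2 + 1) mod n = r - 1" using r by simp
  have first: "\<exists>x<n. \<forall>q<n. ok q \<or> q = x \<or> q = (x + 1) mod n" if "ok (n-1)"
    using other that r m by (intro exI[of _ "r-2"]) (unfold m, use r in force)
  have "\<exists>x<n. \<forall>q<n. ok q \<or> q = x \<or> q = (x + 1) mod n"
  proof (cases "r + 1 = n")
    case True
    show ?thesis
    proof (cases "ok (n-1)")
      case T: True
      then show ?thesis by (rule first)
    next
      case False
      have "ok (r-2)"
      proof (rule ccontr)
        assume "\<not> ok (r-2)"
        then have "a (r-1) < a n" using r2 True by simp
        moreover have "a 2 \<le> a (r-1)" by (rule mono_le) (use True assms(2) in linarith)+
        ultimately show False using False okn by simp
      qed
      then show ?thesis using other True r by (intro exI[of _ "r-1"]) auto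
    qed
  next
    case rn: False
    then have rn: "r + 2 \<le> n" using r by simp
    have 1: "a 2 \<le> a r" by (rule mono_le) (use r in auto)
    have 2: "a (r+2) \<le> a n" by (rule mono_le) (use rn in auto)
    have 3: "a (r+1) \<le> a n" by (rule mono_le) (use rn in auto)
    show ?thesis
    proof (cases "ok (r-1)")
      case False
      then have "ok (n-1)" using r1 rn 1 2 okn by simp
      then show ?thesis by (rule first)
    next
      case ok1: True
      show ?thesis
      proof (cases "ok (n-1)")
        case True
        then show ?thesis by (rule first)
      next
        case False
        \<comment> \<open>Two failures would give
          \<open>a n < a 2 \<le> a (r-1) < a (r+1) \<le> a n\<close>. For \<open>r = 2\<close> the
          middle step is missing, but then \<open>r-2\<close> is 0, the cyclic successor of
          \<open>n-1\<close>.\<close>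
        have "ok (r-2) \<or> r = 2"
        proof (rule ccontr)
          assume *: "\<not> (ok (r-2) \<or> r = 2)"
          then have "2 \<le> r - 1" using r by linarith
          then have "a 2 \<le> a (r-1)" by (rule mono_le) (use r in linarith)+
          then show False using r2 * 3 False okn by simp
        qed
        then have "ok q \<or> q = n - 1 \<or> q = 0" if "q < n" for q
          using other[OF that] ok1 by (metis diff_self_eq_0)
        then show ?thesis using assms(2) by (intro exI[of _ "n-1"]) simp
      qed
    qed
  qed
  then obtain x where x: "\<And>q. q < n \<Longrightarrow> ok q \<or> q = x \<or> q = (x + 1) mod n" by blast
  have "turn r a (cidx n p) (cidx n (p+2)) \<or> int n dvd p - int x \<or> int n dvd p - (int x + 1)" for p
  proof -
    define q where "q = nat (p mod int n)"
    have q: "q < n" "int q = p mod int n" using assms by (auto simp: q_def nat_less_iff)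
    have e: "cidx n p = cidx n (int q)" "cidx n (p+2) = cidx n (int q + 2)"
      unfolding q(2) by (simp_all add: cidx_def mod_add_left_eq)
    from x[OF q(1)] show ?thesis
    proof (elim disjE)
      assume "ok q" then show ?thesis by (simp add: e ok_def)
    next
      assume "q = x"
      then have "p mod int n = int x mod int n" using q by (metis mod_mod_trivial)
      then show ?thesis by (simp add: mod_eq_dvd_iff)
    next
      assume "q = (x + 1) mod n"
      then have "p mod int n = (int x + 1) mod int n" using q(2) by (simp add: zmod_int)
      then show ?thesis by (simp add: mod_eq_dvd_iff)
    qed
  qed
  then show ?thesis by blast
qed

section \<open>The triangles determine the cycle\<close>

text \<open>A sequence with period \<open>n\<close> that is injective on each period. Integer
  indices avoid boundary cases and make reversal the substitution of \<open>-p\<close> for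
  \<open>p\<close>.\<close>

definition cyclic_seq :: "nat \<Rightarrow> (int \<Rightarrow> 'a) \<Rightarrow> bool" where
  "cyclic_seq n y \<longleftrightarrow> (\<forall>p q. y p = y q \<longleftrightarrow> int n dvd p - q)"

definition triple :: "(int \<Rightarrow> 'a) \<Rightarrow> int \<Rightarrow> 'a set" where
  "triple y p = {y p, y (p+1), y (p+2)}"

lemma cyclic_seqD: "cyclic_seq n y \<Longrightarrow> y p = y q \<longleftrightarrow> int n dvd p - q"
  by (simp add: cyclic_seq_def)

lemma dvd_small: "int n dvd x \<Longrightarrow> \<bar>x\<bar> < int n \<Longrightarrow> x = 0"
  using dvd_imp_le_int[of x "int n"] by auto

lemma cyclic_seq_neq: "cyclic_seq n y \<Longrightarrow> p \<noteq> q \<Longrightarrow> \<bar>p - q\<bar> < int n \<Longrightarrow> y p \<noteq> y q"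
  using dvd_small[of n "p - q"] by (auto simp: cyclic_seqD)

lemma cyclic_seq_shift: "cyclic_seq n y \<Longrightarrow> y p = y q \<Longrightarrow> y (p + d) = y (q + d)"
  by (simp add: cyclic_seqD)

text \<open>Terms determine positions only modulo \<open>n\<close>; a bound below \<open>n\<close>
  on the discrepancy turns the congruence into an equality.\<close>

lemma cyclic_seq_diff:
  assumes "cyclic_seq n y" "y p = y (s + i)" "y (p + d) = y (s + j)" "\<bar>d + i - j\<bar> < int n"
  shows "j = d + i"
proof -
  have "int n dvd p - (s + i)" "int n dvd p + d - (s + j)" using assms by (simp_all add: cyclic_seqD)
  then have "int n dvd (p + d - (s + j)) - (p - (s + i))" by (rule dvd_diff[rotated])
  then have "int n dvd d + i - j" by (simp add: algebra_simps)
  then show ?thesis using dvd_small[of n "d + i - j"] assms(4) by simp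
qed

lemma in_triple: "u \<in> triple y s \<longleftrightarrow> (\<exists>i\<in>{0,1,2}. u = y (s + i))"
  by (auto simp: triple_def)

lemma triple_extend:
  assumes y: "cyclic_seq n y" and "5 \<le> n" and eq: "{y k, y (k+1), z} = triple y s" and z: "z \<noteq> y k" "z \<noteq> y (k+1)"
  shows "z = y (k+2) \<or> z = y (k-1)"
proof -
  obtain i where i: "i \<in> {0,1,2}" "y k = y (s + i)" using eq in_triple by (metis insertI1)
  obtain j where j: "j \<in> {0,1,2}" "y (k+1) = y (s + j)" using eq in_triple by (metis insertI1 insert_commute)
  obtain l where l: "l \<in> {0,1,2}" "z = y (s + l)" using eq in_triple by (metis insertI1 insert_commute)
  have ji: "j = 1 + i" using cyclic_seq_diff[OF y i(2) j(2)] i j assms(2) by auto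
  have sh: "y (s + i + d) = y (k + d)" for d using cyclic_seq_shift[OF y i(2)] by simp
  have "l \<noteq> i" "l \<noteq> j" using i j l z by auto
  then have "i = 0 \<and> l = 2 \<or> i = 1 \<and> l = 0" using ji i j l by auto
  then show ?thesis using l sh[of 2] sh[of "-1"] by auto
qed

text \<open>If \<open>u\<close> and \<open>w\<close> are the two ends of one triple, they are also
  the two ends of the other, in the same order, and the triples coincide. So distinct triples can
  share only a neighbouring pair.\<close>

lemma triple_common_pair:
  assumes y: "cyclic_seq n y" and "5 \<le> n" and "triple y q \<noteq> triple y s"
    and u: "u \<in> triple y q" "u \<in> triple y s" and w: "w \<in> triple y q" "w \<in> triple y s" and "u \<noteq> w"
  shows "\<exists>k. u = y k \<and> w = y (k+1) \<or> u = y (k+1) \<and> w = y k"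
proof -
  obtain i where i: "i \<in> {0,1,2}" "u = y (q + i)" using u in_triple by metis
  obtain i' where i': "i' \<in> {0,1,2}" "w = y (q + i')" using w in_triple by metis
  obtain j where j: "j \<in> {0,1,2}" "u = y (s + j)" using u in_triple by metis
  obtain j' where j': "j' \<in> {0,1,2}" "w = y (s + j')" using w in_triple by metis
  \<comment> \<open>The two differences are at most 2 each, so the discrepancy is at most 4; this is
    where \<open>5 \<le> n\<close> enters.\<close>
  have "j' = (i' - i) + j"
    by (rule cyclic_seq_diff[OF y, of "q + i" s j "i' - i" j']) (use i i' j j' assms(2) in auto)
  moreover have "\<not> (j = i \<and> i' \<noteq> i)" if "j = i"
  proof -
    have "y (q + i + (d - i)) = y (s + i + (d - i))" for d
      by (rule cyclic_seq_shift[OF y]) (use i j that in simp)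
    then have "y (q + d) = y (s + d)" for d by simp
    from this[of 0] this[of 1] this[of 2] have "triple y q = triple y s" by (simp add: triple_def)
    then show ?thesis using assms(3) by simp
  qed
  moreover have "i \<noteq> i'" using i i' assms(8) by auto
  ultimately have "i' = i + 1 \<or> i = i' + 1" using i i' j j' by auto
  then show ?thesis using i i' by (auto intro: exI[of _ "q + i"] exI[of _ "q + i'"] simp: add.assoc)
qed

text \<open>Once two neighbours are matched, \<open>triple_extend\<close> leaves two candidates for
  the next term: the one ahead, and one behind that is already taken. Only the first extension, to
  \<open>x (p+3)\<close>, needs another argument, because the term behind has not been matched
  yet.\<close>

lemma triple_chain_forward:
  assumes x: "cyclic_seq n x" and y: "cyclic_seq n y" and n: "5 \<le> n"
    and T: "\<And>j. j + 3 \<le> n \<Longrightarrow> \<exists>s. triple x (p + int j) = triple y s"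
    and start: "x (p+1) = y k" "x (p+2) = y (k+1)"
  shows "\<exists>q. \<forall>j<n. x (p + int j) = y (q + int j)"
proof -
  have ne: "x (p + i) \<noteq> x (p + j)" if "i \<noteq> j" "\<bar>i - j\<bar> < int n" for i j
    using cyclic_seq_neq[OF x, of "p+i" "p+j"] that by simp
  have ne0: "x p \<noteq> x (p + j)" if "0 \<noteq> j" "\<bar>j\<bar> < int n" for j
    using cyclic_seq_neq[OF x, of p "p+j"] that by simp
  obtain s0 s1 s2 where s: "triple x p = triple y s0" "triple x (p+1) = triple y s1" "triple x (p+2) = triple y s2"
    using T[of 0] T[of 1] T[of 2] n by auto
  have "x (p+1) \<in> triple x (p+1)" "x (p+1) \<notin> triple x (p+2)"
    using ne[of 1 2] ne[of 1 3] ne[of 1 4] n by (auto simp: triple_def add.assoc)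
  then have d: "triple y s1 \<noteq> triple y s2" using s by auto
  have x3: "x (p+3) \<noteq> x (p+1)" "x (p+3) \<noteq> x (p+2)" using ne[of 3 1] ne[of 3 2] n by auto
  have x0: "x p \<noteq> x (p+1)" "x p \<noteq> x (p+2)" "x p \<noteq> x (p+3)" using ne0[of 1] ne0[of 2] ne0[of 3] n by auto
  have "x (p+3) = y (k+2) \<or> x (p+3) = y (k-1)"
    by (rule triple_extend[OF y n, of _ _ s1]) (use s(2) start x3 in \<open>auto simp: triple_def add.assoc\<close>)
  \<comment> \<open>The terms \<open>x (p+2)\<close> and \<open>x (p+3)\<close> lie in two different
    triples, hence are neighbours in \<open>y\<close>, whereas \<open>y (k+1)\<close> and
    \<open>y (k-1)\<close> are two steps apart.\<close>
  moreover have "x (p+3) \<noteq> y (k-1)"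
  proof
    assume *: "x (p+3) = y (k-1)"
    have "\<exists>m. x (p+2) = y m \<and> x (p+3) = y (m+1) \<or> x (p+2) = y (m+1) \<and> x (p+3) = y m"
      by (rule triple_common_pair[OF y n d]) (use x3 in \<open>unfold s[symmetric], auto simp: triple_def add.assoc\<close>)
    then obtain m where "y (k+1) = y m \<and> y (k-1) = y (m+1) \<or> y (k+1) = y (m+1) \<and> y (k-1) = y m"
      using start(2) * by auto
    then show False
      using cyclic_seq_diff[OF y, of "k+1" m 0 "-2" 1] cyclic_seq_diff[OF y, of "k+1" m 1 "-2" 0] n by auto
  qed
  ultimately have 3: "x (p+3) = y (k+2)" by blast
  have "x p = y (k+2) \<or> x p = y (k-1)"
    by (rule triple_extend[OF y n, of _ _ s0]) (use s(1) start x0 in \<open>auto simp: triple_def\<close>)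
  then have 0: "x p = y (k-1)" using 3 x0(3) by auto
  have "x (p + int j) = y (k - 1 + int j)" if "j < n" for j
    using that
  proof (induction j rule: less_induct)
    case (less j)
    consider "j = 0" | "j = 1" | "j = 2" | "3 \<le> j" by linarith
    then show ?case
    proof cases
      case 4
      define i where "i = j - 3"
      have i: "j = i + 3" using 4 by (simp add: i_def)
      have IH: "x (p + int i) = y (k - 1 + int i)" "x (p + int i + 1) = y (k + int i)" "x (p + int i + 2) = y (k + int i + 1)"
        using less.IH[of i] less.IH[of "i+1"] less.IH[of "i+2"] less.prems i by (simp_all add: algebra_simps)
      obtain s' where s': "triple x (p + int (i+1)) = triple y s'" using T[of "i+1"] less.prems i by auto
      have "x (p + int i + 3) = y (k + int i + 2) \<or> x (p + int i + 3) = y (k + int i - 1)"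
      proof (rule triple_extend[OF y n, of _ _ s'])
        show "{y (k + int i), y (k + int i + 1), x (p + int i + 3)} = triple y s'"
          unfolding s'[symmetric] IH(2,3)[symmetric] by (simp add: triple_def add_ac)
        show "x (p + int i + 3) \<noteq> y (k + int i)" "x (p + int i + 3) \<noteq> y (k + int i + 1)"
          using ne[of "int i + 3" "int i + 1"] ne[of "int i + 3" "int i + 2"] n
          unfolding IH(2,3)[symmetric] by (simp_all add: add_ac)
      qed
      moreover have "x (p + int i + 3) \<noteq> y (k + int i - 1)"
        using ne[of "int i + 3" "int i"] n IH(1) by (simp add: algebra_simps)
      ultimately show ?thesis using i by (simp add: algebra_simps)
    qed (use 0 start in \<open>auto simp: algebra_simps\<close>)
  qed
  then show ?thesis by blast
qed

lemma cyclic_seq_uminus: "cyclic_seq n y \<Longrightarrow> cyclic_seq n (\<lambda>p. y (- p))"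
  unfolding cyclic_seq_def by (simp add: dvd_diff_commute)

lemma triple_uminus: "triple (\<lambda>p. y (- p)) s = triple y (- s - 2)"
  by (auto simp: triple_def algebra_simps)

lemma cyclic_seq_extend:
  assumes x: "cyclic_seq n x" and y: "cyclic_seq n y" and n: "0 < n" and xy: "\<forall>j<n. x (p + int j) = y (q + int j)"
  shows "x t = y (q - p + t)"
proof -
  define j where "j = nat ((t - p) mod int n)"
  have j: "j < n" "int j = (t - p) mod int n" using n by (auto simp: j_def nat_less_iff)
  have d: "int n dvd (t - p) - int j" unfolding j(2) by (simp add: minus_mod_eq_mult_div)
  have "x t = x (p + int j)" using d by (simp add: cyclic_seqD[OF x] algebra_simps)
  also have "\<dots> = y (q + int j)" using xy j(1) by blast
  also have "\<dots> = y (q - p + t)" using d dvd_diff_commute[of "int n" "t - p" "int j"]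
    by (simp add: cyclic_seqD[OF y] algebra_simps)
  finally show ?thesis .
qed

text \<open>The first two triples of \<open>x\<close> share \<open>x (p+1)\<close> and
  \<open>x (p+2)\<close>, which are therefore neighbours in \<open>y\<close>. Their order there
  decides the direction; the backward case becomes the forward one by reflecting
  \<open>y\<close>.\<close>

lemma triple_chain:
  assumes x: "cyclic_seq n x" and y: "cyclic_seq n y" and n: "5 \<le> n"
    and T: "\<And>j. j + 3 \<le> n \<Longrightarrow> \<exists>s. triple x (p + int j) = triple y s"
  shows "\<exists>q. (\<forall>t. x t = y (q + t)) \<or> (\<forall>t. x t = y (q - t))"
proof -
  obtain s0 s1 where s: "triple x p = triple y s0" "triple x (p+1) = triple y s1"
    using T[of 0] T[of 1] n by auto
  have ne: "x p \<noteq> x (p + j)" if "0 \<noteq> j" "\<bar>j\<bar> < int n" for j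
    using cyclic_seq_neq[OF x, of p "p+j"] that by simp
  have "x p \<in> triple x p" "x p \<notin> triple x (p+1)"
    using ne[of 1] ne[of 2] ne[of 3] n by (auto simp: triple_def add.assoc)
  then have d: "triple y s0 \<noteq> triple y s1" using s by auto
  have "x (p+1) \<noteq> x (p+2)" using cyclic_seq_neq[OF x, of "p+1" "p+2"] n by simp
  then have "\<exists>k. x (p+1) = y k \<and> x (p+2) = y (k+1) \<or> x (p+1) = y (k+1) \<and> x (p+2) = y k"
    by (intro triple_common_pair[OF y n d]) (unfold s[symmetric], auto simp: triple_def add.assoc)
  then obtain k where "x (p+1) = y k \<and> x (p+2) = y (k+1) \<or> x (p+1) = y (k+1) \<and> x (p+2) = y k" by blast
  then show ?thesis
  proof (elim disjE conjE)
    assume "x (p+1) = y k" "x (p+2) = y (k+1)"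
    from triple_chain_forward[OF x y n T this] obtain q where "\<forall>j<n. x (p + int j) = y (q + int j)" by auto
    then have "x t = y (q - p + t)" for t using cyclic_seq_extend[OF x y] n by simp
    then show ?thesis by blast
  next
    assume k: "x (p+1) = y (k+1)" "x (p+2) = y k"
    define y' where "y' p = y (- p)" for p
    have y': "cyclic_seq n y'" using cyclic_seq_uminus[OF y] unfolding y'_def .
    have "\<exists>q. \<forall>j<n. x (p + int j) = y' (q + int j)"
    proof (rule triple_chain_forward[OF x y' n])
      show "x (p+1) = y' (- k - 1)" "x (p+2) = y' (- k - 1 + 1)" using k by (simp_all add: y'_def add.commute)
      fix j assume "j + 3 \<le> n"
      then obtain s where "triple x (p + int j) = triple y s" using T by blast
      also have "\<dots> = triple y' (- s - 2)" unfolding y'_def triple_uminus by simp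
      finally show "\<exists>s. triple x (p + int j) = triple y' s" by blast
    qed
    then obtain q where "\<forall>j<n. x (p + int j) = y' (q + int j)" by blast
    then have "x t = y' (q - p + t)" for t using cyclic_seq_extend[OF x y'] n by simp
    then have "x t = y (p - q - t)" for t by (simp add: y'_def)
    then show ?thesis by blast
  qed
qed

lemma cyclic_seq_cidx:
  assumes "bij_betw a {1..n} {1..n}" "0 < n" shows "cyclic_seq n (\<lambda>p. a (cidx n p))"
  unfolding cyclic_seq_def
  using inj_on_eq_iff[OF bij_betw_imp_inj_on[OF assms(1)] cidx_in[OF assms(2)] cidx_in[OF assms(2)]]
    cidx_eq_iff[OF assms(2)] by simp

lemma position_triangles_triple:
  assumes "4 \<le> n"
  shows "(`) a ` position_triangles n r a =
    {triple (\<lambda>p. a (cidx n p)) p | p. turn r a (cidx n p) (cidx n (p+2))}"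
proof -
  have "a ` {cidx n p, cidx n (p+1), cidx n (p+2)} = triple (\<lambda>p. a (cidx n p)) p" for p
    by (simp add: triple_def)
  then show ?thesis unfolding position_triangles_cidx[OF assms] by (simp only: image_Collect) blast
qed

text \<open>All failures start at \<open>x\<close> or \<open>x + 1\<close>, so the
  \<open>n - 2\<close> triples starting from \<open>x + 2\<close> onwards succeed.\<close>

lemma triple_run:
  assumes "cyc_shape n r a" "4 \<le> n"
  shows "\<exists>p. \<forall>j. j + 3 \<le> n \<longrightarrow> turn r a (cidx n (p + int j)) (cidx n (p + int j + 2))"
proof -
  obtain x where x: "\<And>p. turn r a (cidx n p) (cidx n (p+2)) \<or> int n dvd p - x \<or> int n dvd p - (x+1)"
    using failing_triples_adjacent[OF assms] by blast
  have "turn r a (cidx n (x + 2 + int j)) (cidx n (x + 2 + int j + 2))" if "j + 3 \<le> n" for j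
    using x[of "x + 2 + int j"] dvd_small[of n "2 + int j"] dvd_small[of n "1 + int j"] that
    by (auto simp: algebra_simps)
  then show ?thesis by blast
qed

lemma cyc_shape_descent:
  assumes "cyc_shape n r a" "1 \<le> i" "i < n"
  shows "a (i+1) < a i \<longleftrightarrow> i = r"
proof
  assume "a (i+1) < a i"
  then have "\<not> (i + 1 \<le> r \<or> r < i)" using cyc_shape_mono[OF assms(1), of i "i+1"] assms(2,3) by force
  then show "i = r" by simp
next
  assume "i = r"
  then show "a (i+1) < a i" using assms by (simp add: cyc_shape_def)
qed

text \<open>What remains after \<open>triple_chain\<close> is to exclude reflection. Fixing position
  1, it turns ascents of \<open>a\<close> among the other positions into descents of
  \<open>b\<close>, and \<open>b\<close> has only one descent.\<close>

lemma triangles_determine_cycle_5: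
  assumes A: "cyc_shape n r a" and B: "cyc_shape n s b" and n: "5 \<le> n"
    and eq: "(`) a ` position_triangles n r a = (`) b ` position_triangles n s b" and i: "i \<in> {1..n}"
  shows "a i = b i"
proof -
  define x y where "x p = a (cidx n p)" and "y p = b (cidx n p)" for p
  have bij: "bij_betw a {1..n} {1..n}" "bij_betw b {1..n} {1..n}" and 1: "a 1 = 1" "b 1 = 1"
    using A B by (auto simp: cyc_shape_def)
  have xy: "cyclic_seq n x" "cyclic_seq n y" using cyclic_seq_cidx bij n by (auto simp: x_def[abs_def] y_def[abs_def])
  have n4: "4 \<le> n" using n by simp
  obtain p where p: "\<And>j. j + 3 \<le> n \<Longrightarrow> turn r a (cidx n (p + int j)) (cidx n (p + int j + 2))"
    using triple_run[OF A n4] by blast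
  have T: "\<exists>s. triple x (p + int j) = triple y s" if "j + 3 \<le> n" for j
  proof -
    have "triple x (p + int j) \<in> (`) a ` position_triangles n r a"
      unfolding position_triangles_triple[OF n4] x_def using p[OF that] by blast
    then show ?thesis unfolding eq unfolding position_triangles_triple[OF n4] y_def by blast
  qed
  have zero: "x 0 = 1" "y 0 = 1" using 1 by (simp_all add: x_def y_def cidx_def)
  have xi: "x (int i - 1) = a i" "y (int i - 1) = b i" if "i \<in> {1..n}" for i
    using cidx_int[of "i-1" n] that by (auto simp: x_def y_def of_nat_diff)
  obtain q where "(\<forall>t. x t = y (q + t)) \<or> (\<forall>t. x t = y (q - t))" using triple_chain[OF xy n T] by blast
  then show ?thesis
  proof
    assume *: "\<forall>t. x t = y (q + t)"
    have "y q = y 0" using *[rule_format, of 0] zero by simp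
    then have "y (q + (int i - 1)) = y (0 + (int i - 1))" by (rule cyclic_seq_shift[OF xy(2)])
    then show ?thesis using * xi[OF i] by simp
  next
    assume *: "\<forall>t. x t = y (q - t)"
    have "y q = y 0" using *[rule_format, of 0] zero by simp
    then have q: "int n dvd q" by (simp add: cyclic_seqD[OF xy(2)])
    have rev: "a i = b (n + 2 - i)" if "2 \<le> i" "i \<le> n" for i
    proof -
      have "a i = y (q - (int i - 1))" using *[rule_format, of "int i - 1"] xi(1)[of i] that by simp
      also have "\<dots> = y (int (n + 2 - i) - 1)"
        using q that by (simp add: cyclic_seqD[OF xy(2)] of_nat_diff)
      also have "\<dots> = b (n + 2 - i)" using that by (intro xi(2)) auto
      finally show ?thesis .
    qed
    have "n + 1 - i = s" if "2 \<le> i" "i < n" "i \<noteq> r" for i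
    proof -
      have "a i \<noteq> a (i+1)" using bij_betw_neq[OF bij(1), of i "i+1"] that by auto
      then have "a i < a (i+1)" using cyc_shape_descent[OF A, of i] that by auto
      moreover have "n + 2 - i = n + 1 - i + 1" "n + 2 - (i + 1) = n + 1 - i" using that by auto
      ultimately have "b (n + 1 - i + 1) < b (n + 1 - i)"
        using rev[of i] rev[of "i+1"] that by simp
      then show ?thesis using cyc_shape_descent[OF B, of "n + 1 - i"] that by auto
    qed
    \<comment> \<open>At least two of 2, 3 and 4 differ from \<open>r\<close>, and they would give
      \<open>s\<close> two values.\<close>
    from this[of 2] this[of 3] this[of 4] n show ?thesis by linarith
  qed
qed

text \<open>For \<open>n = 4\<close> the triples at positions 1, 2, 3 and 3, 4, 1 share the opposite
  positions 1 and 3, so \<open>triple_common_pair\<close> fails. This table of all four cycles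
  replaces it.\<close>

lemma cyc_shape_4:
  assumes "cyc_shape 4 r a"
  obtains "r = 2" "a 2 = 3" "a 3 = 2" "a 4 = 4" "(`) a ` position_triangles 4 r a = {{1,2,4},{1,3,4}}"
  | "r = 2" "a 2 = 4" "a 3 = 2" "a 4 = 3" "(`) a ` position_triangles 4 r a = {{1,2,3},{2,3,4}}"
  | "r = 3" "a 2 = 2" "a 3 = 4" "a 4 = 3" "(`) a ` position_triangles 4 r a = {{1,2,3},{1,2,4}}"
  | "r = 3" "a 2 = 3" "a 3 = 4" "a 4 = 2" "(`) a ` position_triangles 4 r a = {{1,3,4},{2,3,4}}"
proof -
  have bij: "bij_betw a {1..4} {1..4}" and a1: "a 1 = 1" and r: "r = 2 \<or> r = 3" using assms by (auto simp: cyc_shape_def)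
  have ne: "a 2 \<noteq> 1" "a 3 \<noteq> 1" "a 4 \<noteq> 1" "a 2 \<noteq> a 3" "a 2 \<noteq> a 4" "a 3 \<noteq> a 4"
    using bij_betw_neq[OF bij, of 2 1] bij_betw_neq[OF bij, of 3 1] bij_betw_neq[OF bij, of 4 1]
     bij_betw_neq[OF bij, of 2 3] bij_betw_neq[OF bij, of 2 4] bij_betw_neq[OF bij, of 3 4] a1 by auto
  have b: "1 \<le> a 2" "a 2 \<le> 4" "1 \<le> a 3" "a 3 \<le> 4" "1 \<le> a 4" "a 4 \<le> 4"
    using bspec[OF bij_betwE[OF bij], of 2] bspec[OF bij_betwE[OF bij], of 3] bspec[OF bij_betwE[OF bij], of 4] by auto
  have d: "a 3 < a 2 \<longleftrightarrow> r = 2" "a 4 < a 3 \<longleftrightarrow> r = 3"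
    using cyc_shape_descent[OF assms, of 2] cyc_shape_descent[OF assms, of 3] by auto
  note P = image_position_triangles[OF assms order_refl]
  have one: "{{a j, a (j+1), a (j+2)} | j. 1 \<le> j \<and> j + 2 \<le> r \<or> r + 1 \<le> j \<and> j + 2 \<le> 4} =
    (if r = 3 then {{a 1, a 2, a 3}} else {})"
    using r by (auto simp: numeral_eq_Suc One_nat_def le_Suc_eq)
  from r show ?thesis
  proof
    assume r2: "r = 2"
    then have "a 3 < a 2" "a 3 < a 4" "2 \<le> a 3" using d b ne by auto
    then have "a 3 = 2" "a 2 = 3 \<and> a 4 = 4 \<or> a 2 = 4 \<and> a 4 = 3" using b ne(5) by auto
    then show ?thesis using that(1,2) r2 a1 unfolding P one by (auto simp: insert_commute One_nat_def)
  next
    assume r3: "r = 3"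
    then have "a 2 < a 3" "a 4 < a 3" "2 \<le> a 2" "2 \<le> a 4" using d b ne by auto
    then have "a 3 = 4" "a 2 = 2 \<and> a 4 = 3 \<or> a 2 = 3 \<and> a 4 = 2" using b ne(5) by auto
    then show ?thesis using that(3,4) r3 a1 unfolding P one by (auto simp: insert_commute One_nat_def)
  qed
qed

lemma triangles_determine_cycle:
  assumes A: "cyc_shape n r a" and B: "cyc_shape n s b" and n: "4 \<le> n"
    and eq: "(`) a ` position_triangles n r a = (`) b ` position_triangles n s b" and i: "i \<in> {1..n}"
  shows "a i = b i"
proof (cases "n = 4")
  case False
  then show ?thesis using triangles_determine_cycle_5[OF A B _ eq i] n by simp
next
  case True
  \<comment> \<open>The element sums tell the four possible sets of triangles apart.\<close>
  have S: "sum id ` (`) a ` position_triangles 4 r a = sum id ` (`) b ` position_triangles 4 s b"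
    using eq True by simp
  have "a 1 = b 1" using A B by (simp add: cyc_shape_def)
  moreover have "a 2 = b 2 \<and> a 3 = b 3 \<and> a 4 = b 4"
    by (rule cyc_shape_4[OF A[unfolded True]]; rule cyc_shape_4[OF B[unfolded True]])
      (use S in \<open>simp_all add: doubleton_eq_iff\<close>)
  moreover have "i = 1 \<or> i = 2 \<or> i = 3 \<or> i = 4" using i True by auto
  ultimately show ?thesis by auto
qed

section \<open>Corner adjacency of the triangles\<close>

lemma card_quotient_le_1:
  assumes "r \<subseteq> A \<times> A" "\<And>x y. x \<in> A \<Longrightarrow> y \<in> A \<Longrightarrow> (x, y) \<in> r" shows "card (A // r) \<le> 1"
proof -
  have "A // r \<subseteq> {A}" using assms by (auto simp: quotient_def)
  then show ?thesis using card_mono[of "{A}" "A // r"] by simp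
qed

text \<open>Triples with successive starts share two sides and, as \<open>n \<ge> 4\<close>, not a
  third, so they are corner adjacent. The run of \<open>n - 2\<close> triangles from
  \<open>triple_run\<close> is therefore a path.\<close>

lemma (in cyclic_family) card_triangle_classes: "card (triangles n L // triangle_equivalence n L) \<le> 1"
proof (rule card_quotient_le_1)
  let ?G = "{(S, T). S \<in> triangles n L \<and> T \<in> triangles n L \<and> corner_adjacent S T}"
  show "triangle_equivalence n L \<subseteq> triangles n L \<times> triangles n L"
    by (auto simp: triangle_equivalence_def)
  define x where "x p = a (cidx n p)" for p
  have x: "cyclic_seq n x" using cyclic_seq_cidx[OF bij] n4 unfolding x_def by simp
  have tri: "triangles n L = {triple x p | p. turn r a (cidx n p) (cidx n (p+2))}"
    unfolding triangles_eq position_triangles_triple[OF n4] x_def by simp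
  have adj: "corner_adjacent (triple x p) (triple x (p+1))" for p
  proof -
    have ne: "x p \<noteq> x (p+1)" "x p \<noteq> x (p+2)" "x p \<noteq> x (p+3)" "x (p+1) \<noteq> x (p+2)"
      using n4 cyclic_seq_neq[OF x, of p "p+1"] cyclic_seq_neq[OF x, of p "p+2"]
        cyclic_seq_neq[OF x, of p "p+3"] cyclic_seq_neq[OF x, of "p+1" "p+2"] by auto
    then have "triple x p \<inter> triple x (p+1) = {x (p+1), x (p+2)}" by (auto simp: triple_def add.assoc)
    then show ?thesis using ne(4) by (simp add: corner_adjacent_def)
  qed
  have sym: "sym (?G\<^sup>*)" by (intro sym_rtrancl symI) (auto simp: corner_adjacent_def Int_commute)
  obtain p where p: "\<And>j. j + 3 \<le> n \<Longrightarrow> turn r a (cidx n (p + int j)) (cidx n (p + int j + 2))"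
    using triple_run[OF shape n4] by blast
  have inT: "triple x (p + int j) \<in> triangles n L" if "j + 3 \<le> n" for j
    unfolding tri using p[OF that] by blast
  have chain: "(triple x p, triple x (p + int j)) \<in> ?G\<^sup>*" if "j + 3 \<le> n" for j
    using that
  proof (induction j)
    case (Suc j)
    have "(triple x (p + int j), triple x (p + int (Suc j))) \<in> ?G"
      using inT[of j] inT[of "Suc j"] Suc.prems adj[of "p + int j"] by (simp add: add_ac)
    moreover have "(triple x p, triple x (p + int j)) \<in> ?G\<^sup>*" using Suc by simp
    ultimately show ?case by (rule rtrancl_into_rtrancl[rotated])
  qed simp
  have all: "(triple x p, S) \<in> ?G\<^sup>*" if S: "S \<in> triangles n L" for S
  proof -
    obtain q where q: "S = triple x q" using S tri by blast
    define j where "j = nat ((q - p) mod int n)"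
    have j: "j < n" "int j = (q - p) mod int n" using n4 by (auto simp: j_def nat_less_iff)
    have d: "int n dvd (q - p) - int j" unfolding j(2) by (simp add: minus_mod_eq_mult_div)
    have "x (q + t) = x (p + int j + t)" for t
      using d by (simp add: cyclic_seqD[OF x] algebra_simps)
    from this[of 0] this[of 1] this[of 2] have Sj: "S = triple x (p + int j)" by (simp add: q triple_def)
    \<comment> \<open>Outside the run there are two positions left: the one just after its last
      triple and the one just before its first. Whichever of them is a triangle is adjacent to an
      end of the path.\<close>
    consider "j + 3 \<le> n" | "j = n - 3 + 1" | "j = n - 1" using j(1) n4 by linarith
    then show ?thesis
    proof cases
      case 2
      have "p + int j = p + int (n-3) + 1" using 2 by simp
      then have "S = triple x (p + int (n-3) + 1)" using Sj by (simp only:)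
      then have "corner_adjacent (triple x (p + int (n-3))) S" using adj[of "p + int (n-3)"] by (simp only:)
      moreover have "triple x (p + int (n-3)) \<in> triangles n L" by (rule inT) (use n4 in simp)
      ultimately have "(triple x (p + int (n-3)), S) \<in> ?G" using S by blast
      moreover have "(triple x p, triple x (p + int (n-3))) \<in> ?G\<^sup>*" using chain[of "n-3"] n4 by simp
      ultimately show ?thesis by (rule rtrancl_into_rtrancl[rotated])
    next
      case 3
      have "x (p + int j + 1 + t) = x (p + t)" for t using 3 n4 by (simp add: cyclic_seqD[OF x] of_nat_diff)
      from this[of 0] this[of 1] this[of 2] have "triple x (p + int j + 1) = triple x p" by (simp add: triple_def)
      then have "(S, triple x p) \<in> ?G"
        using inT[of 0] n4 S adj[of "p + int j"] by (simp add: Sj)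
      then show ?thesis using sym by (meson r_into_rtrancl symD)
    qed (use chain Sj in simp)
  qed
  fix S T assume ST: "S \<in> triangles n L" "T \<in> triangles n L"
  then have "(S, T) \<in> ?G\<^sup>*" using all sym by (meson rtrancl_trans symD)
  then show "(S, T) \<in> triangle_equivalence n L" using ST by (simp add: triangle_equivalence_def)
qed

section \<open>Realisation by tangents of a circle\<close>

context ngon
begin

lemma pred: assumes "k \<in> {1..n}" obtains p where "p \<in> {1..n}" "S p = k"
proof (cases "k = 1")
  case True
  then show ?thesis using that[of n] n3 S_n by simp
next
  case False
  then have "1 \<le> k - 1" "k - 1 < n" "k - 1 + 1 = k" using assms by auto
  then show ?thesis using that[of "k-1"] S_less[of "k-1"] by simp
qed

lemma hull_subset_cell:
  "interior (convex hull (v ` {1..n})) \<subseteq> {x. \<forall>j\<in>{1..n}. F j x > 0}"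
proof safe
  fix x j assume x: "x \<in> interior (convex hull (v ` {1..n}))" and j: "j \<in> {1..n}"
  let ?a = "vector [- (E j$2), E j$1] :: real^2"
  have a: "?a \<noteq> 0" using E_nz[OF j] by (auto simp: vec_eq_iff forall_2)
  have "convex hull (v ` {1..n}) \<subseteq> {x. ?a \<bullet> x \<ge> H j}"
    using F_nonneg[OF j] by (intro hull_minimal convex_halfspace_ge) (auto simp: F_def det2_eq_inner)
  then have "interior (convex hull (v ` {1..n})) \<subseteq> {x. ?a \<bullet> x > H j}"
    using interior_mono interior_halfspace_ge[OF a] by metis
  then show "F j x > 0" using x by (auto simp: F_def det2_eq_inner)
qed

text \<open>A functional \<open>u\<close> separating \<open>x\<close> from the hull is minimal among
  the vertices at some \<open>v k\<close>. The cell lies in the cone at \<open>v k\<close> spanned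
  by \<open>E k\<close> and the reverse of the preceding edge, along both of which \<open>u\<close>
  does not decrease, so \<open>u\<close> cannot be smaller at \<open>x\<close>.\<close>

lemma cell_subset_hull: "{x. \<forall>j\<in>{1..n}. F j x > 0} \<subseteq> convex hull (v ` {1..n})"
proof (rule ccontr)
  assume "\<not> {x. \<forall>j\<in>{1..n}. F j x > 0} \<subseteq> convex hull (v ` {1..n})"
  then obtain x where x: "\<And>j. j \<in> {1..n} \<Longrightarrow> F j x > 0" and "x \<notin> convex hull (v ` {1..n})" by blast
  moreover have "closed (convex hull (v ` {1..n}))"
    by (intro compact_imp_closed finite_imp_compact_convex_hull) simp
  ultimately obtain u b where u: "u \<bullet> x < b" "\<And>y. y \<in> convex hull (v ` {1..n}) \<Longrightarrow> u \<bullet> y > b"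
    using separating_hyperplane_closed_point[OF convex_convex_hull] by metis
  obtain k where k: "k \<in> {1..n}" "\<And>j. j \<in> {1..n} \<Longrightarrow> u \<bullet> v k \<le> u \<bullet> v j"
  proof -
    have "finite {1..n}" "{1..n} \<noteq> {}" using n3 by auto
    then obtain k where "is_arg_min (\<lambda>j. u \<bullet> v j) (\<lambda>j. j \<in> {1..n}) k"
      using ex_is_arg_min_if_finite by metis
    then show ?thesis using that unfolding is_arg_min_linorder by blast
  qed
  obtain p where p: "p \<in> {1..n}" "S p = k" using pred[OF k(1)] .
  define w where "w = x - v k"
  have "D p k *\<^sub>R w = det2 (E p) w *\<^sub>R E k - det2 (E k) w *\<^sub>R E p" unfolding D_def by (rule det2_expand)
  then have "D p k * (u \<bullet> w) = det2 (E p) w * (u \<bullet> E k) - det2 (E k) w * (u \<bullet> E p)"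
    by (metis inner_diff_right inner_scaleR_right)
  moreover have "det2 (E p) w = F p x - F p (v (S p))" "det2 (E k) w = F k x - F k (v k)"
    by (simp_all add: w_def F_def p)
  moreover have "u \<bullet> E k \<ge> 0" "u \<bullet> E p \<le> 0"
    using k(2)[OF S_in] k(2)[OF p(1)] by (simp_all add: E_def p inner_diff_right)
  moreover have "F k x * (u \<bullet> E p) \<le> 0" "F p x * (u \<bullet> E k) \<ge> 0"
    using x[OF p(1)] x[OF k(1)] calculation by (auto intro: mult_nonneg_nonpos mult_nonneg_nonneg)
  ultimately have "D p k * (u \<bullet> w) \<ge> 0" using F_zero[of p] F_zero[of k] by simp
  then have "u \<bullet> w \<ge> 0" using D_S[OF p(1)] p(2) by (simp add: zero_le_mult_iff)
  moreover have "u \<bullet> v k > b" by (rule u(2)) (use k in \<open>auto intro: hull_inc\<close>)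
  ultimately show False using u(1) by (simp add: w_def inner_diff_right)
qed

lemma hull_eq_cell: "interior (convex hull (v ` {1..n})) = {x. \<forall>j\<in>{1..n}. F j x > 0}"
proof
  have "open (\<Inter>j\<in>{1..n}. {x. vector [- (E j$2), E j$1] \<bullet> x > H j})"
    by (intro open_INT ballI open_halfspace_gt) simp
  also have "(\<Inter>j\<in>{1..n}. {x. vector [- (E j$2), E j$1] \<bullet> x > H j}) = {x. \<forall>j\<in>{1..n}. F j x > 0}"
    by (auto simp: F_def det2_eq_inner)
  finally show "{x. \<forall>j\<in>{1..n}. F j x > 0} \<subseteq> interior (convex hull (v ` {1..n}))"
    by (intro interior_maximal cell_subset_hull)
qed (rule hull_subset_cell)

text \<open>Supplies the region clause of \<open>ngon_sides\<close> for a polygon given by its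
  vertices and side lines, as in \<open>ngon_realization\<close>.\<close>

lemma hull_region: "interior (convex hull (v ` {1..n})) \<in> regions (L ` {1..n})"
proof -
  define x where "x = (1/3) *\<^sub>R v 1 + (1/3) *\<^sub>R v 2 + (1/3) *\<^sub>R v 3"
  have x: "F j x > 0" if j: "j \<in> {1..n}" for j
  proof -
    have I: "1 \<in> {1..n}" "2 \<in> {1..n}" "3 \<in> {1..n}" using n3 by auto
    have "F j x = (1/3) * F j (v 1) + (1/3) * F j (v 2) + (1/3) * F j (v 3)"
      unfolding x_def by (rule F_affine) simp
    \<comment> \<open>A side contains only two vertices, so at least one of the three lies strictly
      to its left.\<close>
    moreover have "1 \<noteq> j \<and> 1 \<noteq> S j \<or> 2 \<noteq> j \<and> 2 \<noteq> S j \<or> 3 \<noteq> j \<and> 3 \<noteq> S j" by force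
    ultimately show ?thesis
      using F_nonneg[OF j I(1)] F_nonneg[OF j I(2)] F_nonneg[OF j I(3)]
        F_pos[OF j I(1)] F_pos[OF j I(2)] F_pos[OF j I(3)] by linarith
  qed
  have "interior (convex hull (v ` {1..n})) = {y. \<forall>m\<in>{1..n}. F m x * F m y > 0}"
    unfolding hull_eq_cell using x by (auto simp: zero_less_mult_pos_iff mult.commute[of "F _ x"])
  moreover have "(L \<circ> a) ` {1..n} = L ` {1..n}"
    using bij_betw_imp_surj_on[OF bij] by (metis image_comp)
  moreover have "\<forall>m\<in>{1..n}. F m x \<noteq> 0" using x by fastforce
  ultimately show ?thesis using regions_iff[of "interior (convex hull (v ` {1..n}))"] by auto
qed

lemma ngon_sides: "ngon_sides n L a"
  unfolding ngon_sides_def using bij conv sides hull_region by blast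

end

lemma (in line_family) numbered_arrangement:
  assumes "2 \<le> n" shows "numbered_arrangement n l"
proof -
  have e: "e k \<noteq> 0" if "k \<in> {1..n}" for k
  proof -
    obtain j where "j \<in> {1..n}" "j \<noteq> k" using assms by (cases "k = 1") (auto intro: that[of 1] that[of 2])
    then show ?thesis using cross[of k j] that by auto
  qed
  have ne: "\<exists>x. x \<in> l i \<and> x + e i \<in> l i" if i: "i \<in> {1..n}" for i
  proof -
    obtain j where j: "j \<in> {1..n}" "j \<noteq> i" using assms by (cases "i = 1") (auto intro: that[of 1] that[of 2])
    then have "P i j \<in> l i" using inter_lines[OF i j(1)] by blast
    then show ?thesis using i by (intro exI[of _ "P i j"]) (simp add: line)
  qed
  have par: "i = j" if ij: "i \<in> {1..n}" "j \<in> {1..n}" and t: "l j = (\<lambda>x. t + x) ` l i" for i j t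
  proof (rule ccontr)
    assume ij': "i \<noteq> j"
    obtain x where "x \<in> l i" "x + e i \<in> l i" using ne[OF ij(1)] by blast
    then have "t + x \<in> l j" "t + (x + e i) \<in> l j" using t by blast+
    then have "det2 (e j) (e i) = 0" using ij by (simp add: line)
    then show False using cross[OF ij(2,1)] ij' by simp
  qed
  have inj: "inj_on l {1..n}"
  proof (rule inj_onI)
    fix i j assume ij: "i \<in> {1..n}" "j \<in> {1..n}" "l i = l j"
    have "l j = (\<lambda>x. 0 + x) ` l i" using ij(3) by simp
    then show "i = j" by (rule par[OF ij(1,2)])
  qed
  have isl: "is_line (l k)" if k: "k \<in> {1..n}" for k
  proof -
    let ?a = "vector [- (e k$2), e k$1] :: real^2"
    have "?a \<noteq> 0" using e[OF k] by (auto simp: vec_eq_iff forall_2)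
    moreover have "l k = {x. ?a \<bullet> x = h k}" using line[OF k] by (simp add: det2_eq_inner)
    ultimately show ?thesis unfolding is_line_def by (simp add: affine_hyperplane aff_dim_hyperplane)
  qed
  show ?thesis unfolding numbered_arrangement_def line_arrangement_def
  proof (intro conjI ballI impI inj)
    show "finite (l ` {1..n})" by simp
    fix m assume "m \<in> l ` {1..n}"
    then obtain i where i: "i \<in> {1..n}" "m = l i" by blast
    then show "is_line m" using isl by simp
    fix m' assume "m' \<in> l ` {1..n}"
    then obtain j where j: "j \<in> {1..n}" "m' = l j" by blast
    show "\<not> affine_parallel m m'" if "m \<noteq> m'"
      using par[OF i(1) j(1)] that unfolding i(2) j(2) affine_parallel_def by metis
    fix m'' assume "m'' \<in> l ` {1..n}"
    then obtain k where k: "k \<in> {1..n}" "m'' = l k" by blast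
    show "m \<inter> m' \<inter> m'' = {}" if "m \<noteq> m' \<and> m \<noteq> m'' \<and> m' \<noteq> m''"
    proof -
      have ijk: "i \<noteq> j" "i \<noteq> k" "j \<noteq> k" using that i j k by auto
      have "x \<notin> l i \<inter> l j \<inter> l k" for x
        using Del_nz[OF i(1) j(1) k(1) ijk] Del_eq[of i j k x] on_line[OF i(1)] on_line[OF j(1)] on_line[OF k(1)] by auto
      then show ?thesis using i j k by blast
    qed
  qed
qed

text \<open>Twice the area of the triangle with vertices at the angles \<open>x\<close>,
  \<open>y\<close>, \<open>z\<close> on the unit circle. Half-angles factor it as
  \<open>4 * sin p * sin q * sin (p + q)\<close>.\<close>

lemma sin_sum_pos:
  fixes x y z :: real
  assumes "x < y" "y < z" "z < x + 2 * pi"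
  shows "0 < sin (y - x) + sin (z - y) + sin (x - z)"
proof -
  define p q where "p = (y - x) / 2" and "q = (z - y) / 2"
  have pq: "0 < p" "0 < q" "p + q = (z - x) / 2" by (use assms in \<open>auto simp: p_def q_def field_simps\<close>)
  then have pq3: "p + q < pi" using assms by simp
  have e: "y - x = 2 * p" "z - y = 2 * q" "x - z = - (2 * (p + q))" by (auto simp: p_def q_def field_simps)
  have sc: "sin p * sin p = 1 - cos p * cos p" "sin q * sin q = 1 - cos q * cos q"
    using sin_cos_squared_add[of p] sin_cos_squared_add[of q] by (simp_all add: power2_eq_square)
  have "sin (y - x) + sin (z - y) + sin (x - z) = 2 * sin p * cos p + 2 * sin q * cos q - 2 * sin (p + q) * cos (p + q)"
    unfolding e sin_minus sin_double by simp
  also have "\<dots> = 2 * sin p * cos p * (1 - (cos q * cos q - sin q * sin q)) + 2 * sin q * cos q * (1 - (cos p * cos p - sin p * sin p))"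
    by (simp add: sin_add cos_add algebra_simps)
  also have "1 - (cos q * cos q - sin q * sin q) = 2 * (sin q * sin q)" using sc(2) by simp
  also have "1 - (cos p * cos p - sin p * sin p) = 2 * (sin p * sin p)" using sc(1) by simp
  also have "2 * sin p * cos p * (2 * (sin q * sin q)) + 2 * sin q * cos q * (2 * (sin p * sin p)) = 4 * sin p * sin q * sin (p + q)"
    by (simp add: sin_add algebra_simps)
  finally show ?thesis using pq(1,2) pq3 sin_gt_zero[of p] sin_gt_zero[of q] sin_gt_zero[of "p+q"] by simp
qed

lemma dir_add_pi: "dir (t + pi) = - dir t"
  by (simp add: dir_def vec_eq_iff forall_2)

text \<open>Take the tangents of the unit circle, directed anticlockwise around it. That
  \<open>a\<close> consists of two runs with a descent between them is what makes the directions
  increase around the circle and successive sides turn left.\<close>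

lemma ngon_realization:
  assumes shape: "cyc_shape n r a" and n: "4 \<le> n"
  shows "\<exists>L \<theta>. numbered_arrangement n L \<and> increasing_angles n L \<theta> \<and> ngon_sides n L a"
proof -
  have r: "2 \<le> r" "r + 1 \<le> n" and a1: "a 1 = 1" and bij: "bij_betw a {1..n} {1..n}" and desc: "a (r+1) < a r"
    using shape by (auto simp: cyc_shape_def)
  have aI: "a k \<in> {1..n}" if "k \<in> {1..n}" for k using bij_betwE[OF bij] that by blast
  \<comment> \<open>Equally spaced angles; the denominator \<open>n + 1\<close> keeps the last one
    below \<open>pi\<close>.\<close>
  define \<theta> where "\<theta> j = pi * real j / real (n + 1)" for j
  have th: "0 < \<theta> j" "\<theta> j < pi" if "j \<in> {1..n}" for j
  proof -
    have "pi * real j < pi * real (n + 1)" using that by (intro mult_strict_left_mono) auto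
    then show "0 < \<theta> j" "\<theta> j < pi" using that by (simp_all add: \<theta>_def pos_divide_less_eq)
  qed
  have th_less: "\<theta> i < \<theta> j \<longleftrightarrow> i < j" for i j
    by (simp add: \<theta>_def divide_less_cancel)
  define \<sigma> where "\<sigma> k = (if k \<le> r then 1 else - 1 :: real)" for k
  \<comment> \<open>Adding \<open>pi\<close> on the second run places it after the first, so that
    \<open>\<phi>\<close> increases along the whole polygon.\<close>
  define \<phi> where "\<phi> k = \<theta> (a k) + (if k \<le> r then 0 else pi)" for k
  define e where "e k = dir (\<phi> k)" for k
  have e\<sigma>: "e k = \<sigma> k *\<^sub>R dir (\<theta> (a k))" for k
    by (simp add: e_def \<phi>_def \<sigma>_def dir_add_pi)
  have \<phi>_mono: "\<phi> i < \<phi> j" if "1 \<le> i" "i < j" "j \<le> n" for i j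
  proof (cases "j \<le> r \<or> r < i")
    case True
    then have "a i < a j" using cyc_shape_mono[OF shape that(2,1,3)] by blast
    then show ?thesis using True that by (auto simp: \<phi>_def th_less)
  next
    case False
    then show ?thesis using th(2)[OF aI, of i] th(1)[OF aI, of j] that by (simp add: \<phi>_def)
  qed
  have \<phi>_bound: "0 < \<phi> i" "\<phi> i < 2 * pi" if "i \<in> {1..n}" for i
    using th[OF aI[OF that]] by (auto simp: \<phi>_def intro: add_pos_pos)
  define d where "d i j = det2 (e i) (e j)" for i j
  have d_sin: "d i j = sin (\<phi> j - \<phi> i)" for i j by (simp add: d_def e_def det2_dir)
  have d_swap: "d i j = - d j i" for i j unfolding d_def by (rule det2_swap)
  \<comment> \<open>This is \<open>Del\<close> when every \<open>h\<close> equals -1.\<close>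
  define s where "s i j k = d i j + d j k + d k i" for i j k
  have s_pos: "s i j k > 0" if "1 \<le> i" "i < j" "j < k" "k \<le> n" for i j k
    unfolding s_def d_sin using that \<phi>_bound[of i] \<phi>_bound[of k]
    by (intro sin_sum_pos \<phi>_mono) auto
  have s_rot: "s j k i = s i j k" "s k i j = s i j k" for i j k by (simp_all add: s_def)
  have s_nz: "s i j k \<noteq> 0"
    if ijk: "i \<in> {1..n}" "j \<in> {1..n}" "k \<in> {1..n}" "i \<noteq> j" "i \<noteq> k" "j \<noteq> k" for i j k
  proof -
    have b: "1 \<le> i" "i \<le> n" "1 \<le> j" "j \<le> n" "1 \<le> k" "k \<le> n" using ijk by auto
    have w: "s j k i = s i j k" "s k i j = s i j k" "s j i k = - s i j k" "s i k j = - s i j k" "s k j i = - s i j k"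
      by (simp_all add: s_def d_swap[of j i] d_swap[of i k] d_swap[of k j])
    consider "i < j" "j < k" | "i < k" "k < j" | "j < i" "i < k" | "j < k" "k < i" | "k < i" "i < j" | "k < j" "j < i"
      using ijk(4-6) by linarith
    then show ?thesis
    proof cases
      case 1 then show ?thesis using s_pos[of i j k] b by simp
    next
      case 2 then show ?thesis using s_pos[of i k j] b w by simp
    next
      case 3 then show ?thesis using s_pos[of j i k] b w by simp
    next
      case 4 then show ?thesis using s_pos[of j k i] b w by simp
    next
      case 5 then show ?thesis using s_pos[of k i j] b w by simp
    next
      case 6 then show ?thesis using s_pos[of k j i] b w by simp
    qed
  qed
  have d_pos: "d i j > 0 \<longleftrightarrow> turn r a i j" if ij: "i \<in> {1..n}" "j \<in> {1..n}" "i \<noteq> j" for i j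
  proof -
    have "sin (\<theta> (a j) - \<theta> (a i)) > 0 \<longleftrightarrow> a i < a j" "sin (\<theta> (a i) - \<theta> (a j)) > 0 \<longleftrightarrow> a j < a i"
      using sin_diff_pos_iff[OF th[OF aI[OF ij(1)]] th[OF aI[OF ij(2)]]]
        sin_diff_pos_iff[OF th[OF aI[OF ij(2)]] th[OF aI[OF ij(1)]]] by (simp_all add: th_less)
    moreover have "sin (\<theta> (a i) - \<theta> (a j)) = - sin (\<theta> (a j) - \<theta> (a i))" using sin_minus[of "\<theta> (a j) - \<theta> (a i)"] by simp
    moreover have "a i \<noteq> a j" using bij_betw_neq[OF bij ij] .
    ultimately show ?thesis by (auto simp: d_def e\<sigma> det2_dir \<sigma>_def turn_def)
  qed
  have d_nz: "d i j \<noteq> 0" if ij: "i \<in> {1..n}" "j \<in> {1..n}" "i \<noteq> j" for i j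
    using d_pos[OF ij] d_pos[OF ij(2,1) ij(3)[symmetric]] turn_swap[OF shape ij] d_swap[of i j] by auto
  define p where "p k = (if k = 1 then n else k - 1)" for k
  define S where "S k = Suc (k mod n)" for k
  have pI: "p k \<in> {1..n}" "p k \<noteq> k" "S (p k) = k" if "k \<in> {1..n}" for k
    using that n by (auto simp: p_def S_def)
  have SI: "S k \<in> {1..n}" "p (S k) = k" if k: "k \<in> {1..n}" for k
  proof -
    consider "k < n" | "k = n" using k by force
    then show "S k \<in> {1..n}" "p (S k) = k" using k n by (cases; auto simp: p_def S_def One_nat_def)+
  qed
  have d_S: "d k (S k) > 0" if k: "k \<in> {1..n}" for k
  proof -
    have "turn r a k (S k)"
    proof (cases "k = n")
      case True
      have "a n \<ge> 1" using aI[of n] n by auto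
      then show ?thesis using True r a1 by (auto simp: turn_def S_def One_nat_def)
    next
      case False
      then have S: "S k = k + 1" "k + 1 \<le> n" using k by (auto simp: S_def)
      show ?thesis
      proof (cases "k = r")
        case True
        then show ?thesis using desc S by (simp add: turn_def)
      next
        case False
        then have "k + 1 \<le> r \<or> r < k" by linarith
        then have "a k < a (k+1)" using cyc_shape_mono[OF shape, of k "k+1"] S k by simp
        then show ?thesis using False S(1) by (auto simp: turn_def)
      qed
    qed
    moreover have "k \<noteq> S k" using pI(2)[OF SI(1)[OF k]] SI(2)[OF k] by auto
    ultimately show ?thesis using d_pos[OF k SI(1)[OF k]] by simp
  qed
  have s_edge: "s j (p k) k > 0" if jk: "j \<in> {1..n}" "k \<in> {1..n}" "j \<noteq> k" "j \<noteq> p k" for j k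
  proof (cases "k = 1")
    case True
    then show ?thesis using s_pos[of 1 j n] jk n s_rot(1)[where i=1 and j=j and k=n] by (auto simp: p_def)
  next
    case False
    consider "j < k - 1" | "k < j" using jk False by (auto simp: p_def) linarith
    moreover have "1 \<le> k - 1" using jk False by auto
    ultimately show ?thesis
      using s_pos[of j "k-1" k] s_pos[of "k-1" k j] s_rot(2)[where i="k-1" and j=k and k=j] jk False by cases (auto simp: p_def)
  qed
  \<comment> \<open>The two right-hand sides compensate the orientation: in terms of
    \<open>e k\<close> every line has the value -1, so the circle lies on the left of each
    side.\<close>
  define L where "L j = {x. det2 (dir (\<theta> j)) x = (if j \<in> a ` {1..r} then - 1 else 1)}" for j
  have La: "L (a k) = {x. det2 (e k) x = - 1}" if k: "k \<in> {1..n}" for k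
  proof -
    have "a k \<in> a ` {1..r} \<longleftrightarrow> k \<le> r"
      using inj_on_image_mem_iff[OF bij_betw_imp_inj_on[OF bij] k, of "{1..r}"] r k by auto
    then show ?thesis by (auto simp: L_def e\<sigma> \<sigma>_def)
  qed
  have lf: "line_family n (L \<circ> a) e (\<lambda>_. - 1)"
  proof
    fix i j k assume ijk: "i \<in> {1..n}" "j \<in> {1..n}" "k \<in> {1..n}" "i \<noteq> j" "i \<noteq> k" "j \<noteq> k"
    show "- 1 * det2 (e j) (e k) + - 1 * det2 (e k) (e i) + - 1 * det2 (e i) (e j) \<noteq> 0"
      using s_nz[OF ijk] unfolding s_def d_def by simp
  qed (use La d_nz in \<open>auto simp: d_def\<close>)
  have num: "numbered_arrangement n L"
  proof -
    have "numbered_arrangement n (L \<circ> a)" using line_family.numbered_arrangement[OF lf] n by simp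
    then have "inj_on (L \<circ> a) {1..n}" "line_arrangement ((L \<circ> a) ` {1..n})" by (auto simp: numbered_arrangement_def)
    then show ?thesis unfolding numbered_arrangement_def
      using inj_on_imageI[of L a "{1..n}"] bij_betw_imp_surj_on[OF bij] by (metis image_comp)
  qed
  have ang: "increasing_angles n L \<theta>"
    unfolding increasing_angles_def
  proof (intro conjI ballI th strict_mono_onI)
    fix j assume j: "j \<in> {1..n}"
    define c where "c = (if j \<in> a ` {1..r} then - 1 else 1 :: real)"
    \<comment> \<open>The foot of the perpendicular from the origin, as a point on the line.\<close>
    define q :: "real^2" where "q = vector [- c * sin (\<theta> j), c * cos (\<theta> j)]"
    have "det2 (dir (\<theta> j)) q = c"
      by (simp add: det2_def dir_def q_def mult.left_commute flip: distrib_left)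
    then have "L j = {x. det2 (dir (\<theta> j)) x = det2 (dir (\<theta> j)) q}" by (simp add: L_def c_def)
    then have "L j = range (\<lambda>t. q + t *\<^sub>R dir (\<theta> j))" by (simp only: line_eq_level_set[OF dir_nz])
    then show "has_angle (L j) (\<theta> j)" unfolding has_angle_def dir_def by blast
  qed (auto simp: th_less)
  \<comment> \<open>The formula for \<open>P (p k) k\<close> with both values of \<open>h\<close>
    equal to -1.\<close>
  define v where "v k = (1 / d (p k) k) *\<^sub>R (e (p k) - e k)" for k
  have dp: "d (p k) k > 0" if "k \<in> {1..n}" for k using d_S[OF pI(1)[OF that]] pI(3)[OF that] by simp
  have f: "det2 (e j) (v k) + 1 = s j (p k) k / d (p k) k" if "k \<in> {1..n}" for j k
  proof -
    have "det2 (e j) (v k) = (d j (p k) - d j k) / d (p k) k" by (simp add: v_def d_def)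
    then show ?thesis using dp[OF that] by (simp add: s_def d_swap[of k j] field_simps)
  qed
  have f_pos: "det2 (e j) (v k) > - 1" if "j \<in> {1..n}" "k \<in> {1..n}" "j \<noteq> k" "j \<noteq> p k" for j k
  proof -
    have "det2 (e j) (v k) + 1 > 0" unfolding f[OF that(2)] using s_edge[OF that] dp[OF that(2)] by simp
    then show ?thesis by simp
  qed
  have d0: "d k k = 0" for k by (simp add: d_def)
  have f_zero: "det2 (e k) (v k) = - 1" "det2 (e (p k)) (v k) = - 1" if "k \<in> {1..n}" for k
    using f[OF that, of k] f[OF that, of "p k"] by (auto simp: s_def d0 d_swap[of k "p k"])
  have conv: "anticlockwise_convex_ngon n v"
    unfolding anticlockwise_convex_ngon_def
  proof (intro conjI ballI)
    show "3 \<le> n" using n by simp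
    fix j k assume j: "j \<in> {1..n}" and "k \<in> {1..n} - {j, Suc (j mod n)}"
    then have k: "k \<in> {1..n}" "k \<noteq> j" "k \<noteq> S j" by (auto simp: S_def)
    note Sj = SI[OF j]
    have "det2 (e j) (v (S j) - v j) = 0" using f_zero[OF j] f_zero[OF Sj(1)] Sj(2) by simp
    moreover have "e j \<noteq> 0" unfolding e_def by (rule dir_nz)
    ultimately obtain c where c: "v (S j) - v j = c *\<^sub>R e j" using det2_zero_imp_scaleR by blast
    have "S j \<noteq> j" using pI(2)[OF Sj(1)] Sj(2) by simp
    moreover have "S j \<noteq> p j"
    proof
      assume *: "S j = p j"
      then have *: "S (S j) = j" using pI(3)[OF j] by simp
      consider "j + 1 < n" | "j + 1 = n" | "j = n" using j by force
      then show False
      proof cases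
        case 1
        then have "S j = j + 1" "S (j + 1) = j + 2" by (simp_all add: S_def)
        then show False using * by simp
      next
        case 2
        then have "S j = n" "S n = 1" by (auto simp: S_def)
        then show False using * 2 n by simp
      next
        case 3
        then have "S j = 1" "S 1 = 2" using n by (auto simp: S_def)
        then show False using * 3 n by simp
      qed
    qed
    \<comment> \<open>The point \<open>v j\<close> is strictly to the left of side
      \<open>S j\<close>, and \<open>v (S j)\<close> is on it. As the turn between the two sides is
      to the left, the edge must point along \<open>e j\<close>, that is,
      \<open>c > 0\<close>.\<close>
    ultimately have "det2 (e (S j)) (v j) > - 1" using f_pos[OF Sj(1) j] by simp
    moreover have "det2 (e (S j)) (v (S j)) = det2 (e (S j)) (v j) + c * d (S j) j"
      using arg_cong[OF c, of "det2 (e (S j))"] by (simp add: d_def)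
    ultimately have "c * d j (S j) > 0" using f_zero(1)[OF Sj(1)] by (simp add: d_swap[of "S j" j])
    then have "c > 0" using d_S[OF j] by (simp add: zero_less_mult_iff)
    moreover have "j \<noteq> p k" using k pI(3)[OF k(1)] by auto
    then have "det2 (e j) (v k - v j) > 0" using f_pos[OF j k(1)] k f_zero(1)[OF j] by simp
    ultimately show "signed_area2 (v j) (v (Suc (j mod n))) (v k) > 0"
      unfolding signed_area2_eq S_def[symmetric] c by simp
  qed
  interpret ngon n L \<theta> a v
  proof
    fix j assume j: "j \<in> {1..n}"
    show "v j \<in> L (a j) \<and> v (Suc (j mod n)) \<in> L (a j)"
      using f_zero[OF j] f_zero[OF SI(1)[OF j]] SI(2)[OF j] La[OF j] by (simp add: S_def[symmetric])
  qed (fact num ang bij a1 conv)+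
  show ?thesis using num ang ngon_sides by blast
qed

section \<open>Equal cycles and isomorphic arrangements\<close>

lemma ngon_sides_rotate:
  assumes "ngon_sides n L a" "1 \<le> n"
  shows "\<exists>b. ngon_sides n L b \<and> b 1 = 1"
proof -
  from assms obtain v where bij: "bij_betw a {1..n} {1..n}" and conv: "anticlockwise_convex_ngon n v"
    and sides: "\<And>j. j \<in> {1..n} \<Longrightarrow> v j \<in> L (a j) \<and> v (Suc (j mod n)) \<in> L (a j)"
    and reg: "interior (convex hull (v ` {1..n})) \<in> regions (L ` {1..n})"
    unfolding ngon_sides_def by blast
  obtain t where t: "t \<in> {1..n}" "a t = 1"
    using bij assms(2) unfolding bij_betw_def by (metis atLeastAtMost_iff imageE order_refl)
  define \<sigma> where "\<sigma> j = Suc ((j - 1 + (t - 1)) mod n)" for j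
  have n: "0 < n" using assms by simp
  have \<sigma>I: "\<sigma> j \<in> {1..n}" for j using n by (simp add: \<sigma>_def Suc_le_eq)
  have "inj_on \<sigma> {1..n}"
  proof (rule inj_onI)
    fix i j assume ij: "i \<in> {1..n}" "j \<in> {1..n}" "\<sigma> i = \<sigma> j"
    then have "(i - 1 + (t - 1)) mod n = (j - 1 + (t - 1)) mod n" by (simp add: \<sigma>_def)
    then have "int (i - 1 + (t - 1)) mod int n = int (j - 1 + (t - 1)) mod int n" by (metis of_nat_mod)
    then have "int n dvd int (i - 1 + (t - 1)) - int (j - 1 + (t - 1))" by (simp add: mod_eq_dvd_iff)
    then have "int n dvd int i - int j" using ij by (simp add: of_nat_diff)
    moreover have "\<bar>int i - int j\<bar> < int n" using ij by auto
    ultimately have "int i - int j = 0" using dvd_imp_le_int[of "int i - int j" "int n"] by auto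
    then show "i = j" by simp
  qed
  then have \<sigma>: "bij_betw \<sigma> {1..n} {1..n}"
    using \<sigma>I by (intro bij_betw_imageI endo_inj_surj) auto
  have \<sigma>S: "\<sigma> (Suc (j mod n)) = Suc (\<sigma> j mod n)" if "j \<in> {1..n}" for j
  proof -
    have "\<sigma> (Suc (j mod n)) = Suc ((j + (t - 1)) mod n)" by (simp add: \<sigma>_def mod_add_left_eq)
    also have "j + (t - 1) = Suc (j - 1 + (t - 1))" using that by simp
    also have "Suc (Suc (j - 1 + (t - 1)) mod n) = Suc (\<sigma> j mod n)"
      unfolding \<sigma>_def by (simp only: mod_Suc_eq)
    finally show ?thesis .
  qed
  have "ngon_sides n L (a \<circ> \<sigma>)"
    unfolding ngon_sides_def
  proof (intro conjI exI[of _ "v \<circ> \<sigma>"] ballI)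
    show "bij_betw (a \<circ> \<sigma>) {1..n} {1..n}" by (rule bij_betw_trans[OF \<sigma> bij])
    show "anticlockwise_convex_ngon n (v \<circ> \<sigma>)"
      unfolding anticlockwise_convex_ngon_def
    proof (intro conjI ballI)
      show "3 \<le> n" using conv by (simp add: anticlockwise_convex_ngon_def)
      fix j k assume j: "j \<in> {1..n}" and k: "k \<in> {1..n} - {j, Suc (j mod n)}"
      have "Suc (j mod n) \<in> {1..n}" using n by (simp add: Suc_le_eq)
      then have "\<sigma> k \<in> {1..n} - {\<sigma> j, Suc (\<sigma> j mod n)}"
        using k j \<sigma>I bij_betw_neq[OF \<sigma>] unfolding \<sigma>S[OF j, symmetric] by blast
      then show "signed_area2 ((v \<circ> \<sigma>) j) ((v \<circ> \<sigma>) (Suc (j mod n))) ((v \<circ> \<sigma>) k) > 0"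
        using conv \<sigma>I unfolding anticlockwise_convex_ngon_def comp_def \<sigma>S[OF j] by blast
    qed
    have "(v \<circ> \<sigma>) ` {1..n} = v ` {1..n}" using bij_betw_imp_surj_on[OF \<sigma>] by (metis image_comp)
    then show "interior (convex hull ((v \<circ> \<sigma>) ` {1..n})) \<in> regions (L ` {1..n})" using reg by simp
    fix j assume j: "j \<in> {1..n}"
    show "(v \<circ> \<sigma>) j \<in> L ((a \<circ> \<sigma>) j)" "(v \<circ> \<sigma>) (Suc (j mod n)) \<in> L ((a \<circ> \<sigma>) j)"
      using sides[OF \<sigma>I] by (simp_all add: \<sigma>S[OF j])
  qed
  moreover have "\<sigma> 1 = t"
  proof -
    have "(t - 1) mod n = t - 1" using t(1) n by (intro mod_less) auto
    then show ?thesis using t(1) by (simp add: \<sigma>_def)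
  qed
  then have "(a \<circ> \<sigma>) 1 = 1" using t(2) by simp
  ultimately show ?thesis by blast
qed

lemma cyclic_family_exists:
  assumes "numbered_arrangement n L" "increasing_angles n L \<theta>" "ngon_sides n L a" "a 1 = 1" "4 \<le> n"
  shows "\<exists>e h r. cyclic_family n L a e h r"
proof -
  obtain v where v: "bij_betw a {1..n} {1..n}" "anticlockwise_convex_ngon n v"
    "\<forall>j\<in>{1..n}. v j \<in> L (a j) \<and> v (Suc (j mod n)) \<in> L (a j)"
    using assms(3) unfolding ngon_sides_def by blast
  interpret ngon n L \<theta> a v
    using assms v by unfold_locales blast+
  obtain r where r: "cyc_shape n r a"
    "\<forall>i\<in>{1..n}. \<forall>j\<in>{1..n}. i \<noteq> j \<longrightarrow> (D i j > 0 \<longleftrightarrow> turn r a i j)"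
    using turns by blast
  have "cyclic_family n L a E H r"
    by unfold_locales (use r assms(5) Del_pos in blast)+
  then show ?thesis by blast
qed

lemma cyc_shape_cong:
  assumes "cyc_shape n r a" "\<And>i. i \<in> {1..n} \<Longrightarrow> a i = b i" shows "cyc_shape n r b"
proof -
  have r: "2 \<le> r" "r + 1 \<le> n" using assms(1) by (auto simp: cyc_shape_def)
  have "bij_betw b {1..n} {1..n}"
    using assms bij_betw_cong[of "{1..n}" a b] unfolding cyc_shape_def by blast
  moreover have "strict_mono_on {1..r} b" "strict_mono_on {r+1..n} b"
    using assms r unfolding cyc_shape_def strict_mono_on_def by (metis atLeastAtMost_iff le_trans add_leE)+
  moreover have "b 1 = a 1" "b r = a r" "b (r+1) = a (r+1)" using assms(2) r by auto
  ultimately show ?thesis using assms(1) unfolding cyc_shape_def by metis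
qed

lemma cyc_shape_unique:
  assumes "cyc_shape n r a" "cyc_shape n s a" shows "r = s"
proof -
  have "a (r+1) < a r" "1 \<le> r" "r < n" using assms(1) by (auto simp: cyc_shape_def)
  then show ?thesis using cyc_shape_descent[OF assms(2)] by blast
qed

text \<open>By \<open>precedes_iff\<close> the order along a line depends only on signs. Those of
  \<open>Del\<close> are given by the cyclic order of the positions, and those of \<open>D\<close>
  by \<open>turn\<close>, where \<open>r\<close> is the only descent of the cycle.\<close>

lemma same_cycle_iso:
  assumes "cyclic_family n L a e h r" "cyclic_family n M b e' h' s"
    and ab: "\<And>i. i \<in> {1..n} \<Longrightarrow> a i = b i" and inj: "inj_on L {1..n}" "inj_on M {1..n}"
  shows "iso_trivial_on_subscripts n L M"
proof -
  interpret L: cyclic_family n L a e h r by fact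
  interpret M: cyclic_family n M b e' h' s by fact
  have rs: "r = s" using cyc_shape_unique[OF cyc_shape_cong[OF L.shape ab] M.shape] .
  have turn: "turn r a i j \<longleftrightarrow> turn s b i j" if "i \<in> {1..n}" "j \<in> {1..n}" for i j
    unfolding turn_def rs ab[OF that(1)] ab[OF that(2)] ..
  define \<phi> where "\<phi> = M \<circ> inv_into {1..n} L"
  have \<phi>: "\<phi> (L j) = M j" if "j \<in> {1..n}" for j using inv_into_f_f[OF inj(1) that] by (simp add: \<phi>_def)
  have "arrangement_iso \<phi> (L ` {1..n}) (M ` {1..n})"
    unfolding arrangement_iso_def
  proof (intro conjI ballI)
    show "bij_betw \<phi> (L ` {1..n}) (M ` {1..n})"
      unfolding \<phi>_def
      by (rule bij_betw_trans[OF bij_betw_inv_into[OF inj_on_imp_bij_betw[OF inj(1)]] inj_on_imp_bij_betw[OF inj(2)]])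
    fix l assume "l \<in> L ` {1..n}"
    then obtain x where x: "x \<in> {1..n}" "l = L x" by blast
    have pos: "\<exists>i\<in>{1..n}. y = a i" if "y \<in> {1..n}" for y
      using that bij_betw_imp_surj_on[OF L.bij] by blast
    obtain i where i: "i \<in> {1..n}" "x = a i" using pos[OF x(1)] by blast
    obtain i' where i': "i' \<in> {1..n}" "i \<noteq> i'"
      using L.n4 by (cases "i = 1") (auto intro: that[of 1] that[of 2])
    have e: "e i \<noteq> 0" "e' i \<noteq> 0" using L.cross[OF i(1) i'] M.cross[OF i(1) i'] by auto
    have li: "l = (L \<circ> a) i" "\<phi> l = (M \<circ> b) i" using x i \<phi>[OF x(1)] ab[OF i(1)] by auto
    have "direction_of (1 *\<^sub>R e i) l"
      unfolding li(1) L.direction_of_iff[OF i(1) e(1)] by (metis zero_neq_one)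
    moreover have "direction_of (1 *\<^sub>R e' i) (\<phi> l)"
      unfolding li(2) M.direction_of_iff[OF i(1) e(2)] by (metis zero_neq_one)
    moreover have "precedes (1 *\<^sub>R e i) (meet l m) (meet l k) \<longleftrightarrow>
        precedes (1 *\<^sub>R e' i) (meet (\<phi> l) (\<phi> m)) (meet (\<phi> l) (\<phi> k))"
      if mk: "m \<in> L ` {1..n} - {l}" "k \<in> L ` {1..n} - {l}" for m k
    proof (cases "m = k")
      case True
      then show ?thesis by (simp add: precedes_def)
    next
      case False
      have ex: "\<exists>j\<in>{1..n}. i \<noteq> j \<and> m = (L \<circ> a) j \<and> \<phi> m = (M \<circ> b) j" if m: "m \<in> L ` {1..n} - {l}" for m
      proof -
        obtain y where y: "y \<in> {1..n}" "m = L y" using m by blast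
        obtain j where j: "j \<in> {1..n}" "y = a j" using pos[OF y(1)] by blast
        then show ?thesis using y m li \<phi>[OF y(1)] ab[OF j(1)] by (intro bexI[of _ j]) auto
      qed
      obtain j where j: "j \<in> {1..n}" "i \<noteq> j" "m = (L \<circ> a) j" "\<phi> m = (M \<circ> b) j" using ex[OF mk(1)] by blast
      obtain k' where k': "k' \<in> {1..n}" "i \<noteq> k'" "k = (L \<circ> a) k'" "\<phi> k = (M \<circ> b) k'" using ex[OF mk(2)] by blast
      have jk: "j \<noteq> k'" using False j k' by auto
      have sg: "0 < u * v * w \<longleftrightarrow> ((0 < u) = (0 < v)) = (0 < w)" if "u \<noteq> 0" "v \<noteq> 0" "w \<noteq> 0" for u v w :: real
        using zero_less_mult_iff_eq[of "u * v" w] zero_less_mult_iff_eq[of u v] that by simp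
      note I = i(1) j(1) k'(1) j(2) k'(2) jk
      have "precedes (1 *\<^sub>R e i) (meet l m) (meet l k) \<longleftrightarrow> 0 < L.Del i j k' * L.D i j * L.D i k'"
        unfolding li(1) j(3) k'(3) L.meet_eq[OF i(1) j(1,2)] L.meet_eq[OF i(1) k'(1,2)] L.precedes_iff[OF I(1-5)]
        by simp
      also have "\<dots> \<longleftrightarrow> 0 < M.Del i j k' * M.D i j * M.D i k'"
        using sg[OF L.Del_nz[OF I] L.D_nz[OF I(1,2,4)] L.D_nz[OF I(1,3,5)]]
          sg[OF M.Del_nz[OF I] M.D_nz[OF I(1,2,4)] M.D_nz[OF I(1,3,5)]]
          L.Del_pos_iff[OF I] M.Del_pos_iff[OF I] turn[OF I(1,2)] turn[OF I(1,3)]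
          L.turn_iff[OF I(1,2,4)] L.turn_iff[OF I(1,3,5)] M.turn_iff[OF I(1,2,4)] M.turn_iff[OF I(1,3,5)] by simp
      also have "\<dots> \<longleftrightarrow> precedes (1 *\<^sub>R e' i) (meet (\<phi> l) (\<phi> m)) (meet (\<phi> l) (\<phi> k))"
        unfolding li(2) j(4) k'(4) M.meet_eq[OF i(1) j(1,2)] M.meet_eq[OF i(1) k'(1,2)] M.precedes_iff[OF I(1-5)]
        by simp
      finally show ?thesis .
    qed
    ultimately show "\<exists>u w. direction_of u l \<and> direction_of w (\<phi> l) \<and>
        (\<forall>m\<in>L ` {1..n} - {l}. \<forall>k\<in>L ` {1..n} - {l}.
           precedes u (meet l m) (meet l k) \<longleftrightarrow> precedes w (meet (\<phi> l) (\<phi> m)) (meet (\<phi> l) (\<phi> k)))"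
      by blast
  qed
  then show ?thesis unfolding iso_trivial_on_subscripts_def using \<phi> by blast
qed

definition has_cycle :: "nat \<Rightarrow> (nat \<Rightarrow> (real^2) set) \<Rightarrow> (nat \<Rightarrow> nat) \<Rightarrow> bool" where
  "has_cycle n L a \<longleftrightarrow> numbered_arrangement n L \<and> (\<exists>\<theta>. increasing_angles n L \<theta>) \<and> ngon_sides n L a \<and> a 1 = 1"

lemma has_cycle_family: "has_cycle n L a \<Longrightarrow> 4 \<le> n \<Longrightarrow> \<exists>e h r. cyclic_family n L a e h r"
  unfolding has_cycle_def using cyclic_family_exists by blast

lemma has_cycle_inj: "has_cycle n L a \<Longrightarrow> inj_on L {1..n}"
  by (simp add: has_cycle_def numbered_arrangement_def)

lemma has_cycle_iso:
  assumes "has_cycle n L a" "has_cycle n M b" "4 \<le> n" "\<And>i. i \<in> {1..n} \<Longrightarrow> a i = b i"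
  shows "iso_trivial_on_subscripts n L M"
proof -
  obtain e h r e' h' s where "cyclic_family n L a e h r" "cyclic_family n M b e' h' s"
    using has_cycle_family assms by meson
  then show ?thesis using same_cycle_iso assms has_cycle_inj by blast
qed

lemma iso_triangles_eq:
  assumes L: "has_cycle n L a" and M: "has_cycle n M b" and iso: "iso_trivial_on_subscripts n L M"
  shows "triangles n L = triangles n M"
proof -
  obtain e h where l: "line_family n L e h" using L arrangement_line_family unfolding has_cycle_def by blast
  obtain e' h' where m: "line_family n M e' h'" using M arrangement_line_family unfolding has_cycle_def by blast
  have "forms_triangle n L i j k \<longleftrightarrow> forms_triangle n M i j k" for i j k
    using iso_trivial_same_triangles[OF l m iso has_cycle_inj[OF L], of i j k]
      iso_trivial_same_triangles[OF m l iso_trivial_sym[OF iso has_cycle_inj[OF L]] has_cycle_inj[OF M], of i j k]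
    by blast
  then show ?thesis unfolding triangles_def by simp
qed

lemma triangles_eq_cycle:
  assumes "has_cycle n L a" "has_cycle n M b" "4 \<le> n" "triangles n L = triangles n M" "i \<in> {1..n}"
  shows "a i = b i"
proof -
  obtain e h r e' h' s where c: "cyclic_family n L a e h r" "cyclic_family n M b e' h' s"
    using has_cycle_family assms by meson
  interpret L: cyclic_family n L a e h r by (rule c(1))
  interpret M: cyclic_family n M b e' h' s by (rule c(2))
  show ?thesis
    using triangles_determine_cycle[OF L.shape M.shape L.n4 _ assms(5)] assms(4)
    unfolding L.triangles_eq M.triangles_eq by blast
qed

lemma map_cycle_of_list: "distinct xs \<Longrightarrow> map (cycle_of_list xs) xs = rotate1 xs"
  using cyclic_rotation[of xs "Suc 0"] by (simp add: rotate_def)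

text \<open>The permutation maps \<open>a i\<close> to \<open>a (i+1)\<close>, so together with the
  common starting value 1 it determines all values by induction.\<close>

lemma gonality_cycle_eq_iff:
  assumes "bij_betw a {1..n} {1..n}" "bij_betw b {1..n} {1..n}" "a 1 = 1" "b 1 = 1"
  shows "gonality_cycle n a = gonality_cycle n b \<longleftrightarrow> (\<forall>i\<in>{1..n}. a i = b i)"
proof
  assume "\<forall>i\<in>{1..n}. a i = b i"
  then have "map a [1..<Suc n] = map b [1..<Suc n]" by auto
  then show "gonality_cycle n a = gonality_cycle n b" by (simp only: gonality_cycle_def)
next
  assume eq: "gonality_cycle n a = gonality_cycle n b"
  have step: "gonality_cycle n c (c i) = c (i+1)" if bij: "bij_betw c {1..n} {1..n}" and i: "1 \<le> i" "i < n" for c i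
  proof -
    let ?xs = "map c [1..<Suc n]"
    have "distinct ?xs"
      using bij_betw_imp_inj_on[OF bij] by (simp add: distinct_map atLeastLessThanSuc_atLeastAtMost del: upt_Suc)
    then have "map (cycle_of_list ?xs) ?xs = rotate1 ?xs" by (rule map_cycle_of_list)
    then have "map (cycle_of_list ?xs) ?xs ! (i-1) = rotate1 ?xs ! (i-1)" by (simp only:)
    moreover have "rotate1 ?xs ! (i-1) = ?xs ! i"
      using i by (subst nth_rotate1) (auto simp del: upt_Suc)
    ultimately show ?thesis using i by (simp add: gonality_cycle_def add.commute[of 1 i] del: upt_Suc)
  qed
  have "a (Suc i) = b (Suc i)" if "i < n" for i
    using that
  proof (induction i)
    case 0
    then show ?case using assms by (simp add: One_nat_def)
  next
    case (Suc i)
    then have "a (Suc i) = b (Suc i)" by simp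
    then show ?case using step[OF assms(1), of "Suc i"] step[OF assms(2), of "Suc i"] Suc.prems eq by (simp add: One_nat_def)
  qed
  then show "\<forall>i\<in>{1..n}. a i = b i" by (metis Suc_pred' atLeastAtMost_iff Suc_le_eq le_eq_less_or_eq less_one not_less)
qed

section \<open>Counting the cycles\<close>

text \<open>Lists rather than functions, because \<open>cyc_shape\<close> leaves \<open>a\<close>
  free outside \<open>{1..n}\<close> and the cycles are to be counted.\<close>

definition cycle_lists :: "nat \<Rightarrow> nat list set" where
  "cycle_lists n = {map a [1..<Suc n] | a. \<exists>r. cyc_shape n r a}"

lemma map_upt_eq_iff: "map a [1..<Suc n] = map b [1..<Suc n] \<longleftrightarrow> (\<forall>i\<in>{1..n}. a i = b i)"
  by (auto simp: atLeastLessThanSuc_atLeastAtMost simp del: upt_Suc)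

text \<open>The ascending run \<open>A = a ` {1..r}\<close> determines the cycle; the sets \<open>A\<close> that occur are those
  containing \<open>1\<close> that are not an initial segment of \<open>{1..n}\<close>.\<close>

definition ascending_runs :: "nat \<Rightarrow> nat set set" where
  "ascending_runs n = {A. A \<subseteq> {1..n} \<and> 1 \<in> A} - (\<lambda>m. {1..m}) ` {1..n}"

lemma card_ascending_runs: assumes "1 \<le> n" shows "card (ascending_runs n) = 2 ^ (n - 1) - n"
proof -
  have "{A. A \<subseteq> {1..n} \<and> 1 \<in> A} = insert 1 ` Pow {2..n}"
  proof safe
    fix A assume A: "A \<subseteq> {1..n}" "1 \<in> A"
    then have "A = insert 1 (A - {1})" "A - {1} \<in> Pow {2..n}" by force+
    then show "A \<in> insert 1 ` Pow {2..n}" by blast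
  qed (use assms in auto)
  moreover have "inj_on (insert 1) (Pow {2..n})" 
  proof (rule inj_onI)
    have e: "z = insert 1 z - {1}" if "z \<in> Pow {2..n}" for z using that by auto
    fix x y assume "x \<in> Pow {2..n}" "y \<in> Pow {2..n}" "insert 1 x = insert 1 y"
    then show "x = y" using e by metis
  qed
  ultimately have "card {A. A \<subseteq> {1..n} \<and> 1 \<in> A} = 2 ^ (n - 1)"
    using assms by (simp add: card_image card_Pow Suc_diff_le numeral_eq_Suc One_nat_def)
  moreover have "card ((\<lambda>m. {1..m}) ` {1..n}) = n"
    by (subst card_image) (auto intro!: inj_onI simp: atLeastatMost_subset_iff set_eq_subset)
  moreover have "(\<lambda>m. {1..m}) ` {1..n} \<subseteq> {A. A \<subseteq> {1..n} \<and> 1 \<in> A}" by auto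
  ultimately show ?thesis unfolding ascending_runs_def by (subst card_Diff_subset) auto
qed

definition run_list :: "nat \<Rightarrow> nat set \<Rightarrow> nat list" where
  "run_list n A = sorted_list_of_set A @ sorted_list_of_set ({1..n} - A)"

lemma sorted_list_of_strict_mono:
  assumes "strict_mono_on {i..j} a"
  shows "map a [i..<Suc j] = sorted_list_of_set (a ` {i..j})"
proof -
  have "sorted_wrt (<) (map a [i..<Suc j])"
    unfolding sorted_wrt_map
    by (rule sorted_wrt_mono_rel[OF _ sorted_wrt_upt]) (use assms in \<open>auto simp: strict_mono_on_def simp del: upt_Suc\<close>)
  then have "sorted_list_of_set (set (map a [i..<Suc j])) = map a [i..<Suc j]"
    by (intro sorted_list_of_set.idem_if_sorted_distinct) (auto simp: strict_sorted_iff)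
  then show ?thesis by (simp add: atLeastLessThanSuc_atLeastAtMost del: upt_Suc)
qed

text \<open>If the first run were an initial segment \<open>{1..m}\<close>, then
  \<open>a (r+1)\<close> would exceed \<open>m \<ge> a r\<close>, against the descent.\<close>

lemma cyc_shape_run_list:
  assumes shape: "cyc_shape n r a"
  shows "map a [1..<Suc n] = run_list n (a ` {1..r})" "a ` {1..r} \<in> ascending_runs n"
proof -
  have r: "2 \<le> r" "r + 1 \<le> n" and a1: "a 1 = 1" and bij: "bij_betw a {1..n} {1..n}" and desc: "a (r+1) < a r"
    and sm: "strict_mono_on {1..r} a" "strict_mono_on {r+1..n} a"
    using shape by (auto simp: cyc_shape_def)
  have sp: "{1..n} = {1..r} \<union> {r+1..n}" "{1..r} \<inter> {r+1..n} = {}" using r by auto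
  have im: "a ` {1..n} = {1..n}" using bij by (rule bij_betw_imp_surj_on)
  have inj: "inj_on a {1..n}" using bij by (rule bij_betw_imp_inj_on)
  have "a ` {r+1..n} = a ` ({1..n} - {1..r})" using sp by (intro arg_cong[of _ _ "(`) a"]) blast
  also have "\<dots> = {1..n} - a ` {1..r}" using inj_on_image_set_diff[OF inj, of "{1..n}" "{1..r}"] r im by auto
  finally have B: "a ` {r+1..n} = {1..n} - a ` {1..r}" .
  have "[1..<Suc n] = [1..<Suc r] @ [r+1..<Suc n]"
    using upt_add_eq_append[of 1 "Suc r" "n - r"] r by (simp flip: Suc_eq_plus1 del: upt_Suc)
  then show "map a [1..<Suc n] = run_list n (a ` {1..r})"
    unfolding run_list_def B[symmetric] by (simp only: map_append sorted_list_of_strict_mono[OF sm(1)] sorted_list_of_strict_mono[OF sm(2)])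
  have "a ` {1..r} \<noteq> {1..m}" for m
  proof
    assume *: "a ` {1..r} = {1..m}"
    have "a r \<in> {1..m}" using * r by auto
    moreover have "a (r+1) \<in> {1..n}" "a (r+1) \<notin> {1..m}" using B r unfolding * by auto
    ultimately show False using desc by auto
  qed
  moreover have "a ` {1..r} \<subseteq> {1..n}" "1 \<in> a ` {1..r}" using im sp a1 r by (blast, force)
  ultimately show "a ` {1..r} \<in> ascending_runs n" unfolding ascending_runs_def by blast
qed

text \<open>Without a descent at \<open>r\<close>, every element of \<open>A\<close> would be at
  most \<open>a r\<close>, and every element of the complement at least \<open>a (r+1)\<close>, so
  \<open>A\<close> would be the initial segment \<open>{1..a r}\<close>. The segments
  \<open>{1}\<close> and \<open>{1..n}\<close> rule out \<open>r = 1\<close> and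
  \<open>r = n\<close>.\<close>

lemma run_list_cyc_shape:
  assumes A: "A \<in> ascending_runs n"
  shows "\<exists>a. cyc_shape n (card A) a \<and> map a [1..<Suc n] = run_list n A"
proof -
  have sub: "A \<subseteq> {1..n}" and 1: "1 \<in> A" and no: "\<And>m. m \<in> {1..n} \<Longrightarrow> A \<noteq> {1..m}"
    using A by (auto simp: ascending_runs_def)
  define B where "B = {1..n} - A"
  have fin: "finite A" "finite B" using sub finite_subset by (auto simp: B_def)
  define r where "r = card A"
  have cB: "card B = n - r" "r \<le> n" using card_Diff_subset[OF fin(1) sub] card_mono[OF _ sub] by (auto simp: B_def r_def)
  define a where "a i = run_list n A ! (i - 1)" for i
  have len: "length (run_list n A) = n" using cB by (simp add: run_list_def B_def[symmetric] r_def)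
  have map: "map a [1..<Suc n] = run_list n A"
    by (rule nth_equalityI) (auto simp: len a_def simp del: upt_Suc)
  have set: "set (run_list n A) = {1..n}" using fin sub by (auto simp: run_list_def B_def)
  have dist: "distinct (run_list n A)" using fin by (auto simp: run_list_def B_def[symmetric]) (auto simp: B_def)
  have im: "a ` {1..n} = {1..n}"
    using arg_cong[OF map, of set] set by (simp add: atLeastLessThanSuc_atLeastAtMost del: upt_Suc)
  have "inj_on a {1..n}" using dist unfolding map[symmetric] by (simp add: distinct_map atLeastLessThanSuc_atLeastAtMost del: upt_Suc)
  then have bij: "bij_betw a {1..n} {1..n}" using im by (simp add: bij_betw_def)
  have aA: "a i = sorted_list_of_set A ! (i - 1)" if "1 \<le> i" "i \<le> r" for i
    using that by (simp add: a_def run_list_def nth_append r_def)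
  have aB: "a i = sorted_list_of_set B ! (i - 1 - r)" if "r < i" for i
    using that by (simp add: a_def run_list_def nth_append r_def B_def)
  have inA: "a i \<in> A" if "1 \<le> i" "i \<le> r" for i
    using that nth_mem[of "i-1" "sorted_list_of_set A"] fin by (simp add: aA r_def)
  have inB: "a i \<in> B" if "r < i" "i \<le> n" for i
    using that nth_mem[of "i-1-r" "sorted_list_of_set B"] fin cB by (simp add: aB)
  have sw: "sorted_wrt (<) (sorted_list_of_set X)" for X :: "nat set" by (rule strict_sorted_list_of_set)
  have smA: "strict_mono_on {1..r} a"
  proof (rule strict_mono_onI)
    fix i j assume "i \<in> {1..r}" "j \<in> {1..r}" "i < j"
    then show "a i < a j" using sorted_wrt_nth_less[OF sw[of A], of "i-1" "j-1"] by (simp add: aA r_def)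
  qed
  have smB: "strict_mono_on {r+1..n} a"
  proof (rule strict_mono_onI)
    fix i j assume "i \<in> {r+1..n}" "j \<in> {r+1..n}" "i < j"
    then show "a i < a j" using sorted_wrt_nth_less[OF sw[of B], of "i-1-r" "j-1-r"] cB by (simp add: aB)
  qed
  have n1: "1 \<le> n" using sub 1 by auto
  have r1: "1 \<le> r" using 1 fin by (auto simp: r_def Suc_le_eq card_gt_0_iff One_nat_def)
  have Aim: "A = a ` {1..r}"
    using inA fin by (intro card_subset_eq[symmetric]) (auto simp: r_def card_image strict_mono_on_imp_inj_on[OF smA, unfolded r_def])
  have a1: "a 1 = 1"
  proof -
    obtain i where i: "i \<in> {1..r}" "a i = 1" using 1 Aim by force
    have "a 1 \<ge> 1" using inA[of 1] r1 sub by auto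
    moreover have "a 1 \<le> a i" using strict_mono_on_leD[OF smA, of 1 i] i r1 by auto
    ultimately show ?thesis using i by simp
  qed
  have "r \<noteq> 1"
  proof
    assume "r = 1"
    then have "A = {1..1}" using Aim a1 by simp
    then show False using no[of 1] n1 by simp
  qed
  then have r2: "2 \<le> r" using r1 by simp
  have "r \<noteq> n"
  proof
    assume "r = n"
    then have "A = {1..n}" using Aim im by simp
    then show False using no[of n] n1 by simp
  qed
  then have rn: "r + 1 \<le> n" using cB by simp
  have "a (r+1) \<in> B" using inB rn by simp
  then have b1: "1 < a (r+1)" using 1 by (auto simp: B_def) (metis le_neq_implies_less)
  have "a (r+1) < a r"
  proof (rule ccontr)
    assume *: "\<not> a (r+1) < a r"
    have le: "x \<le> a r" if x: "x \<in> A" for x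
    proof -
      obtain i where i: "i \<in> {1..r}" "x = a i" using x Aim by blast
      then show ?thesis using strict_mono_on_leD[OF smA, of i r] r1 by auto
    qed
    have ge: "a (r+1) \<le> y" if y: "y \<in> B" for y
    proof -
      have "y \<in> a ` {1..n}" using y im by (simp add: B_def)
      then obtain i where i: "i \<in> {1..n}" "y = a i" by blast
      then have "r < i" using inA[of i] y by (cases "i \<le> r") (auto simp: B_def)
      then show ?thesis using strict_mono_on_leD[OF smB, of "r+1" i] i rn by auto
    qed
    have "A = {1..a r}"
    proof safe
      fix x assume "x \<in> A" then show "x \<in> {1..a r}" using le sub by auto
    next
      fix x assume x: "x \<in> {1..a r}"
      have "a r \<in> A" using inA r1 by simp
      then have "x \<in> {1..n}" using x sub by force
      show "x \<in> A"
      proof (rule ccontr)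
        assume "x \<notin> A"
        then have "a (r+1) \<le> x" using ge \<open>x \<in> {1..n}\<close> by (simp add: B_def)
        then have "a (r+1) = a r" using x * by simp
        then show False using \<open>a (r+1) \<in> B\<close> \<open>a r \<in> A\<close> by (simp add: B_def)
      qed
    qed
    then show False using no[of "a r"] inA[of r] r1 sub by auto
  qed
  then have "cyc_shape n r a" unfolding cyc_shape_def using bij a1 r2 rn smA smB b1 by blast
  then show ?thesis using map unfolding r_def by blast
qed

lemma card_cycle_lists: assumes "1 \<le> n" shows "card (cycle_lists n) = 2 ^ (n - 1) - n"
proof -
  have "cycle_lists n = run_list n ` ascending_runs n"
    unfolding cycle_lists_def
  proof safe
    fix a r assume "cyc_shape n r a"
    then show "map a [1..<Suc n] \<in> run_list n ` ascending_runs n" using cyc_shape_run_list by blast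
  next
    fix A assume "A \<in> ascending_runs n"
    then show "\<exists>a. run_list n A = map a [1..<Suc n] \<and> (\<exists>r. cyc_shape n r a)" using run_list_cyc_shape by metis
  qed
  \<comment> \<open>The list determines \<open>card A\<close> as the place of its only descent, and
    then \<open>A\<close> as the set of entries up to there.\<close>
  moreover have "inj_on (run_list n) (ascending_runs n)"
  proof (rule inj_onI)
    fix A A' assume A: "A \<in> ascending_runs n" "A' \<in> ascending_runs n" "run_list n A = run_list n A'"
    obtain a where a: "cyc_shape n (card A) a" "map a [1..<Suc n] = run_list n A" using run_list_cyc_shape[OF A(1)] by blast
    obtain b where b: "cyc_shape n (card A') b" "map b [1..<Suc n] = run_list n A'" using run_list_cyc_shape[OF A(2)] by blast
    have "\<forall>i\<in>{1..n}. b i = a i" using a(2) b(2) A(3) map_upt_eq_iff by metis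
    then have c: "card A = card A'" using cyc_shape_unique[OF a(1) cyc_shape_cong[OF b(1)]] by blast
    have "set (take (card X) (run_list n X)) = X" if "X \<in> ascending_runs n" for X
    proof -
      have "finite X" using that finite_subset by (auto simp: ascending_runs_def)
      then show ?thesis by (simp add: run_list_def)
    qed
    then show "A = A'" using A c by metis
  qed
  ultimately show ?thesis using card_ascending_runs[OF assms] by (simp add: card_image)
qed

section \<open>Isomorphism classes and the final statement\<close>

lemma card_quotient_kernel: "card (X // {(x, y). x \<in> X \<and> y \<in> X \<and> f x = f y}) = card (f ` X)"
proof -
  have "X // {(x, y). x \<in> X \<and> y \<in> X \<and> f x = f y} = (\<lambda>k. {y \<in> X. f y = k}) ` f ` X"
    by (force simp: quotient_def image_iff)
  moreover have "inj_on (\<lambda>k. {y \<in> X. f y = k}) (f ` X)" by (rule inj_onI) blast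
  ultimately show ?thesis by (simp add: card_image)
qed

text \<open>Two arrangements are related iff their cycle lists agree, so the classes correspond to
  the lists that occur; by \<open>ngon_realization\<close> these are all of
  \<open>cycle_lists n\<close>.\<close>

lemma card_isomorphism_classes:
  assumes n: "4 \<le> n"
  shows "card (globally_cyclic_arrangements n // trivial_iso_relation n) = 2 ^ (n - 1) - n"
proof -
  let ?X = "globally_cyclic_arrangements n"
  have ex: "\<exists>a. has_cycle n L a" if "L \<in> ?X" for L
    using that ngon_sides_rotate[of n L] n unfolding globally_cyclic_arrangements_def global_cyclicity_def has_cycle_def by fastforce
  have X: "L \<in> ?X" if "has_cycle n L a" for L a
    using that unfolding globally_cyclic_arrangements_def global_cyclicity_def has_cycle_def by blast
  define g where "g L = (SOME a. has_cycle n L a)" for L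
  define f where "f L = map (g L) [1..<Suc n]" for L
  have g: "has_cycle n L (g L)" if "L \<in> ?X" for L unfolding g_def using ex[OF that] by (rule someI_ex)
  \<comment> \<open>The cycle does not depend on the choice made in \<open>g\<close>:
    \<open>triangles_eq_cycle\<close>, applied to the same arrangement twice, makes it
    unique.\<close>
  have f: "f L = map a [1..<Suc n]" if "has_cycle n L a" for L a
    unfolding f_def map_upt_eq_iff using triangles_eq_cycle[OF g[OF X[OF that]] that n refl] by blast
  have "iso_trivial_on_subscripts n L M \<longleftrightarrow> f L = f M" if "L \<in> ?X" "M \<in> ?X" for L M
    unfolding f_def map_upt_eq_iff
    using has_cycle_iso[OF g[OF that(1)] g[OF that(2)] n]
      triangles_eq_cycle[OF g[OF that(1)] g[OF that(2)] n iso_triangles_eq[OF g[OF that(1)] g[OF that(2)]]] by blast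
  then have "trivial_iso_relation n = {(L, M). L \<in> ?X \<and> M \<in> ?X \<and> f L = f M}"
    unfolding trivial_iso_relation_def by blast
  then have "card (?X // trivial_iso_relation n) = card (f ` ?X)" by (simp only: card_quotient_kernel)
  also have "f ` ?X = cycle_lists n"
  proof safe
    fix L assume "L \<in> ?X"
    then obtain e h r where c: "cyclic_family n L (g L) e h r" using has_cycle_family[OF g n] by blast
    then have "cyc_shape n r (g L)" by (rule cyclic_family.shape)
    then show "f L \<in> cycle_lists n" unfolding cycle_lists_def f_def by blast
  next
    fix xs assume "xs \<in> cycle_lists n"
    then obtain a r where a: "xs = map a [1..<Suc n]" "cyc_shape n r a" unfolding cycle_lists_def by blast
    then obtain L \<theta> where "numbered_arrangement n L" "increasing_angles n L \<theta>" "ngon_sides n L a"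
      using ngon_realization[OF _ n] by meson
    then have L: "has_cycle n L a" using a(2) unfolding has_cycle_def cyc_shape_def by blast
    show "xs \<in> f ` ?X" unfolding a(1) f[OF L, symmetric] using X[OF L] by (rule imageI)
  qed
  also have "card (cycle_lists n) = 2 ^ (n - 1) - n" using n by (intro card_cycle_lists) simp
  finally show ?thesis .
qed

text \<open>The implications close up: an isomorphism preserves triangles, the triangles determine
  the cycle, and equal cycles give an isomorphism.\<close>

lemma cycle_equivalences:
  assumes L: "has_cycle n L a" and M: "has_cycle n M b" and n: "4 \<le> n"
  shows "iso_trivial_on_subscripts n L M \<longleftrightarrow> gonality_cycle n a = gonality_cycle n b"
    and "gonality_cycle n a = gonality_cycle n b \<longleftrightarrow> triangles n L = triangles n M"
proof -
  have "gonality_cycle n a = gonality_cycle n b \<longleftrightarrow> (\<forall>i\<in>{1..n}. a i = b i)"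
    using L M unfolding has_cycle_def ngon_sides_def by (intro gonality_cycle_eq_iff) blast+
  then show "iso_trivial_on_subscripts n L M \<longleftrightarrow> gonality_cycle n a = gonality_cycle n b"
    "gonality_cycle n a = gonality_cycle n b \<longleftrightarrow> triangles n L = triangles n M"
    using has_cycle_iso[OF L M n] iso_triangles_eq[OF L M] triangles_eq_cycle[OF L M n] by blast+
qed

text \<open>The given \<open>r\<close> is the one underlying \<open>cyclic_family\<close>, since the
  place of the descent is unique.\<close>

lemma cycle_triangles:
  assumes L: "has_cycle n L a" and n: "4 \<le> n" and r: "2 \<le> r \<and> r \<le> n - 1 \<and>
           strict_mono_on {1..r} a \<and> strict_mono_on {r+1..n} a \<and> 1 < a (r+1) \<and> a (r+1) < a r"
  shows "triangles n L =
             {{a j, a (j+1), a (j+2)} | j. 1 \<le> j \<and> j + 2 \<le> r \<or> r + 1 \<le> j \<and> j + 2 \<le> n} \<union>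
             (if n \<ge> r + 2 then {{a 1, a (n-1), a n}} else {}) \<union>
             (if a 2 < a n then {{a 1, a 2, a n}} else {}) \<union>
             (if a (r+1) < a (r-1) then {{a (r+1), a (r-1), a r}} else {}) \<union>
             (if a (r+2) < a r \<and> n \<ge> r + 2 then {{a (r+1), a (r+2), a r}} else {})"
proof -
  obtain e h s where c: "cyclic_family n L a e h s" using has_cycle_family[OF L n] by blast
  interpret cyclic_family n L a e h s by (rule c)
  have "r + 1 \<le> n" using r n by auto
  then have shape': "cyc_shape n r a" using r L bij unfolding cyc_shape_def has_cycle_def by blast
  then have "s = r" using cyc_shape_unique[OF shape] by blast
  then show ?thesis using triangles_eq image_position_triangles[OF shape' n] by simp
qed

lemma cycle_triangle_classes:
  assumes "has_cycle n L a" "4 \<le> n" shows "card (triangles n L // triangle_equivalence n L) \<le> 2"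
proof -
  obtain e h r where "cyclic_family n L a e h r" using has_cycle_family[OF assms] by blast
  then have "card (triangles n L // triangle_equivalence n L) \<le> 1" by (rule cyclic_family.card_triangle_classes)
  then show ?thesis by simp
qed

theorem theoremA:
  fixes n :: nat
  assumes "n \<ge> 4"
  shows
    "(\<forall>(L :: nat \<Rightarrow> nat \<Rightarrow> (real^2) set) (\<theta> :: nat \<Rightarrow> nat \<Rightarrow> real) (a :: nat \<Rightarrow> nat \<Rightarrow> nat).
        (\<forall>i\<in>{1,2}. numbered_arrangement n (L i) \<and> increasing_angles n (L i) (\<theta> i) \<and>
                   global_cyclicity n (L i) \<and> ngon_sides n (L i) (a i) \<and> a i 1 = 1) \<longrightarrow>
        (iso_trivial_on_subscripts n (L 1) (L 2) \<longleftrightarrow>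
           gonality_cycle n (a 1) = gonality_cycle n (a 2)) \<and>
        (gonality_cycle n (a 1) = gonality_cycle n (a 2) \<longleftrightarrow>
           (\<forall>i j k. 1 \<le> i \<and> i < j \<and> j < k \<and> k \<le> n \<longrightarrow>
              (forms_triangle n (L 1) i j k \<longleftrightarrow> forms_triangle n (L 2) i j k))) \<and>
        (\<forall>i\<in>{1,2}. card (triangles n (L i) // triangle_equivalence n (L i)) \<le> 2) \<and>
        (\<forall>i\<in>{1,2}. \<forall>r. 2 \<le> r \<and> r \<le> n - 1 \<and>
           strict_mono_on {1..r} (a i) \<and> strict_mono_on {r+1..n} (a i) \<and>
           1 < a i (r+1) \<and> a i (r+1) < a i r \<longrightarrow>
           triangles n (L i) =
             {{a i j, a i (j+1), a i (j+2)} | j. 1 \<le> j \<and> j + 2 \<le> r \<or> r + 1 \<le> j \<and> j + 2 \<le> n} \<union>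
             (if n \<ge> r + 2 then {{a i 1, a i (n-1), a i n}} else {}) \<union>
             (if a i 2 < a i n then {{a i 1, a i 2, a i n}} else {}) \<union>
             (if a i (r+1) < a i (r-1) then {{a i (r+1), a i (r-1), a i r}} else {}) \<union>
             (if a i (r+2) < a i r \<and> n \<ge> r + 2 then {{a i (r+1), a i (r+2), a i r}} else {})))
     \<and> card (globally_cyclic_arrangements n // trivial_iso_relation n) = 2 ^ (n - 1) - n"
proof (intro conjI allI impI card_isomorphism_classes[OF assms])
  fix L :: "nat \<Rightarrow> nat \<Rightarrow> (real^2) set" and \<theta> :: "nat \<Rightarrow> nat \<Rightarrow> real" and a :: "nat \<Rightarrow> nat \<Rightarrow> nat"
  assume "\<forall>i\<in>{1,2}. numbered_arrangement n (L i) \<and> increasing_angles n (L i) (\<theta> i) \<and>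
                   global_cyclicity n (L i) \<and> ngon_sides n (L i) (a i) \<and> a i 1 = 1"
  then have c: "has_cycle n (L i) (a i)" if "i \<in> {1,2}" for i
    using that unfolding has_cycle_def by blast
  then have "has_cycle n (L 1) (a 1)" "has_cycle n (L 2) (a 2)" by blast+
  note equiv = cycle_equivalences[OF this assms]
  show "iso_trivial_on_subscripts n (L 1) (L 2) \<longleftrightarrow> gonality_cycle n (a 1) = gonality_cycle n (a 2)"
    by (rule equiv(1))
  show "gonality_cycle n (a 1) = gonality_cycle n (a 2) \<longleftrightarrow>
           (\<forall>i j k. 1 \<le> i \<and> i < j \<and> j < k \<and> k \<le> n \<longrightarrow>
              (forms_triangle n (L 1) i j k \<longleftrightarrow> forms_triangle n (L 2) i j k))"
    unfolding equiv(2) by (rule triangles_eq_iff)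
  show "\<forall>i\<in>{1,2}. card (triangles n (L i) // triangle_equivalence n (L i)) \<le> 2"
    using cycle_triangle_classes[OF c assms] by blast
  show "\<forall>i\<in>{1,2}. \<forall>r. 2 \<le> r \<and> r \<le> n - 1 \<and>
           strict_mono_on {1..r} (a i) \<and> strict_mono_on {r+1..n} (a i) \<and>
           1 < a i (r+1) \<and> a i (r+1) < a i r \<longrightarrow>
           triangles n (L i) =
             {{a i j, a i (j+1), a i (j+2)} | j. 1 \<le> j \<and> j + 2 \<le> r \<or> r + 1 \<le> j \<and> j + 2 \<le> n} \<union>
             (if n \<ge> r + 2 then {{a i 1, a i (n-1), a i n}} else {}) \<union>
             (if a i 2 < a i n then {{a i 1, a i 2, a i n}} else {}) \<union>
             (if a i (r+1) < a i (r-1) then {{a i (r+1), a i (r-1), a i r}} else {}) \<union>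
             (if a i (r+2) < a i r \<and> n \<ge> r + 2 then {{a i (r+1), a i (r+2), a i r}} else {})"
    by (intro ballI allI impI cycle_triangles[OF c assms])
qed

end
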